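(* Let $\mathcal{E}$ be a locally cartesian closed category with a chosen object $I$ and chosen pullbacks (so that $\mathrm{cod}\colon\mathcal{E}^{\mathbf 2}\to\mathcal{E}$ is a cloven Grothendieck fibration). Suppose given structured trivial fibrations $u\colon \mathsf{TFib}\to\mathcal{E}^{\mathbf 2}$ satisfying the conditions (STF0), (STF1), (STF2), (STF3) stated in the context, and let $u\colon\mathsf{Fib}_{\mathrm{cart}}\to\mathcal{E}^{\mathbf 2}_{\mathrm{cart}}$ be the resulting category of stably structured fibrations. Then the pushforward functor $\Pi\colon\mathcal{E}^{\mathbf 3}_{\mathrm{cart}}\to\mathcal{E}^{\mathbf 2}_{\mathrm{cart}}$, $(q,p)\mapsto p_*q$, lifts to $\mathsf{Fib}_{\mathrm{cart}}$: there is a functor $$\widetilde{\Pi}\colon \mathsf{Fib}_{\mathrm{cart}}\times_{\mathcal{E}}\mathsf{Fib}_{\mathrm{cart}}\to\mathsf{Fib}_{\mathrm{cart}}$$ with $u\circ\widetilde{\Pi}=\Pi\circ(u\times u)$, and it is a cartesian functor (over $\mathcal{E}$, via codomain).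
   Context: Categories of diagrams. $\mathbf 1,\mathbf 2,\mathbf 3,\mathbf 4$ are the ordinals regarded as categories, so $\mathcal{E}^{\mathbf 2},\mathcal{E}^{\mathbf 3},\mathcal{E}^{\mathbf 4}$ are the categories of arrows, composable pairs and composable triples in $\mathcal{E}$. The subscript $\mathrm{cart}$ denotes the wide subcategory on cartesian natural transformations, i.e. those all of whose naturality squares are pullbacks. $\mathrm{cod}$ sends a string of arrows to its final object, and $\mathrm{ev}_{01}$ sends a string to its first arrow. For $p\colon A\to X$, $p_*\colon\mathcal{E}/A\to\mathcal{E}/X$ is the right adjoint of the pullback functor $p^*$. The functor $\Pi\colon\mathcal{E}^{\mathbf 3}_{\mathrm{cart}}\to\mathcal{E}^{\mathbf 2}_{\mathrm{cart}}$ sends $(q\colon B\to A,\ p\colon A\to X)$ to $p_*q\colon\Pi_AB\to X$. The functor $\Pi\colon\mathcal{E}^{\mathbf 4}_{\mathrm{cart}}\to\mathcal{E}^{\mathbf 3}_{\mathrm{cart}}$ sends $(r\colon C\to B,\ q\colon B\to A,\ p\colon A\to X)$ to the composable pair $(p_*r\colon\Pi_AC\to\Pi_AB,\ p_*q\colon\Pi_AB\to X)$, where $p_*r$ is the action of $p_*$ on $r$ viewed as a morphism $qr\to q$ of $\mathcal{E}/A$. Both are functorial on cartesian transformations by the Beck-Chevalley property. The free retract $\mathbf R$ is the category with two objects $r$ ("retract") and $c$ ("center"), generated by a section $d^2\colon r\to c$ and a retraction $d^0\colon c\to r$ with $d^0d^2=\mathrm{id}_r$. An object of $\mathcal{E}^{\mathbf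 R}$ is a map together with a chosen section, and $d^0\colon\mathcal{E}^{\mathbf R}\to\mathcal{E}^{\mathbf 2}$ forgets the section. $\mathcal{E}^{\mathbf R}_{\mathrm{cart}}$ is the pullback of $d^0\colon\mathcal{E}^{\mathbf R}\to\mathcal{E}^{\mathbf 2}$ along $\mathcal{E}^{\mathbf 2}_{\mathrm{cart}}\hookrightarrow\mathcal{E}^{\mathbf 2}$. $\mathcal{E}^{\mathbf 2\times\mathbf R}_{\mathrm{cart}}$ is the category of retract diagrams of arrows, whose morphisms are the natural transformations whose components between the center arrows and between the retract arrows are pullback squares; $\mathrm{ev}_c,\mathrm{ev}_r\colon\mathcal{E}^{\mathbf 2\times\mathbf R}_{\mathrm{cart}}\to\mathcal{E}^{\mathbf 2}_{\mathrm{cart}}$ send a retract diagram of arrows to its center arrow and its retract arrow. A fibred notion of structure is a functor $u\colon\mathcal{F}\to\mathcal{E}^{\mathbf 2}$ such that $\mathrm{cod}\cdot u\colon\mathcal{F}\to\mathcal{E}$ is a Grothendieck fibration, $u$ is a cartesian functor over $\mathcal{E}$ (from $\mathrm{cod}\cdot u$ to $\mathrm{cod}$), and $u$ restricts to a discrete fibration $u\colon\mathcal{F}_{\mathrm{cart}}\to\mathcal{E}^{\mathbf 2}_{\mathrm{cart}}$ on the wide subcategories of cartesian arrows. A category of stably structured fibrations over $\mathcal{E}$ is a discrete fibration $\mathcal{F}_{\mathrm{cart}}\to\mathcal{E}^{\mathbf 2}_{\mathrm{cart}}$. The conditions are: (STF0) $u\colon\mathsf{TFib}\to\mathcal{E}^{\mathbf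 2}$ is a fibred notion of structure. Hence it restricts to a discrete fibration $u\colon\mathsf{TFib}_{\mathrm{cart}}\to\mathcal{E}^{\mathbf 2}_{\mathrm{cart}}$. (STF1) There is a functor $s\colon\mathsf{TFib}_{\mathrm{cart}}\to\mathcal{E}^{\mathbf R}_{\mathrm{cart}}$ with $d^0\circ s=u$ (a map of discrete fibrations over $\mathcal{E}^{\mathbf 2}_{\mathrm{cart}}$). (STF2) Let $\mathsf{TFib}_{\mathrm{cart}}\times_{\mathcal{E}}\mathcal{E}^{\mathbf 3}_{\mathrm{cart}}$ be the pullback of $u\colon\mathsf{TFib}_{\mathrm{cart}}\to\mathcal{E}^{\mathbf 2}_{\mathrm{cart}}$ along $\mathrm{ev}_{01}\colon\mathcal{E}^{\mathbf 4}_{\mathrm{cart}}\to\mathcal{E}^{\mathbf 2}_{\mathrm{cart}}$ (objects: a structured trivial fibration followed by a composable pair out of its codomain), and let $\mathsf{TFib}_{\mathrm{cart}}\times_{\mathcal{E}}\mathcal{E}^{\mathbf 2}_{\mathrm{cart}}$ be the pullback of $u$ along $\mathrm{ev}_{01}\colon\mathcal{E}^{\mathbf 3}_{\mathrm{cart}}\to\mathcal{E}^{\mathbf 2}_{\mathrm{cart}}$. Write $u\times\mathrm{id}$ for their projections to $\mathcal{E}^{\mathbf 4}_{\mathrm{cart}}$ and $\mathcal{E}^{\mathbf 3}_{\mathrm{cart}}$. There is a functor $\mathsf{TFib}_{\mathrm{cart}}\times_{\mathcal{E}}\mathcal{E}^{\mathbf 3}_{\mathrm{cart}}\to\mathsf{TFib}_{\mathrm{cart}}\times_{\mathcal{E}}\mathcal{E}^{\mathbf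 2}_{\mathrm{cart}}$ lifting $\Pi\colon\mathcal{E}^{\mathbf 4}_{\mathrm{cart}}\to\mathcal{E}^{\mathbf 3}_{\mathrm{cart}}$ strictly along the projections $u\times\mathrm{id}$. (STF3) Let $\mathsf{TFib}_{\mathrm{cart}}\times_{\mathcal{E}^{\mathbf 2}_{\mathrm{cart}}}\mathcal{E}^{\mathbf 2\times\mathbf R}_{\mathrm{cart}}$ be the pullback of $u$ along $\mathrm{ev}_c$ (objects: retract diagrams of arrows whose center arrow is a structured trivial fibration). There is a functor from it to $\mathsf{TFib}_{\mathrm{cart}}$ lifting $\mathrm{ev}_r\colon\mathcal{E}^{\mathbf 2\times\mathbf R}_{\mathrm{cart}}\to\mathcal{E}^{\mathbf 2}_{\mathrm{cart}}$ strictly along the projections. Structured fibrations. For an object $X$ let $\epsilon\colon X^I\times I\to X$ be evaluation. For $p\colon A\to X$, let $A_\epsilon$ be the pullback of $p$ along $\epsilon\colon X^I\times I\to X$, and let $\delta\Rightarrow p\colon A^I\times I\to A_\epsilon$ be the map induced by $p^I\times I$ and $\epsilon\colon A^I\times I\to A$. This defines a functor $\delta\Rightarrow(-)\colon\mathcal{E}^{\mathbf 2}_{\mathrm{cart}}\to\mathcal{E}^{\mathbf 2}_{\mathrm{cart}}$, and $u\colon\mathsf{Fib}_{\mathrm{cart}}\to\mathcal{E}^{\mathbf 2}_{\mathrm{cart}}$ is defined as the pullback of $u\colon\mathsf{TFib}_{\mathrm{cart}}\to\mathcal{E}^{\mathbf 2}_{\mathrm{cart}}$ along $\delta\Rightarrow(-)$.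 The category $\mathsf{Fib}_{\mathrm{cart}}\times_{\mathcal{E}}\mathsf{Fib}_{\mathrm{cart}}$ has as objects pairs of structured fibrations $(q,p)$ with underlying maps composable, $\mathrm{cod}\,q=\mathrm{dom}\,p$ (it is the pullback of $\mathrm{cod}\cdot u$ along $\mathrm{dom}\cdot u$), and $u\times u$ is its forgetful functor to $\mathcal{E}^{\mathbf 3}_{\mathrm{cart}}$. *)

theory Defs
  imports Main
begin

section \<open>Categories and functors\<close>

record ('o, 'm) cat =
  ob :: "'o set"
  ar :: "'m set"
  dm :: "'m \<Rightarrow> 'o"
  cd :: "'m \<Rightarrow> 'o"
  idt :: "'o \<Rightarrow> 'm"
  cmp :: "'m \<Rightarrow> 'm \<Rightarrow> 'm"  (infixl "\<cdot>\<index>" 70)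

definition hom :: "('o, 'm, 'z) cat_scheme \<Rightarrow> 'o \<Rightarrow> 'o \<Rightarrow> 'm set" where
  "hom C x y = {f \<in> ar C. dm C f = x \<and> cd C f = y}"

locale category =
  fixes C :: "('o, 'm, 'z) cat_scheme" (structure)
  assumes dm_ob: "f \<in> ar C \<Longrightarrow> dm C f \<in> ob C"
    and cd_ob: "f \<in> ar C \<Longrightarrow> cd C f \<in> ob C"
    and idt_hom: "x \<in> ob C \<Longrightarrow> idt C x \<in> hom C x x"
    and cmp_hom: "f \<in> hom C x y \<Longrightarrow> g \<in> hom C y z \<Longrightarrow> g \<cdot> f \<in> hom C x z"
    and cmp_idt: "f \<in> hom C x y \<Longrightarrow> f \<cdot> idt C x = f"
    and idt_cmp: "f \<in> hom C x y \<Longrightarrow> idt C y \<cdot> f = f"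
    and cmp_assoc: "f \<in> hom C w x \<Longrightarrow> g \<in> hom C x y \<Longrightarrow> h \<in> hom C y z
      \<Longrightarrow> h \<cdot> g \<cdot> f = h \<cdot> (g \<cdot> f)"

record ('o1, 'm1, 'o2, 'm2) ftor =
  FO :: "'o1 \<Rightarrow> 'o2"
  FA :: "'m1 \<Rightarrow> 'm2"

definition is_functor ::
  "('o1, 'm1, 'z1) cat_scheme \<Rightarrow> ('o2, 'm2, 'z2) cat_scheme \<Rightarrow> ('o1, 'm1, 'o2, 'm2) ftor \<Rightarrow> bool" where
  "is_functor C D F \<longleftrightarrow> category C \<and> category D \<and>
     (\<forall>x\<in>ob C. FO F x \<in> ob D) \<and>
     (\<forall>f\<in>ar C. FA F f \<in> hom D (FO F (dm C f)) (FO F (cd C f))) \<and>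
     (\<forall>x\<in>ob C. FA F (idt C x) = idt D (FO F x)) \<and>
     (\<forall>f\<in>ar C. \<forall>g\<in>ar C. cd C f = dm C g \<longrightarrow> FA F (g \<cdot>\<^bsub>C\<^esub> f) = FA F g \<cdot>\<^bsub>D\<^esub> FA F f)"

definition ftor_comp ::
  "('o2, 'm2, 'o3, 'm3) ftor \<Rightarrow> ('o1, 'm1, 'o2, 'm2) ftor \<Rightarrow> ('o1, 'm1, 'o3, 'm3) ftor"  (infixl "\<circ>\<^sub>F" 55) where
  "G \<circ>\<^sub>F F = \<lparr>FO = FO G \<circ> FO F, FA = FA G \<circ> FA F\<rparr>"

text \<open>Strict equality of functors on \<open>C\<close>; values outside the carriers are irrelevant.\<close>

definition ftor_eq ::
  "('o1, 'm1, 'z) cat_scheme \<Rightarrow> ('o1, 'm1, 'o2, 'm2) ftor \<Rightarrow> ('o1, 'm1, 'o2, 'm2) ftor \<Rightarrow> bool" where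
  "ftor_eq C F G \<longleftrightarrow> (\<forall>x\<in>ob C. FO F x = FO G x) \<and> (\<forall>f\<in>ar C. FA F f = FA G f)"

text \<open>\<open>F \<stileturn> G\<close> with counit \<open>e\<close>, every \<open>e y\<close> being universal from \<open>F\<close> to \<open>y\<close>.\<close>

definition adjunction ::
  "('o1, 'm1, 'z1) cat_scheme \<Rightarrow> ('o2, 'm2, 'z2) cat_scheme \<Rightarrow>
   ('o1, 'm1, 'o2, 'm2) ftor \<Rightarrow> ('o2, 'm2, 'o1, 'm1) ftor \<Rightarrow> ('o2 \<Rightarrow> 'm2) \<Rightarrow> bool" where
  "adjunction C D F G e \<longleftrightarrow> is_functor C D F \<and> is_functor D C G \<and>
     (\<forall>y\<in>ob D. e y \<in> hom D (FO F (FO G y)) y) \<and>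
     (\<forall>k\<in>ar D. k \<cdot>\<^bsub>D\<^esub> e (dm D k) = e (cd D k) \<cdot>\<^bsub>D\<^esub> FA F (FA G k)) \<and>
     (\<forall>x\<in>ob C. \<forall>y\<in>ob D. \<forall>f\<in>hom D (FO F x) y.
        \<exists>!g. g \<in> hom C x (FO G y) \<and> e y \<cdot>\<^bsub>D\<^esub> FA F g = f)"

definition wide_subcat :: "('o, 'm) cat \<Rightarrow> ('m \<Rightarrow> bool) \<Rightarrow> ('o, 'm) cat" where
  "wide_subcat C P = C\<lparr>ar := {f \<in> ar C. P f}\<rparr>"

definition pullback_cat ::
  "('o1, 'm1) cat \<Rightarrow> ('o2, 'm2) cat \<Rightarrow> ('o1, 'm1, 'o, 'm) ftor \<Rightarrow> ('o2, 'm2, 'o, 'm) ftor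
   \<Rightarrow> ('o1 \<times> 'o2, 'm1 \<times> 'm2) cat" where
  "pullback_cat C D F G =
     \<lparr>ob = {(x, y). x \<in> ob C \<and> y \<in> ob D \<and> FO F x = FO G y},
      ar = {(f, g). f \<in> ar C \<and> g \<in> ar D \<and> FA F f = FA G g},
      dm = map_prod (dm C) (dm D),
      cd = map_prod (cd C) (cd D),
      idt = map_prod (idt C) (idt D),
      cmp = (\<lambda>(f', g') (f, g). (f' \<cdot>\<^bsub>C\<^esub> f, g' \<cdot>\<^bsub>D\<^esub> g))\<rparr>"

definition proj2 :: "('o1 \<times> 'o2, 'm1 \<times> 'm2, 'o2, 'm2) ftor" where
  "proj2 = \<lparr>FO = snd, FA = snd\<rparr>"

section \<open>Fibrations\<close>

definition cartesian_arrow ::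
  "('o1, 'm1, 'z1) cat_scheme \<Rightarrow> ('o2, 'm2, 'z2) cat_scheme \<Rightarrow> ('o1, 'm1, 'o2, 'm2) ftor \<Rightarrow> 'm1 \<Rightarrow> bool" where
  "cartesian_arrow C B P f \<longleftrightarrow> f \<in> ar C \<and>
     (\<forall>g\<in>ar C. \<forall>w. cd C g = cd C f \<longrightarrow>
        w \<in> hom B (FO P (dm C g)) (FO P (dm C f)) \<longrightarrow> FA P f \<cdot>\<^bsub>B\<^esub> w = FA P g \<longrightarrow>
        (\<exists>!h. h \<in> hom C (dm C g) (dm C f) \<and> f \<cdot>\<^bsub>C\<^esub> h = g \<and> FA P h = w))"

definition fibration ::
  "('o1, 'm1, 'z1) cat_scheme \<Rightarrow> ('o2, 'm2, 'z2) cat_scheme \<Rightarrow> ('o1, 'm1, 'o2, 'm2) ftor \<Rightarrow> bool" where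
  "fibration C B P \<longleftrightarrow> is_functor C B P \<and>
     (\<forall>y\<in>ob C. \<forall>f\<in>ar B. cd B f = FO P y \<longrightarrow>
        (\<exists>k. cartesian_arrow C B P k \<and> cd C k = y \<and> FA P k = f))"

definition discrete_fibration ::
  "('o1, 'm1, 'z1) cat_scheme \<Rightarrow> ('o2, 'm2, 'z2) cat_scheme \<Rightarrow> ('o1, 'm1, 'o2, 'm2) ftor \<Rightarrow> bool" where
  "discrete_fibration C B P \<longleftrightarrow> is_functor C B P \<and>
     (\<forall>y\<in>ob C. \<forall>f\<in>ar B. cd B f = FO P y \<longrightarrow> (\<exists>!k. k \<in> ar C \<and> cd C k = y \<and> FA P k = f))"

definition cartesian_functor ::
  "('o, 'm, 'z) cat_scheme \<Rightarrow>
   ('o1, 'm1, 'z1) cat_scheme \<Rightarrow> ('o1, 'm1, 'o, 'm) ftor \<Rightarrow>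
   ('o2, 'm2, 'z2) cat_scheme \<Rightarrow> ('o2, 'm2, 'o, 'm) ftor \<Rightarrow>
   ('o1, 'm1, 'o2, 'm2) ftor \<Rightarrow> bool" where
  "cartesian_functor B C P D Q F \<longleftrightarrow> fibration C B P \<and> fibration D B Q \<and>
     is_functor C D F \<and> ftor_eq C (Q \<circ>\<^sub>F F) P \<and>
     (\<forall>k. cartesian_arrow C B P k \<longrightarrow> cartesian_arrow D B Q (FA F k))"

section \<open>Categories of diagrams\<close>

text \<open>
  A morphism of diagrams is a triple of its source, its target and its family of components;
  \<open>N x y t\<close> says that \<open>t\<close> is a natural family from \<open>x\<close> to \<open>y\<close>.
\<close>

definition diag_cat ::
  "'d set \<Rightarrow> ('d \<Rightarrow> 'd \<Rightarrow> 'c \<Rightarrow> bool) \<Rightarrow> ('d \<Rightarrow> 'c) \<Rightarrow> ('c \<Rightarrow> 'c \<Rightarrow> 'c) \<Rightarrow> ('d, 'd \<times> 'd \<times> 'c) cat" where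
  "diag_cat D N e m =
     \<lparr>ob = D,
      ar = {(x, y, t). x \<in> D \<and> y \<in> D \<and> N x y t},
      dm = (\<lambda>(x, y, t). x),
      cd = (\<lambda>(x, y, t). y),
      idt = (\<lambda>x. (x, x, e x)),
      cmp = (\<lambda>(y, z, t') (x, y', t). (x, z, m t' t))\<rparr>"

definition components :: "'d \<times> 'd \<times> 'c \<Rightarrow> 'c" where
  "components = (\<lambda>(x, y, t). t)"

text \<open>The square with verticals \<open>f\<close>, \<open>g\<close>, upper side \<open>a\<close> and lower side \<open>b\<close>.\<close>

definition square :: "('o, 'm, 'z) cat_scheme \<Rightarrow> 'm \<Rightarrow> 'm \<Rightarrow> 'm \<Rightarrow> 'm \<Rightarrow> bool" where
  "square E f g a b \<longleftrightarrow> f \<in> ar E \<and> g \<in> ar E \<and>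
     a \<in> hom E (dm E f) (dm E g) \<and> b \<in> hom E (cd E f) (cd E g) \<and> g \<cdot>\<^bsub>E\<^esub> a = b \<cdot>\<^bsub>E\<^esub> f"

definition is_pullback :: "('o, 'm, 'z) cat_scheme \<Rightarrow> 'm \<Rightarrow> 'm \<Rightarrow> 'm \<Rightarrow> 'm \<Rightarrow> bool" where
  "is_pullback E f g x y \<longleftrightarrow> f \<in> ar E \<and> g \<in> ar E \<and> x \<in> ar E \<and> y \<in> ar E \<and>
     cd E f = cd E g \<and> dm E x = dm E y \<and> cd E x = dm E f \<and> cd E y = dm E g \<and>
     f \<cdot>\<^bsub>E\<^esub> x = g \<cdot>\<^bsub>E\<^esub> y \<and>
     (\<forall>x'\<in>ar E. \<forall>y'\<in>ar E. dm E x' = dm E y' \<longrightarrow> cd E x' = dm E f \<longrightarrow> cd E y' = dm E g \<longrightarrow>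
        f \<cdot>\<^bsub>E\<^esub> x' = g \<cdot>\<^bsub>E\<^esub> y' \<longrightarrow>
        (\<exists>!h. h \<in> hom E (dm E x') (dm E x) \<and> x \<cdot>\<^bsub>E\<^esub> h = x' \<and> y \<cdot>\<^bsub>E\<^esub> h = y'))"

definition pb_square :: "('o, 'm, 'z) cat_scheme \<Rightarrow> 'm \<Rightarrow> 'm \<Rightarrow> 'm \<Rightarrow> 'm \<Rightarrow> bool" where
  "pb_square E f g a b \<longleftrightarrow> square E f g a b \<and> is_pullback E g b a f"

type_synonym 'm arr2 = "'m \<times> 'm \<times> ('m \<times> 'm)"
type_synonym 'm arr3 = "('m \<times> 'm) \<times> ('m \<times> 'm) \<times> ('m \<times> 'm \<times> 'm)"
type_synonym 'm arr4 = "('m \<times> 'm \<times> 'm) \<times> ('m \<times> 'm \<times> 'm) \<times> ('m \<times> 'm \<times> 'm \<times> 'm)"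
type_synonym 'm slice_arr = "'m \<times> 'm \<times> 'm"

definition cat2 :: "('o, 'm, 'z) cat_scheme \<Rightarrow> ('m, 'm arr2) cat" where
  "cat2 E = diag_cat (ar E)
     (\<lambda>f g (a, b). square E f g a b)
     (\<lambda>f. (idt E (dm E f), idt E (cd E f)))
     (\<lambda>(a', b') (a, b). (a' \<cdot>\<^bsub>E\<^esub> a, b' \<cdot>\<^bsub>E\<^esub> b))"

definition cat2_cart :: "('o, 'm, 'z) cat_scheme \<Rightarrow> ('m, 'm arr2) cat" where
  "cat2_cart E = wide_subcat (cat2 E) (\<lambda>(f, g, (a, b)). pb_square E f g a b)"

definition cat3 :: "('o, 'm, 'z) cat_scheme \<Rightarrow> ('m \<times> 'm, 'm arr3) cat" where
  "cat3 E = diag_cat {(q, p). q \<in> ar E \<and> p \<in> ar E \<and> cd E q = dm E p}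
     (\<lambda>(q, p) (q', p') (a, b, c). square E q q' a b \<and> square E p p' b c)
     (\<lambda>(q, p). (idt E (dm E q), idt E (dm E p), idt E (cd E p)))
     (\<lambda>(a', b', c') (a, b, c). (a' \<cdot>\<^bsub>E\<^esub> a, b' \<cdot>\<^bsub>E\<^esub> b, c' \<cdot>\<^bsub>E\<^esub> c))"

text \<open>
  The naturality squares at composites are pastings of those at the generating arrows, so for
  strings it is enough to require the latter to be pullbacks.
\<close>

definition cat3_cart :: "('o, 'm, 'z) cat_scheme \<Rightarrow> ('m \<times> 'm, 'm arr3) cat" where
  "cat3_cart E = wide_subcat (cat3 E)
     (\<lambda>((q, p), (q', p'), (a, b, c)). pb_square E q q' a b \<and> pb_square E p p' b c)"

definition cat4 :: "('o, 'm, 'z) cat_scheme \<Rightarrow> ('m \<times> 'm \<times> 'm, 'm arr4) cat" where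
  "cat4 E = diag_cat
     {(r, q, p). r \<in> ar E \<and> q \<in> ar E \<and> p \<in> ar E \<and> cd E r = dm E q \<and> cd E q = dm E p}
     (\<lambda>(r, q, p) (r', q', p') (a, b, c, d).
        square E r r' a b \<and> square E q q' b c \<and> square E p p' c d)
     (\<lambda>(r, q, p). (idt E (dm E r), idt E (dm E q), idt E (dm E p), idt E (cd E p)))
     (\<lambda>(a', b', c', d') (a, b, c, d).
        (a' \<cdot>\<^bsub>E\<^esub> a, b' \<cdot>\<^bsub>E\<^esub> b, c' \<cdot>\<^bsub>E\<^esub> c, d' \<cdot>\<^bsub>E\<^esub> d))"

definition cat4_cart :: "('o, 'm, 'z) cat_scheme \<Rightarrow> ('m \<times> 'm \<times> 'm, 'm arr4) cat" where
  "cat4_cart E = wide_subcat (cat4 E)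
     (\<lambda>((r, q, p), (r', q', p'), (a, b, c, d)).
        pb_square E r r' a b \<and> pb_square E q q' b c \<and> pb_square E p p' c d)"

definition dom2 :: "('o, 'm, 'z) cat_scheme \<Rightarrow> ('m, 'm arr2, 'o, 'm) ftor" where
  "dom2 E = \<lparr>FO = dm E, FA = (\<lambda>(f, g, (a, b)). a)\<rparr>"

definition cod2 :: "('o, 'm, 'z) cat_scheme \<Rightarrow> ('m, 'm arr2, 'o, 'm) ftor" where
  "cod2 E = \<lparr>FO = cd E, FA = (\<lambda>(f, g, (a, b)). b)\<rparr>"

definition cod3 :: "('o, 'm, 'z) cat_scheme \<Rightarrow> ('m \<times> 'm, 'm arr3, 'o, 'm) ftor" where
  "cod3 E = \<lparr>FO = (\<lambda>(q, p). cd E p), FA = (\<lambda>(x, y, (a, b, c)). c)\<rparr>"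

definition ev01_3 :: "('m \<times> 'm, 'm arr3, 'm, 'm arr2) ftor" where
  "ev01_3 = \<lparr>FO = (\<lambda>(q, p). q), FA = (\<lambda>((q, p), (q', p'), (a, b, c)). (q, q', (a, b)))\<rparr>"

definition ev01_4 :: "('m \<times> 'm \<times> 'm, 'm arr4, 'm, 'm arr2) ftor" where
  "ev01_4 = \<lparr>FO = (\<lambda>(r, q, p). r),
     FA = (\<lambda>((r, q, p), (r', q', p'), (a, b, c, d)). (r, r', (a, b)))\<rparr>"

text \<open>
  Diagrams of shape \<open>R\<close> in an arbitrary category: pairs \<open>(d0, d2)\<close> of a retraction
  \<open>d0 : c \<rightarrow> r\<close> and a section \<open>d2 : r \<rightarrow> c\<close>.  A morphism has components \<open>(k, l)\<close> at \<open>c\<close> and \<open>r\<close>.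
\<close>

definition catR ::
  "('o, 'm, 'z) cat_scheme \<Rightarrow> ('m \<times> 'm, ('m \<times> 'm) \<times> ('m \<times> 'm) \<times> ('m \<times> 'm)) cat" where
  "catR C = diag_cat
     {(d0, d2). d0 \<in> ar C \<and> d2 \<in> hom C (cd C d0) (dm C d0) \<and> d0 \<cdot>\<^bsub>C\<^esub> d2 = idt C (cd C d0)}
     (\<lambda>(d0, d2) (d0', d2') (k, l). square C d0 d0' k l \<and> square C d2 d2' l k)
     (\<lambda>(d0, d2). (idt C (dm C d0), idt C (cd C d0)))
     (\<lambda>(k', l') (k, l). (k' \<cdot>\<^bsub>C\<^esub> k, l' \<cdot>\<^bsub>C\<^esub> l))"

definition d0_ftor :: "('m \<times> 'm, ('m \<times> 'm) \<times> ('m \<times> 'm) \<times> ('m \<times> 'm), 'm, 'm arr2) ftor" where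
  "d0_ftor = \<lparr>FO = fst, FA = (\<lambda>((d0, d2), (d0', d2'), (k, l)). (d0, d0', (k, l)))\<rparr>"

text \<open>The pullback of \<open>d0_ftor\<close> along the inclusion of \<open>cat2_cart E\<close> into \<open>cat2 E\<close>.\<close>

definition catR_cart ::
  "('o, 'm, 'z) cat_scheme \<Rightarrow> ('m \<times> 'm, ('m \<times> 'm) \<times> ('m \<times> 'm) \<times> ('m \<times> 'm)) cat" where
  "catR_cart E = wide_subcat (catR E) (\<lambda>k. FA d0_ftor k \<in> ar (cat2_cart E))"

text \<open>Retract diagrams of arrows are \<open>R\<close>-shaped diagrams in the category of arrows.\<close>

type_synonym 'm ob2R = "'m arr2 \<times> 'm arr2"
type_synonym 'm arr2R = "'m ob2R \<times> 'm ob2R \<times> ('m arr2 \<times> 'm arr2)"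

definition cat2R_cart :: "('o, 'm, 'z) cat_scheme \<Rightarrow> ('m ob2R, 'm arr2R) cat" where
  "cat2R_cart E = wide_subcat (catR (cat2 E))
     (\<lambda>(x, y, (k, l)). k \<in> ar (cat2_cart E) \<and> l \<in> ar (cat2_cart E))"

definition ev_c :: "('o, 'm, 'z) cat_scheme \<Rightarrow> ('m ob2R, 'm arr2R, 'm, 'm arr2) ftor" where
  "ev_c E = \<lparr>FO = (\<lambda>(d0, d2). dm (cat2 E) d0), FA = (\<lambda>(x, y, (k, l)). k)\<rparr>"

definition ev_r :: "('o, 'm, 'z) cat_scheme \<Rightarrow> ('m ob2R, 'm arr2R, 'm, 'm arr2) ftor" where
  "ev_r E = \<lparr>FO = (\<lambda>(d0, d2). cd (cat2 E) d0), FA = (\<lambda>(x, y, (k, l)). l)\<rparr>"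

definition slice :: "('o, 'm, 'z) cat_scheme \<Rightarrow> 'o \<Rightarrow> ('m, 'm slice_arr) cat" where
  "slice E x = diag_cat {f \<in> ar E. cd E f = x}
     (\<lambda>f g h. h \<in> hom E (dm E f) (dm E g) \<and> g \<cdot>\<^bsub>E\<^esub> h = f)
     (\<lambda>f. idt E (dm E f))
     (\<lambda>h' h. h' \<cdot>\<^bsub>E\<^esub> h)"

section \<open>Locally cartesian closed categories with chosen structure\<close>

text \<open>
  \<open>pb1 f g\<close> and \<open>pb2 f g\<close> are the projections of the chosen pullback of a cospan \<open>f\<close>, \<open>g\<close> to the
  domains of \<open>f\<close> and of \<open>g\<close>.  \<open>pf p\<close> is the pushforward functor along \<open>p\<close>, and
  \<open>pf_counit p\<close> the counit of its adjunction with the pullback functor.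
\<close>

record ('o, 'm) lcc = "('o, 'm) cat" +
  pb1 :: "'m \<Rightarrow> 'm \<Rightarrow> 'm"
  pb2 :: "'m \<Rightarrow> 'm \<Rightarrow> 'm"
  pf :: "'m \<Rightarrow> ('m, 'm slice_arr, 'm, 'm slice_arr) ftor"
  pf_counit :: "'m \<Rightarrow> 'm \<Rightarrow> 'm slice_arr"

definition pb_pair :: "('o, 'm, 'z) lcc_scheme \<Rightarrow> 'm \<Rightarrow> 'm \<Rightarrow> 'm \<Rightarrow> 'm \<Rightarrow> 'm" where
  "pb_pair E f g x y =
     (THE h. h \<in> hom E (dm E x) (dm E (pb1 E f g)) \<and>
             pb1 E f g \<cdot>\<^bsub>E\<^esub> h = x \<and> pb2 E f g \<cdot>\<^bsub>E\<^esub> h = y)"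

definition pullback_ftor ::
  "('o, 'm, 'z) lcc_scheme \<Rightarrow> 'm \<Rightarrow> ('m, 'm slice_arr, 'm, 'm slice_arr) ftor" where
  "pullback_ftor E p =
     \<lparr>FO = (\<lambda>z. pb1 E p z),
      FA = (\<lambda>(z, w, h). (pb1 E p z, pb1 E p w, pb_pair E p w (pb1 E p z) (h \<cdot>\<^bsub>E\<^esub> pb2 E p z)))\<rparr>"

locale lcc_category = category E for E :: "('o, 'm, 'z) lcc_scheme" (structure) +
  assumes terminal: "\<exists>t\<in>ob E. \<forall>x\<in>ob E. \<exists>!f. f \<in> hom E x t"
    and pullbacks: "f \<in> ar E \<Longrightarrow> g \<in> ar E \<Longrightarrow> cd E f = cd E g \<Longrightarrow>
      is_pullback E f g (pb1 E f g) (pb2 E f g)"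
    and pushforward: "p \<in> ar E \<Longrightarrow>
      adjunction (slice E (cd E p)) (slice E (dm E p)) (pullback_ftor E p) (pf E p) (pf_counit E p)"

text \<open>
  An object \<open>I\<close> with chosen products \<open>X \<times> I\<close> (projections \<open>prX\<close>, \<open>prI\<close>), a chosen functor
  \<open>X \<mapsto> X\<^sup>I\<close> and evaluations \<open>X\<^sup>I \<times> I \<rightarrow> X\<close>.  Since there are pullbacks, pushforwards and a
  terminal object, all of this exists for every object \<open>I\<close>.
\<close>

record ('o, 'm) lcc_interval = "('o, 'm) lcc" +
  intv :: 'o
  prX :: "'o \<Rightarrow> 'm"
  prI :: "'o \<Rightarrow> 'm"
  path_ftor :: "('o, 'm, 'o, 'm) ftor"
  eval :: "'o \<Rightarrow> 'm"

definition is_product :: "('o, 'm, 'z) cat_scheme \<Rightarrow> 'o \<Rightarrow> 'o \<Rightarrow> 'm \<Rightarrow> 'm \<Rightarrow> bool" where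
  "is_product E x y s t \<longleftrightarrow> s \<in> ar E \<and> t \<in> ar E \<and> dm E s = dm E t \<and> cd E s = x \<and> cd E t = y \<and>
     (\<forall>z\<in>ob E. \<forall>s'\<in>hom E z x. \<forall>t'\<in>hom E z y.
        \<exists>!h. h \<in> hom E z (dm E s) \<and> s \<cdot>\<^bsub>E\<^esub> h = s' \<and> t \<cdot>\<^bsub>E\<^esub> h = t')"

definition prod_ftor :: "('o, 'm, 'z) lcc_interval_scheme \<Rightarrow> ('o, 'm, 'o, 'm) ftor" where
  "prod_ftor E =
     \<lparr>FO = (\<lambda>x. dm E (prX E x)),
      FA = (\<lambda>f. THE h. h \<in> hom E (dm E (prX E (dm E f))) (dm E (prX E (cd E f))) \<and>
              prX E (cd E f) \<cdot>\<^bsub>E\<^esub> h = f \<cdot>\<^bsub>E\<^esub> prX E (dm E f) \<and>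
              prI E (cd E f) \<cdot>\<^bsub>E\<^esub> h = prI E (dm E f))\<rparr>"

locale lcc_interval_category = lcc_category E
  for E :: "('o, 'm, 'z) lcc_interval_scheme" (structure) +
  assumes intv_ob: "intv E \<in> ob E"
    and products: "x \<in> ob E \<Longrightarrow> is_product E x (intv E) (prX E x) (prI E x)"
    and exponentials: "adjunction E E (prod_ftor E) (path_ftor E) (eval E)"

section \<open>The pushforward functors on cartesian transformations\<close>

definition push :: "('o, 'm, 'z) lcc_scheme \<Rightarrow> 'm \<Rightarrow> 'm \<Rightarrow> 'm" where
  "push E p q = FO (pf E p) q"

text \<open>
  For a transformation \<open>(a, b, c) : (q, p) \<rightarrow> (q', p')\<close> the Beck-Chevalley isomorphism identifies
  \<open>push p q\<close> with the pullback of \<open>push p' q'\<close> along \<open>c\<close>.  The resulting map between the domains of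
  the pushforwards is the transpose of \<open>a\<close> precomposed with the counit, i.e. the unique map over
  \<open>c\<close> that commutes with the counits.
\<close>

definition push_map ::
  "('o, 'm, 'z) lcc_scheme \<Rightarrow> 'm \<times> 'm \<Rightarrow> 'm \<times> 'm \<Rightarrow> 'm \<times> 'm \<times> 'm \<Rightarrow> 'm" where
  "push_map E = (\<lambda>(q, p) (q', p') (a, b, c).
     THE e. e \<in> hom E (dm E (push E p q)) (dm E (push E p' q')) \<and>
       push E p' q' \<cdot>\<^bsub>E\<^esub> e = c \<cdot>\<^bsub>E\<^esub> push E p q \<and>
       components (pf_counit E p' q') \<cdot>\<^bsub>E\<^esub>
           pb_pair E p' (push E p' q') (b \<cdot>\<^bsub>E\<^esub> pb1 E p (push E p q)) (e \<cdot>\<^bsub>E\<^esub> pb2 E p (push E p q))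
         = a \<cdot>\<^bsub>E\<^esub> components (pf_counit E p q))"

definition Pi3 :: "('o, 'm, 'z) lcc_scheme \<Rightarrow> ('m \<times> 'm, 'm arr3, 'm, 'm arr2) ftor" where
  "Pi3 E =
     \<lparr>FO = (\<lambda>(q, p). push E p q),
      FA = (\<lambda>((q, p), (q', p'), (a, b, c)).
        (push E p q, push E p' q', (push_map E (q, p) (q', p') (a, b, c), c)))\<rparr>"

definition push_arr :: "('o, 'm, 'z) lcc_scheme \<Rightarrow> 'm \<Rightarrow> 'm \<Rightarrow> 'm \<Rightarrow> 'm" where
  "push_arr E p q r = components (FA (pf E p) (q \<cdot>\<^bsub>E\<^esub> r, q, r))"

definition Pi4 :: "('o, 'm, 'z) lcc_scheme \<Rightarrow> ('m \<times> 'm \<times> 'm, 'm arr4, 'm \<times> 'm, 'm arr3) ftor" where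
  "Pi4 E =
     \<lparr>FO = (\<lambda>(r, q, p). (push_arr E p q r, push E p q)),
      FA = (\<lambda>((r, q, p), (r', q', p'), (a, b, c, d)).
        ((push_arr E p q r, push E p q),
         (push_arr E p' q' r', push E p' q'),
         (push_map E (q \<cdot>\<^bsub>E\<^esub> r, p) (q' \<cdot>\<^bsub>E\<^esub> r', p') (a, c, d),
          push_map E (q, p) (q', p') (b, c, d),
          d)))\<rparr>"

section \<open>Structured trivial fibrations\<close>

definition cart_part ::
  "('o, 'm, 'z) cat_scheme \<Rightarrow> ('f, 'g) cat \<Rightarrow> ('f, 'g, 'm, 'm arr2) ftor \<Rightarrow> ('f, 'g) cat" where
  "cart_part E F u = wide_subcat F (cartesian_arrow F E (cod2 E \<circ>\<^sub>F u))"

definition fibred_structure ::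
  "('o, 'm, 'z) cat_scheme \<Rightarrow> ('f, 'g) cat \<Rightarrow> ('f, 'g, 'm, 'm arr2) ftor \<Rightarrow> bool" where
  "fibred_structure E F u \<longleftrightarrow> is_functor F (cat2 E) u \<and>
     fibration F E (cod2 E \<circ>\<^sub>F u) \<and>
     cartesian_functor E F (cod2 E \<circ>\<^sub>F u) (cat2 E) (cod2 E) u \<and>
     discrete_fibration (cart_part E F u) (cat2_cart E) u"

definition STF0 ::
  "('o, 'm, 'z) cat_scheme \<Rightarrow> ('f, 'g) cat \<Rightarrow> ('f, 'g, 'm, 'm arr2) ftor \<Rightarrow> bool" where
  "STF0 E TFib u \<longleftrightarrow> fibred_structure E TFib u"

definition STF1 ::
  "('o, 'm, 'z) cat_scheme \<Rightarrow> ('f, 'g) cat \<Rightarrow> ('f, 'g, 'm, 'm arr2) ftor \<Rightarrow> bool" where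
  "STF1 E TFib u \<longleftrightarrow>
     (\<exists>s. is_functor (cart_part E TFib u) (catR_cart E) s \<and>
          ftor_eq (cart_part E TFib u) (d0_ftor \<circ>\<^sub>F s) u)"

definition STF2 ::
  "('o, 'm, 'z) lcc_scheme \<Rightarrow> ('f, 'g) cat \<Rightarrow> ('f, 'g, 'm, 'm arr2) ftor \<Rightarrow> bool" where
  "STF2 E TFib u \<longleftrightarrow>
     (let T4 = pullback_cat (cart_part E TFib u) (cat4_cart E) u ev01_4;
          T3 = pullback_cat (cart_part E TFib u) (cat3_cart E) u ev01_3
      in \<exists>L. is_functor T4 T3 L \<and> ftor_eq T4 (proj2 \<circ>\<^sub>F L) (Pi4 E \<circ>\<^sub>F proj2))"

definition STF3 ::
  "('o, 'm, 'z) cat_scheme \<Rightarrow> ('f, 'g) cat \<Rightarrow> ('f, 'g, 'm, 'm arr2) ftor \<Rightarrow> bool" where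
  "STF3 E TFib u \<longleftrightarrow>
     (let TR = pullback_cat (cart_part E TFib u) (cat2R_cart E) u (ev_c E)
      in \<exists>L. is_functor TR (cart_part E TFib u) L \<and> ftor_eq TR (u \<circ>\<^sub>F L) (ev_r E \<circ>\<^sub>F proj2))"

section \<open>Structured fibrations\<close>

definition path_prod :: "('o, 'm, 'z) lcc_interval_scheme \<Rightarrow> 'm \<Rightarrow> 'm" where
  "path_prod E f = FA (prod_ftor E) (FA (path_ftor E) f)"

definition delta_arr :: "('o, 'm, 'z) lcc_interval_scheme \<Rightarrow> 'm \<Rightarrow> 'm" where
  "delta_arr E p = pb_pair E (eval E (cd E p)) p (path_prod E p) (eval E (dm E p))"

definition delta_ftor :: "('o, 'm, 'z) lcc_interval_scheme \<Rightarrow> ('m, 'm arr2, 'm, 'm arr2) ftor" where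
  "delta_ftor E =
     \<lparr>FO = delta_arr E,
      FA = (\<lambda>(p, p', (a, b)).
        (delta_arr E p, delta_arr E p',
         (path_prod E a,
          pb_pair E (eval E (cd E p')) p'
            (path_prod E b \<cdot>\<^bsub>E\<^esub> pb1 E (eval E (cd E p)) p)
            (a \<cdot>\<^bsub>E\<^esub> pb2 E (eval E (cd E p)) p))))\<rparr>"

definition Fib_cart ::
  "('o, 'm, 'z) lcc_interval_scheme \<Rightarrow> ('f, 'g) cat \<Rightarrow> ('f, 'g, 'm, 'm arr2) ftor
   \<Rightarrow> ('f \<times> 'm, 'g \<times> 'm arr2) cat" where
  "Fib_cart E TFib u = pullback_cat (cart_part E TFib u) (cat2_cart E) u (delta_ftor E)"

definition u_Fib :: "('f \<times> 'm, 'g \<times> 'm arr2, 'm, 'm arr2) ftor" where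
  "u_Fib = proj2"

definition Fib_Fib_cart ::
  "('o, 'm, 'z) lcc_interval_scheme \<Rightarrow> ('f, 'g) cat \<Rightarrow> ('f, 'g, 'm, 'm arr2) ftor
   \<Rightarrow> (('f \<times> 'm) \<times> ('f \<times> 'm), ('g \<times> 'm arr2) \<times> ('g \<times> 'm arr2)) cat" where
  "Fib_Fib_cart E TFib u =
     pullback_cat (Fib_cart E TFib u) (Fib_cart E TFib u) (cod2 E \<circ>\<^sub>F u_Fib) (dom2 E \<circ>\<^sub>F u_Fib)"

definition times_ftor :: "('x, 'y, 'm, 'm arr2) ftor \<Rightarrow> ('x \<times> 'x, 'y \<times> 'y, 'm \<times> 'm, 'm arr3) ftor" where
  "times_ftor v =
     \<lparr>FO = (\<lambda>(y, x). (FO v y, FO v x)),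
      FA = (\<lambda>(l, k). case (FA v l, FA v k) of
        ((q, q', (a, b)), (p, p', (b', c))) \<Rightarrow> ((q, p), (q', p'), (a, b, c)))\<rparr>"

end

theory Submission
  imports Defs
begin

text \<open>
  Let \<open>q : B \<rightarrow> A\<close> and \<open>p : A \<rightarrow> X\<close> be structured fibrations, so that \<open>\<delta> \<Rightarrow> q\<close> and \<open>\<delta> \<Rightarrow> p\<close> are
  structured trivial fibrations, and the latter has a section \<open>s\<close> by STF1.  With
  \<open>P = p\<^sup>I \<times> I : A\<^sup>I \<times> I \<rightarrow> X\<^sup>I \<times> I\<close>, STF2 applied to \<open>\<delta> \<Rightarrow> q\<close> followed by the pullback of \<open>q\<close> along
  the evaluation of \<open>A\<close> and by \<open>P\<close> makes \<open>P\<^sub>*(\<delta> \<Rightarrow> q)\<close> a structured trivial fibration.  The map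
  \<open>\<delta> \<Rightarrow> p\<^sub>*q\<close> is a retract of it: its domain and codomain consist of functions on the pullback
  \<open>A\<^sub>\<epsilon>\<close>, those of \<open>P\<^sub>*(\<delta> \<Rightarrow> q)\<close> of functions on \<open>A\<^sup>I \<times> I\<close>, and the two retract maps are
  precomposition with \<open>\<delta> \<Rightarrow> p\<close> and with \<open>s\<close>.  The diagram is natural in cartesian transformations,
  because \<open>s\<close> is, and STF3 applies.
\<close>

section \<open>Fibrations\<close>

text \<open>The delicate point is the time coordinate. A function on A^I \<times> I over a path x
  with time j accepts only lifts of x that carry the same j. The retraction on domains, however,
  must return a whole path of functions, with a value for every time i and every point a over x(i),
  and the section of \<open>delta_arr E p\<close> at such a point returns a lift carrying i. The
  remedy is to keep the lifted path, restore the time j, apply the function, and evaluate the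
  resulting path in B at i. For i = j nothing is altered, which makes the retraction square commute.

  The functor of STF3 lifts strictly, so the retract arrow has to be the chosen
  \<open>delta_arr E (push E p q)\<close> itself. The four maps of the retract are therefore
  specified by their values on generalized elements, where equality is tested by extensionality and
  no canonical isomorphism is carried along.

  Functoriality and cartesianness of the result are formal: an arrow of a discrete fibration is
  determined by its codomain and its image, and every arrow of \<open>Fib_cart\<close> is cartesian
  over E.\<close>

lemma in_hom_iff [simp]: "f \<in> hom C x y \<longleftrightarrow> f \<in> ar C \<and> dm C f = x \<and> cd C f = y"
  by (simp add: hom_def)

context category
begin

lemma cmp_typing [simp]:
  assumes "f \<in> ar C" "g \<in> ar C" "cd C f = dm C g"
  shows "g \<cdot> f \<in> ar C" "dm C (g \<cdot> f) = dm C f" "cd C (g \<cdot> f) = cd C g"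
  using cmp_hom[of f "dm C f" "cd C f" g "cd C g"] assms by auto

lemma idt_typing [simp]:
  assumes "x \<in> ob C"
  shows "idt C x \<in> ar C" "dm C (idt C x) = x" "cd C (idt C x) = x"
  using idt_hom[OF assms] by auto

lemma cmp_idt_simp [simp]: "f \<in> ar C \<Longrightarrow> dm C f = x \<Longrightarrow> f \<cdot> idt C x = f"
  using cmp_idt[of f x "cd C f"] by auto

lemma idt_cmp_simp [simp]: "f \<in> ar C \<Longrightarrow> cd C f = x \<Longrightarrow> idt C x \<cdot> f = f"
  using idt_cmp[of f "dm C f" x] by auto

lemma assoc [simp]:
  "f \<in> ar C \<Longrightarrow> g \<in> ar C \<Longrightarrow> h \<in> ar C \<Longrightarrow> cd C f = dm C g \<Longrightarrow> cd C g = dm C h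
    \<Longrightarrow> h \<cdot> g \<cdot> f = h \<cdot> (g \<cdot> f)"
  using cmp_assoc[of f "dm C f" "cd C f" g "cd C g" h "cd C h"] by auto

lemmas ob_typing [simp] = dm_ob cd_ob

end

lemma is_functorD:
  assumes "is_functor C D F"
  shows "category C" "category D"
    "\<And>x. x \<in> ob C \<Longrightarrow> FO F x \<in> ob D"
    "\<And>f. f \<in> ar C \<Longrightarrow> FA F f \<in> ar D"
    "\<And>f. f \<in> ar C \<Longrightarrow> dm D (FA F f) = FO F (dm C f)"
    "\<And>f. f \<in> ar C \<Longrightarrow> cd D (FA F f) = FO F (cd C f)"
    "\<And>x. x \<in> ob C \<Longrightarrow> FA F (idt C x) = idt D (FO F x)"
    "\<And>f g. f \<in> ar C \<Longrightarrow> g \<in> ar C \<Longrightarrow> cd C f = dm C g \<Longrightarrow>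
      FA F (g \<cdot>\<^bsub>C\<^esub> f) = FA F g \<cdot>\<^bsub>D\<^esub> FA F f"
  using assms unfolding is_functor_def by auto

lemma is_functor_comp:
  assumes F: "is_functor C D F" and G: "is_functor D B G"
  shows "is_functor C B (G \<circ>\<^sub>F F)"
  using is_functorD[OF F] is_functorD[OF G] by (simp add: is_functor_def ftor_comp_def)

lemma pullback_cat_simps [simp]:
  "z \<in> ob (pullback_cat C D F G) \<longleftrightarrow> fst z \<in> ob C \<and> snd z \<in> ob D \<and> FO F (fst z) = FO G (snd z)"
  "k \<in> ar (pullback_cat C D F G) \<longleftrightarrow> fst k \<in> ar C \<and> snd k \<in> ar D \<and> FA F (fst k) = FA G (snd k)"
  "dm (pullback_cat C D F G) k = (dm C (fst k), dm D (snd k))"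
  "cd (pullback_cat C D F G) k = (cd C (fst k), cd D (snd k))"
  "idt (pullback_cat C D F G) z = (idt C (fst z), idt D (snd z))"
  "l \<cdot>\<^bsub>pullback_cat C D F G\<^esub> k = (fst l \<cdot>\<^bsub>C\<^esub> fst k, snd l \<cdot>\<^bsub>D\<^esub> snd k)"
  by (auto simp: pullback_cat_def map_prod_def split: prod.splits)

lemma ftor_simps [simp]:
  "FO proj2 z = snd z" "FA proj2 k = snd k"
  "FO (G \<circ>\<^sub>F F) x = FO G (FO F x)" "FA (G \<circ>\<^sub>F F) f = FA G (FA F f)"
  by (simp_all add: proj2_def ftor_comp_def)

lemma pullback_cat_functor:
  assumes F: "is_functor C B F" and G: "is_functor D B G"
  shows "is_functor (pullback_cat C D F G) D proj2"
proof -
  note F' = is_functorD[OF F] and G' = is_functorD[OF G]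
  interpret C: category C by (rule F')
  interpret D: category D by (rule G')
  have "category (pullback_cat C D F G)"
    by standard (auto simp: F' G', (metis F'(5,6) G'(5,6))+)
  then show ?thesis using G' by (auto simp: is_functor_def)
qed

text \<open>Fibrations all of whose arrows are cartesian, that is, fibrations in groupoids. The
  class contains the discrete fibrations and also the codomain functor on
  \<open>cat2_cart E\<close>, and it is stable under composition and pullback; this yields the
  fibration conditions inside \<open>cartesian_functor\<close>.\<close>

definition right_fibration ::
  "('o1, 'm1, 'z1) cat_scheme \<Rightarrow> ('o2, 'm2, 'z2) cat_scheme \<Rightarrow> ('o1, 'm1, 'o2, 'm2) ftor \<Rightarrow> bool" where
  "right_fibration C B P \<longleftrightarrow> is_functor C B P \<and> (\<forall>k\<in>ar C. cartesian_arrow C B P k) \<and>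
     (\<forall>y\<in>ob C. \<forall>f\<in>ar B. cd B f = FO P y \<longrightarrow> (\<exists>k\<in>ar C. cd C k = y \<and> FA P k = f))"

lemma right_fibration_imp_fibration: "right_fibration C B P \<Longrightarrow> fibration C B P"
  unfolding right_fibration_def fibration_def by blast

lemma right_fibration_lift:
  assumes "right_fibration C B P" "y \<in> ob C" "f \<in> ar B" "cd B f = FO P y"
  obtains k where "k \<in> ar C" "cd C k = y" "FA P k = f"
  using assms unfolding right_fibration_def by blast

lemma right_fibration_fill:
  assumes "right_fibration C B P" "k \<in> ar C" "g \<in> ar C" "cd C g = cd C k"
    "w \<in> ar B" "dm B w = FO P (dm C g)" "cd B w = FO P (dm C k)" "FA P k \<cdot>\<^bsub>B\<^esub> w = FA P g"
  obtains h where "h \<in> ar C" "dm C h = dm C g" "cd C h = dm C k" "k \<cdot>\<^bsub>C\<^esub> h = g" "FA P h = w"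
proof -
  have "\<exists>!h. h \<in> hom C (dm C g) (dm C k) \<and> k \<cdot>\<^bsub>C\<^esub> h = g \<and> FA P h = w"
    using assms unfolding right_fibration_def cartesian_arrow_def by simp
  then show thesis using that by auto
qed

lemma right_fibration_cancel:
  assumes "right_fibration C B P" "k \<in> ar C" "h \<in> ar C" "h' \<in> ar C"
    "cd C h = dm C k" "cd C h' = dm C k" "dm C h = dm C h'"
    "k \<cdot>\<^bsub>C\<^esub> h = k \<cdot>\<^bsub>C\<^esub> h'" "FA P h = FA P h'"
  shows "h = h'"
proof -
  note P = is_functorD[OF assms(1)[unfolded right_fibration_def, THEN conjunct1]]
  interpret C: category C by (rule P)
  have "\<exists>!l. l \<in> hom C (dm C (k \<cdot>\<^bsub>C\<^esub> h)) (dm C k) \<and> k \<cdot>\<^bsub>C\<^esub> l = k \<cdot>\<^bsub>C\<^esub> h \<and> FA P l = FA P h"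
  proof -
    have "cartesian_arrow C B P k" using assms unfolding right_fibration_def by blast
    then have "k \<cdot>\<^bsub>C\<^esub> h \<in> ar C \<Longrightarrow> cd C (k \<cdot>\<^bsub>C\<^esub> h) = cd C k \<Longrightarrow>
      FA P h \<in> hom B (FO P (dm C (k \<cdot>\<^bsub>C\<^esub> h))) (FO P (dm C k)) \<Longrightarrow>
      FA P k \<cdot>\<^bsub>B\<^esub> FA P h = FA P (k \<cdot>\<^bsub>C\<^esub> h) \<Longrightarrow> ?thesis"
      unfolding cartesian_arrow_def by blast
    then show ?thesis using assms P by simp
  qed
  then show ?thesis using assms by auto
qed

lemma right_fibrationI:
  assumes P: "is_functor C B P"
    and lift: "\<And>y f. y \<in> ob C \<Longrightarrow> f \<in> ar B \<Longrightarrow> cd B f = FO P y \<Longrightarrow> \<exists>k\<in>ar C. cd C k = y \<and> FA P k = f"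
    and fill: "\<And>k g w. k \<in> ar C \<Longrightarrow> g \<in> ar C \<Longrightarrow> cd C g = cd C k \<Longrightarrow> w \<in> ar B \<Longrightarrow>
      dm B w = FO P (dm C g) \<Longrightarrow> cd B w = FO P (dm C k) \<Longrightarrow> FA P k \<cdot>\<^bsub>B\<^esub> w = FA P g \<Longrightarrow>
      \<exists>h\<in>ar C. dm C h = dm C g \<and> cd C h = dm C k \<and> k \<cdot>\<^bsub>C\<^esub> h = g \<and> FA P h = w"
    and cancel: "\<And>k h h'. k \<in> ar C \<Longrightarrow> h \<in> ar C \<Longrightarrow> h' \<in> ar C \<Longrightarrow> cd C h = dm C k \<Longrightarrow>
      cd C h' = dm C k \<Longrightarrow> dm C h = dm C h' \<Longrightarrow> k \<cdot>\<^bsub>C\<^esub> h = k \<cdot>\<^bsub>C\<^esub> h' \<Longrightarrow>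
      FA P h = FA P h' \<Longrightarrow> h = h'"
  shows "right_fibration C B P"
proof -
  have "cartesian_arrow C B P k" if k: "k \<in> ar C" for k
    unfolding cartesian_arrow_def
  proof (intro conjI ballI allI impI)
    fix g w
    assume g: "g \<in> ar C" "cd C g = cd C k" "w \<in> hom B (FO P (dm C g)) (FO P (dm C k))"
      "FA P k \<cdot>\<^bsub>B\<^esub> w = FA P g"
    with fill[OF k, of g w] obtain h
      where "h\<in>ar C" "dm C h = dm C g" "cd C h = dm C k" "k \<cdot>\<^bsub>C\<^esub> h = g" "FA P h = w"
      by auto
    then show "\<exists>!h. h \<in> hom C (dm C g) (dm C k) \<and> k \<cdot>\<^bsub>C\<^esub> h = g \<and> FA P h = w"
      using cancel[OF k] by (intro ex1I[of _ h]) auto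
  qed (fact k)
  then show ?thesis using P lift unfolding right_fibration_def by blast
qed

text \<open>Lifts and fillers are found in two stages, first along \<open>Q\<close> and then along
  \<open>P\<close>. Cancellation goes the same way: the images under \<open>P\<close> are cancelled
  with \<open>Q\<close>, after which \<open>P\<close> applies.\<close>

lemma right_fibration_comp:
  assumes P: "right_fibration C D P" and Q: "right_fibration D B Q"
  shows "right_fibration C B (Q \<circ>\<^sub>F P)"
proof -
  have P1: "is_functor C D P" and Q1: "is_functor D B Q"
    using P Q by (auto simp: right_fibration_def)
  note P' = is_functorD[OF P1] and Q' = is_functorD[OF Q1]
  show ?thesis
  proof (rule right_fibrationI[OF is_functor_comp[OF P1 Q1]])
    fix y f assume y: "y \<in> ob C" "f \<in> ar B" "cd B f = FO (Q \<circ>\<^sub>F P) y"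
    obtain k where k: "k \<in> ar D" "cd D k = FO P y" "FA Q k = f"
      by (rule right_fibration_lift[OF Q, of "FO P y" f]) (use y in \<open>simp_all add: P'(3)\<close>)
    obtain l where "l \<in> ar C" "cd C l = y" "FA P l = k"
      by (rule right_fibration_lift[OF P, of y k]) (use y k in auto)
    then show "\<exists>k\<in>ar C. cd C k = y \<and> FA (Q \<circ>\<^sub>F P) k = f" using k by auto
  next
    fix k g w
    assume k: "k \<in> ar C" "g \<in> ar C" "cd C g = cd C k" "w \<in> ar B"
      "dm B w = FO (Q \<circ>\<^sub>F P) (dm C g)" "cd B w = FO (Q \<circ>\<^sub>F P) (dm C k)"
      "FA (Q \<circ>\<^sub>F P) k \<cdot>\<^bsub>B\<^esub> w = FA (Q \<circ>\<^sub>F P) g"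
    obtain v where v: "v \<in> ar D" "dm D v = FO P (dm C g)" "cd D v = FO P (dm C k)"
      "FA P k \<cdot>\<^bsub>D\<^esub> v = FA P g" "FA Q v = w"
      by (rule right_fibration_fill[OF Q, of "FA P k" "FA P g" w]) (use k in \<open>simp_all add: P'(4-6)\<close>)
    obtain h where "h \<in> ar C" "dm C h = dm C g" "cd C h = dm C k" "k \<cdot>\<^bsub>C\<^esub> h = g" "FA P h = v"
      by (rule right_fibration_fill[OF P k(1-3) v(1-4)])
    then show "\<exists>h\<in>ar C. dm C h = dm C g \<and> cd C h = dm C k \<and> k \<cdot>\<^bsub>C\<^esub> h = g \<and> FA (Q \<circ>\<^sub>F P) h = w"
      using v by auto
  next
    fix k h h'
    assume k: "k \<in> ar C" "h \<in> ar C" "h' \<in> ar C" "cd C h = dm C k" "cd C h' = dm C k"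
      "dm C h = dm C h'" "k \<cdot>\<^bsub>C\<^esub> h = k \<cdot>\<^bsub>C\<^esub> h'" "FA (Q \<circ>\<^sub>F P) h = FA (Q \<circ>\<^sub>F P) h'"
    have "FA P k \<cdot>\<^bsub>D\<^esub> FA P h = FA P k \<cdot>\<^bsub>D\<^esub> FA P h'"
    proof -
      have "FA P (k \<cdot>\<^bsub>C\<^esub> h) = FA P k \<cdot>\<^bsub>D\<^esub> FA P h"
        "FA P (k \<cdot>\<^bsub>C\<^esub> h') = FA P k \<cdot>\<^bsub>D\<^esub> FA P h'"
        by (rule P'(8); use k in simp)+
      with k(7) show ?thesis by metis
    qed
    then have "FA P h = FA P h'"
      by (rule right_fibration_cancel[OF Q, of "FA P k", rotated -2])
        (use k(1-6,8) in \<open>simp_all add: P'(4-6)\<close>)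
    then show "h = h'" by (rule right_fibration_cancel[OF P k(1-7)])
  qed
qed

text \<open>The second component of a lift or filler is prescribed; the first is a lift or filler in
  \<open>C\<close> over the image of the second under \<open>G\<close>.\<close>

lemma right_fibration_pullback:
  assumes F: "right_fibration C B F" and G: "is_functor D B G"
  shows "right_fibration (pullback_cat C D F G) D proj2"
proof -
  have F1: "is_functor C B F" using F by (auto simp: right_fibration_def)
  note F' = is_functorD[OF F1] and G' = is_functorD[OF G]
  show ?thesis
  proof (rule right_fibrationI[OF pullback_cat_functor[OF F1 G]])
    fix y f
    assume y: "y \<in> ob (pullback_cat C D F G)" "f \<in> ar D" "cd D f = FO proj2 y"
    obtain k where "k \<in> ar C" "cd C k = fst y" "FA F k = FA G f"
      by (rule right_fibration_lift[OF F, of "fst y" "FA G f"]) (use y G' in auto)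
    then show "\<exists>k\<in>ar (pullback_cat C D F G). cd (pullback_cat C D F G) k = y \<and> FA proj2 k = f"
      using y by (intro bexI[of _ "(k, f)"]) auto
  next
    fix k g w
    assume k: "k \<in> ar (pullback_cat C D F G)" "g \<in> ar (pullback_cat C D F G)"
      "cd (pullback_cat C D F G) g = cd (pullback_cat C D F G) k" "w \<in> ar D"
      "dm D w = FO proj2 (dm (pullback_cat C D F G) g)"
      "cd D w = FO proj2 (dm (pullback_cat C D F G) k)" "FA proj2 k \<cdot>\<^bsub>D\<^esub> w = FA proj2 g"
    have "FA F (fst k) \<cdot>\<^bsub>B\<^esub> FA G w = FA F (fst g)"
      using k G'(8)[of w "snd k"] by auto
    moreover have "dm B (FA G w) = FO F (dm C (fst g))" "cd B (FA G w) = FO F (dm C (fst k))"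
      using k F'(5)[of "fst g"] F'(5)[of "fst k"] G'(5,6)[of w] G'(5)[of "snd g"] G'(5)[of "snd k"]
      by auto
    moreover have "fst k \<in> ar C" "fst g \<in> ar C" "cd C (fst g) = cd C (fst k)" "FA G w \<in> ar B"
      using k G'(4)[of w] by simp_all
    ultimately obtain h where "h \<in> ar C" "dm C h = dm C (fst g)" "cd C h = dm C (fst k)"
        "fst k \<cdot>\<^bsub>C\<^esub> h = fst g" "FA F h = FA G w"
      by (metis right_fibration_fill[OF F, of "fst k" "fst g" "FA G w"])
    then show "\<exists>h\<in>ar (pullback_cat C D F G).
        dm (pullback_cat C D F G) h = dm (pullback_cat C D F G) g \<and>
        cd (pullback_cat C D F G) h = dm (pullback_cat C D F G) k \<and>
        k \<cdot>\<^bsub>pullback_cat C D F G\<^esub> h = g \<and> FA proj2 h = w"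
      using k by (intro bexI[of _ "(h, w)"]) auto
  next
    fix k h h'
    assume k: "k \<in> ar (pullback_cat C D F G)" "h \<in> ar (pullback_cat C D F G)"
      "h' \<in> ar (pullback_cat C D F G)"
      "cd (pullback_cat C D F G) h = dm (pullback_cat C D F G) k"
      "cd (pullback_cat C D F G) h' = dm (pullback_cat C D F G) k"
      "dm (pullback_cat C D F G) h = dm (pullback_cat C D F G) h'"
      "k \<cdot>\<^bsub>pullback_cat C D F G\<^esub> h = k \<cdot>\<^bsub>pullback_cat C D F G\<^esub> h'" "FA proj2 h = FA proj2 h'"
    have "fst h = fst h'"
      by (rule right_fibration_cancel[OF F, of "fst k"]) (use k in simp_all)
    with k show "h = h'" by (auto intro: prod_eqI)
  qed
qed

section \<open>Discrete fibrations\<close>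

lemma discrete_fibration_lift:
  assumes "discrete_fibration C B P" "y \<in> ob C" "f \<in> ar B" "cd B f = FO P y"
  obtains k where "k \<in> ar C" "cd C k = y" "FA P k = f"
  using assms unfolding discrete_fibration_def by blast

lemma discrete_fibration_unique:
  assumes "discrete_fibration C B P" "h \<in> ar C" "h' \<in> ar C" "cd C h = cd C h'" "FA P h = FA P h'"
  shows "h = h'"
proof -
  have P: "is_functor C B P" using assms by (simp add: discrete_fibration_def)
  interpret C: category C by (rule is_functorD[OF P])
  have "\<exists>!k. k \<in> ar C \<and> cd C k = cd C h \<and> FA P k = FA P h"
    using assms is_functorD[OF P] unfolding discrete_fibration_def by simp
  then show ?thesis using assms by auto
qed

text \<open>The filler is the unique lift of \<open>w\<close> with codomain \<open>dm C k\<close>.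
  The triangle commutes because \<open>k \<cdot> h\<close> and \<open>g\<close> lift the same arrow
  to the same codomain.\<close>

lemma discrete_imp_right_fibration:
  assumes P: "discrete_fibration C B P"
  shows "right_fibration C B P"
proof -
  have P1: "is_functor C B P" using P by (simp add: discrete_fibration_def)
  note P' = is_functorD[OF P1]
  interpret C: category C by (rule P')
  show ?thesis
  proof (rule right_fibrationI[OF P1])
    fix y f assume "y \<in> ob C" "f \<in> ar B" "cd B f = FO P y"
    then show "\<exists>k\<in>ar C. cd C k = y \<and> FA P k = f"
      by (meson P discrete_fibration_lift)
  next
    fix k g w assume k: "k \<in> ar C" "g \<in> ar C" "cd C g = cd C k" "w \<in> ar B"
      "dm B w = FO P (dm C g)" "cd B w = FO P (dm C k)" "FA P k \<cdot>\<^bsub>B\<^esub> w = FA P g"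
    obtain h where h: "h \<in> ar C" "cd C h = dm C k" "FA P h = w"
      by (rule discrete_fibration_lift[OF P, of "dm C k" w]) (use k in auto)
    have "k \<cdot>\<^bsub>C\<^esub> h = g"
      by (rule discrete_fibration_unique[OF P]) (use h k P' in auto)
    then show "\<exists>h\<in>ar C. dm C h = dm C g \<and> cd C h = dm C k \<and> k \<cdot>\<^bsub>C\<^esub> h = g \<and> FA P h = w"
      using h k by force
  next
    fix k h h' assume "h \<in> ar C" "h' \<in> ar C" "cd C h = dm C k" "cd C h' = dm C k" "FA P h = FA P h'"
    then show "h = h'" by (intro discrete_fibration_unique[OF P]) auto
  qed
qed

lemma discrete_fibration_pullback:
  assumes F: "discrete_fibration C B F" and G: "is_functor D B G"
  shows "discrete_fibration (pullback_cat C D F G) D proj2"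
proof -
  have R: "right_fibration (pullback_cat C D F G) D proj2"
    by (rule right_fibration_pullback[OF discrete_imp_right_fibration[OF F] G])
  show ?thesis unfolding discrete_fibration_def
  proof (intro conjI ballI impI)
    show "is_functor (pullback_cat C D F G) D proj2" using R by (simp add: right_fibration_def)
    fix y f
    assume y: "y \<in> ob (pullback_cat C D F G)" "f \<in> ar D" "cd D f = FO proj2 y"
    obtain k where "k \<in> ar (pullback_cat C D F G)" "cd (pullback_cat C D F G) k = y"
      "FA proj2 k = f" by (rule right_fibration_lift[OF R, of y f]) (use y in simp_all)
    then show "\<exists>!k. k \<in> ar (pullback_cat C D F G) \<and> cd (pullback_cat C D F G) k = y \<and> FA proj2 k = f"
      by (intro ex1I[of _ k])
        (auto intro!: prod_eqI discrete_fibration_unique[OF F])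
  qed
qed

text \<open>
  A discrete fibration is faithful with prescribed codomains, so the lifts of the arrows need
  not be chosen functorially.
\<close>

lemma lift_functor_along_discrete_fibration:
  assumes G: "is_functor C B G" and P: "discrete_fibration D B P"
    and Ob: "\<And>x. x \<in> ob C \<Longrightarrow> Ob x \<in> ob D \<and> FO P (Ob x) = FO G x"
    and A: "\<And>f. f \<in> ar C \<Longrightarrow> \<exists>k\<in>ar D. dm D k = Ob (dm C f) \<and> cd D k = Ob (cd C f) \<and> FA P k = FA G f"
  obtains L where "is_functor C D L" "ftor_eq C (P \<circ>\<^sub>F L) G"
proof -
  have P1: "is_functor D B P" using P by (simp add: discrete_fibration_def)
  note P' = is_functorD[OF P1] and G' = is_functorD[OF G]
  interpret C: category C by (rule G')
  interpret D: category D by (rule P')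
  obtain k where k: "\<And>f. f \<in> ar C \<Longrightarrow>
      k f \<in> ar D \<and> dm D (k f) = Ob (dm C f) \<and> cd D (k f) = Ob (cd C f) \<and> FA P (k f) = FA G f"
    using A by metis
  have "k (idt C x) = idt D (Ob x)" if "x \<in> ob C" for x
    by (rule discrete_fibration_unique[OF P]) (use that k Ob P' G' in auto)
  moreover have "k (g \<cdot>\<^bsub>C\<^esub> f) = k g \<cdot>\<^bsub>D\<^esub> k f"
    if "f \<in> ar C" "g \<in> ar C" "cd C f = dm C g" for f g
    by (rule discrete_fibration_unique[OF P]) (use that k Ob P' G' in auto)
  ultimately have "is_functor C D \<lparr>FO = Ob, FA = k\<rparr>"
    using Ob k P' G' by (simp add: is_functor_def)
  moreover have "ftor_eq C (P \<circ>\<^sub>F \<lparr>FO = Ob, FA = k\<rparr>) G"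
    using Ob k by (simp add: ftor_eq_def)
  ultimately show thesis by (rule that)
qed

section \<open>Diagram categories and pullback squares\<close>

lemma diag_cat_simps:
  "x \<in> ob (diag_cat D N e m) \<longleftrightarrow> x \<in> D"
  "(x, y, t) \<in> ar (diag_cat D N e m) \<longleftrightarrow> x \<in> D \<and> y \<in> D \<and> N x y t"
  "dm (diag_cat D N e m) k = fst k"
  "cd (diag_cat D N e m) k = fst (snd k)"
  "idt (diag_cat D N e m) x = (x, x, e x)"
  "(y, z, t') \<cdot>\<^bsub>diag_cat D N e m\<^esub> (x, y', t) = (x, z, m t' t)"
  by (auto simp: diag_cat_def split: prod.splits)

lemma wide_subcat_simps:
  "ob (wide_subcat C Q) = ob C" "k \<in> ar (wide_subcat C Q) \<longleftrightarrow> k \<in> ar C \<and> Q k"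
  "dm (wide_subcat C Q) = dm C" "cd (wide_subcat C Q) = cd C" "idt (wide_subcat C Q) = idt C"
  "cmp (wide_subcat C Q) = cmp C"
  by (auto simp: wide_subcat_def)

lemma cat2_simps [simp]:
  "f \<in> ob (cat2 E) \<longleftrightarrow> f \<in> ar E"
  "(f, g, (a, b)) \<in> ar (cat2 E) \<longleftrightarrow> square E f g a b"
  "dm (cat2 E) (f, g, t) = f" "cd (cat2 E) (f, g, t) = g"
  "idt (cat2 E) f = (f, f, (idt E (dm E f), idt E (cd E f)))"
  "(g', k, (a', b')) \<cdot>\<^bsub>cat2 E\<^esub> (f, g, (a, b)) = (f, k, (a' \<cdot>\<^bsub>E\<^esub> a, b' \<cdot>\<^bsub>E\<^esub> b))"
  by (auto simp: cat2_def diag_cat_simps square_def)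

lemma cat2_cart_simps [simp]:
  "f \<in> ob (cat2_cart E) \<longleftrightarrow> f \<in> ar E"
  "(f, g, (a, b)) \<in> ar (cat2_cart E) \<longleftrightarrow> pb_square E f g a b"
  "dm (cat2_cart E) (f, g, t) = f" "cd (cat2_cart E) (f, g, t) = g"
  "idt (cat2_cart E) f = (f, f, (idt E (dm E f), idt E (cd E f)))"
  "(g', k, (a', b')) \<cdot>\<^bsub>cat2_cart E\<^esub> (f, g, (a, b)) = (f, k, (a' \<cdot>\<^bsub>E\<^esub> a, b' \<cdot>\<^bsub>E\<^esub> b))"
  by (auto simp: cat2_cart_def wide_subcat_simps pb_square_def)

lemma cat3_cart_simps [simp]:
  "(q, p) \<in> ob (cat3_cart E) \<longleftrightarrow> q \<in> ar E \<and> p \<in> ar E \<and> cd E q = dm E p"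
  "((q, p), (q', p'), (a, b, c)) \<in> ar (cat3_cart E) \<longleftrightarrow>
     pb_square E q q' a b \<and> pb_square E p p' b c \<and> cd E q = dm E p \<and> cd E q' = dm E p'"
  by (auto simp: cat3_cart_def cat3_def diag_cat_simps wide_subcat_simps pb_square_def square_def)

lemma cat4_cart_simps [simp]:
  "(r, q, p) \<in> ob (cat4_cart E) \<longleftrightarrow>
     r \<in> ar E \<and> q \<in> ar E \<and> p \<in> ar E \<and> cd E r = dm E q \<and> cd E q = dm E p"
  "((r, q, p), (r', q', p'), (a, b, c, d)) \<in> ar (cat4_cart E) \<longleftrightarrow>
     pb_square E r r' a b \<and> pb_square E q q' b c \<and> pb_square E p p' c d \<and>
     cd E r = dm E q \<and> cd E q = dm E p \<and> cd E r' = dm E q' \<and> cd E q' = dm E p'"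
  by (auto simp: cat4_cart_def cat4_def diag_cat_simps wide_subcat_simps pb_square_def square_def)

context category
begin

text \<open>The simplifier associates composites to the right, so an equation for
  \<open>g \<cdot> f\<close> no longer matches inside a longer composite. This form applies it
  there.\<close>

lemma cmp_reassoc:
  assumes "g \<cdot> f = k" "f \<in> ar C" "g \<in> ar C" "h \<in> ar C" "cd C f = dm C g" "cd C h = dm C f"
  shows "g \<cdot> (f \<cdot> h) = k \<cdot> h"
  unfolding assms(1)[symmetric] using assms(2-) by simp

section \<open>Calculus of pullback squares\<close>

lemma pb_squareD:
  assumes "pb_square C f g a b"
  shows "f \<in> ar C" "g \<in> ar C" "a \<in> ar C" "b \<in> ar C" "dm C a = dm C f" "cd C a = dm C g"
    "dm C b = cd C f" "cd C b = cd C g" "g \<cdot> a = b \<cdot> f"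
  using assms by (auto simp: pb_square_def square_def)

lemma pb_square_lift:
  assumes "pb_square C f g a b" "x \<in> ar C" "y \<in> ar C" "dm C x = dm C y" "cd C x = dm C g"
    "cd C y = cd C f" "g \<cdot> x = b \<cdot> y"
  obtains h where "h \<in> ar C" "dm C h = dm C x" "cd C h = dm C f" "a \<cdot> h = x" "f \<cdot> h = y"
proof -
  have P: "is_pullback C g b a f" using assms by (simp add: pb_square_def)
  have "cd C y = dm C b" using pb_squareD[OF assms(1)] assms by simp
  then obtain h where "h \<in> hom C (dm C x) (dm C a)" "a \<cdot> h = x" "f \<cdot> h = y"
    using P assms unfolding is_pullback_def by metis
  then show thesis using that[of h] pb_squareD[OF assms(1)] by simp
qed

lemma is_pullback_ext:
  assumes "is_pullback C f g x y" "h \<in> ar C" "h' \<in> ar C" "cd C h = dm C x" "cd C h' = dm C x"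
    "x \<cdot> h = x \<cdot> h'" "y \<cdot> h = y \<cdot> h'" "dm C h = dm C h'"
  shows "h = h'"
proof -
  have "f \<cdot> (x \<cdot> h) = g \<cdot> (y \<cdot> h)"
    using assms unfolding is_pullback_def by (metis assoc)
  moreover have "x \<cdot> h \<in> ar C" "y \<cdot> h \<in> ar C" "dm C (x \<cdot> h) = dm C (y \<cdot> h)"
    "cd C (x \<cdot> h) = dm C f" "cd C (y \<cdot> h) = dm C g"
    using assms by (auto simp: is_pullback_def)
  ultimately have "\<exists>!l. l \<in> hom C (dm C (x \<cdot> h)) (dm C x) \<and> x \<cdot> l = x \<cdot> h \<and> y \<cdot> l = y \<cdot> h"
    using assms(1) unfolding is_pullback_def by blast
  then show ?thesis using assms by (auto simp: is_pullback_def)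
qed

lemma pb_square_ext:
  assumes "pb_square C f g a b" "h \<in> ar C" "h' \<in> ar C" "cd C h = dm C f" "cd C h' = dm C f"
    "dm C h = dm C h'" "a \<cdot> h = a \<cdot> h'" "f \<cdot> h = f \<cdot> h'"
  shows "h = h'"
proof -
  have "is_pullback C g b a f" "dm C a = dm C f" using assms by (auto simp: pb_square_def square_def)
  then show ?thesis by - (rule is_pullback_ext[of g b a f], use assms in simp_all)
qed

lemma pb_squareI:
  assumes "f \<in> ar C" "g \<in> ar C" "a \<in> ar C" "b \<in> ar C" "dm C a = dm C f" "cd C a = dm C g"
    "dm C b = cd C f" "cd C b = cd C g" "g \<cdot> a = b \<cdot> f"
    and lift: "\<And>x y. x \<in> ar C \<Longrightarrow> y \<in> ar C \<Longrightarrow> dm C x = dm C y \<Longrightarrow> cd C x = dm C g \<Longrightarrow>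
      cd C y = cd C f \<Longrightarrow> g \<cdot> x = b \<cdot> y \<Longrightarrow>
      \<exists>h\<in>ar C. dm C h = dm C x \<and> cd C h = dm C f \<and> a \<cdot> h = x \<and> f \<cdot> h = y"
    and ext: "\<And>h h'. h \<in> ar C \<Longrightarrow> h' \<in> ar C \<Longrightarrow> cd C h = dm C f \<Longrightarrow> cd C h' = dm C f \<Longrightarrow>
      dm C h = dm C h' \<Longrightarrow> a \<cdot> h = a \<cdot> h' \<Longrightarrow> f \<cdot> h = f \<cdot> h' \<Longrightarrow> h = h'"
  shows "pb_square C f g a b"
  unfolding pb_square_def is_pullback_def square_def
proof (intro conjI ballI impI)
  fix x y
  assume xy: "x \<in> ar C" "y \<in> ar C" "dm C x = dm C y" "cd C x = dm C g" "cd C y = dm C b"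
    "g \<cdot> x = b \<cdot> y"
  then obtain h where h: "h\<in>ar C" "dm C h = dm C x" "cd C h = dm C f" "a \<cdot> h = x" "f \<cdot> h = y"
    using lift[of x y] assms by auto
  then show "\<exists>!h. h \<in> hom C (dm C x) (dm C a) \<and> a \<cdot> h = x \<and> f \<cdot> h = y"
    using ext[of _ h] assms by (intro ex1I[of _ h]) auto
qed (use assms in simp_all)

lemma pb_square_idt:
  assumes "f \<in> ar C"
  shows "pb_square C f f (idt C (dm C f)) (idt C (cd C f))"
  by (rule pb_squareI) (use assms in auto)

lemma pb_square_paste:
  assumes s: "pb_square C f g a b" and t: "pb_square C g k a' b'"
  shows "pb_square C f k (a' \<cdot> a) (b' \<cdot> b)"
proof -
  note [simp] = pb_squareD[OF s] pb_squareD[OF t]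
  show ?thesis
  proof (rule pb_squareI)
    show "k \<cdot> (a' \<cdot> a) = b' \<cdot> b \<cdot> f"
      by (simp flip: assoc) simp
  next
    fix x y assume [simp]: "x \<in> ar C" "y \<in> ar C" "cd C x = dm C k" "cd C y = cd C f"
      and d: "dm C x = dm C y" and e: "k \<cdot> x = b' \<cdot> b \<cdot> y"
    obtain z where z [simp]: "z \<in> ar C" "cd C z = dm C g" and z': "dm C z = dm C x" "a' \<cdot> z = x"
      "g \<cdot> z = b \<cdot> y"
      by (rule pb_square_lift[OF t, of x "b \<cdot> y"]) (use d e in auto)
    obtain h where "h \<in> ar C" "dm C h = dm C z" "cd C h = dm C f" "a \<cdot> h = z" "f \<cdot> h = y"
      by (rule pb_square_lift[OF s, of z y]) (use d z' in auto)
    with z' show "\<exists>h\<in>ar C. dm C h = dm C x \<and> cd C h = dm C f \<and> a' \<cdot> a \<cdot> h = x \<and> f \<cdot> h = y"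
      by (intro bexI[of _ h]) auto
  next
    fix h h' assume h [simp]: "h \<in> ar C" "h' \<in> ar C" "cd C h = dm C f" "cd C h' = dm C f"
      and e: "dm C h = dm C h'" "a' \<cdot> a \<cdot> h = a' \<cdot> a \<cdot> h'" "f \<cdot> h = f \<cdot> h'"
    have "g \<cdot> (a \<cdot> h) = b \<cdot> (f \<cdot> h)" "g \<cdot> (a \<cdot> h') = b \<cdot> (f \<cdot> h')"
      by (simp_all flip: assoc)
    then have "a \<cdot> h = a \<cdot> h'"
      by - (rule pb_square_ext[OF t], use e in simp_all)
    then show "h = h'" by - (rule pb_square_ext[OF s], use e in simp_all)
  qed simp_all
qed

text \<open>The cancellation half of the pasting law, with the upper arrow \<open>a\<close>
  constructed rather than given. It supplies the fillers that make pullback squares cartesian arrows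
  for \<open>cod2\<close>.\<close>

lemma pb_square_cancel:
  assumes t: "pb_square C g k a' b'" and u: "pb_square C f k c (b' \<cdot> b)"
    and b: "b \<in> ar C" "dm C b = cd C f" "cd C b = cd C g"
  obtains a where "a' \<cdot> a = c" "pb_square C f g a b"
proof -
  note [simp] = pb_squareD[OF t] pb_squareD(1-8)[OF u] b
  have uc: "k \<cdot> c = b' \<cdot> (b \<cdot> f)" using pb_squareD(9)[OF u] by simp
  obtain a where a [simp]: "a \<in> ar C" "dm C a = dm C f" "cd C a = dm C g" and a': "a' \<cdot> a = c"
    "g \<cdot> a = b \<cdot> f"
    by (rule pb_square_lift[OF t, of c "b \<cdot> f"]) (use uc in auto)
  have "pb_square C f g a b"
  proof (rule pb_squareI)
    fix x y assume [simp]: "x \<in> ar C" "y \<in> ar C" "cd C x = dm C g" "cd C y = cd C f"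
      and d: "dm C x = dm C y" and e: "g \<cdot> x = b \<cdot> y"
    have e': "k \<cdot> (a' \<cdot> x) = b' \<cdot> (g \<cdot> x)"
      using cmp_reassoc[OF pb_squareD(9)[OF t], of x] by simp
    obtain h where h: "h \<in> ar C" "dm C h = dm C x" "cd C h = dm C f" "c \<cdot> h = a' \<cdot> x" "f \<cdot> h = y"
      by (rule pb_square_lift[OF u, of "a' \<cdot> x" y]) (use d e e' in auto)
    have "a \<cdot> h = x"
    proof (rule pb_square_ext[OF t])
      show "a' \<cdot> (a \<cdot> h) = a' \<cdot> x" using cmp_reassoc[OF a'(1), of h] h by simp
      have "g \<cdot> (a \<cdot> h) = b \<cdot> (f \<cdot> h)" using cmp_reassoc[OF a'(2), of h] h by simp
      then show "g \<cdot> (a \<cdot> h) = g \<cdot> x" using h e by simp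
    qed (use h in simp_all)
    with h show "\<exists>h\<in>ar C. dm C h = dm C x \<and> cd C h = dm C f \<and> a \<cdot> h = x \<and> f \<cdot> h = y"
      by blast
  next
    fix h h' assume h [simp]: "h \<in> ar C" "h' \<in> ar C" "cd C h = dm C f" "cd C h' = dm C f"
      and e: "dm C h = dm C h'" "a \<cdot> h = a \<cdot> h'" "f \<cdot> h = f \<cdot> h'"
    have "c \<cdot> h = a' \<cdot> (a \<cdot> h)" "c \<cdot> h' = a' \<cdot> (a \<cdot> h')"
      using cmp_reassoc[OF a'(1)] by simp_all
    then have "c \<cdot> h = c \<cdot> h'" using e by simp
    then show "h = h'"
      by - (rule pb_square_ext[OF u h(1-4) e(1)], use e in simp_all)
  qed (use a' in simp_all)
  then show thesis using a'(1) that by blast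
qed

lemma cat2_cart_functors:
  shows "is_functor (cat2_cart C) C (cod2 C)" "is_functor (cat2_cart C) C (dom2 C)"
proof -
  have "category (cat2_cart C)"
  proof
    fix w x y z k l n
    assume h: "k \<in> hom (cat2_cart C) w x" "l \<in> hom (cat2_cart C) x y" "n \<in> hom (cat2_cart C) y z"
    obtain a b where k: "k = (w, x, (a, b))" using h(1) by (cases k) auto
    obtain a' b' where l: "l = (x, y, (a', b'))" using h(2) by (cases l) auto
    obtain a'' b'' where n: "n = (y, z, (a'', b''))" using h(3) by (cases n) auto
    show "n \<cdot>\<^bsub>cat2_cart C\<^esub> l \<cdot>\<^bsub>cat2_cart C\<^esub> k = n \<cdot>\<^bsub>cat2_cart C\<^esub> (l \<cdot>\<^bsub>cat2_cart C\<^esub> k)"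
      using h unfolding k l n by (simp add: pb_squareD)
  qed (auto simp: pb_square_idt pb_square_paste pb_squareD)
  then show "is_functor (cat2_cart C) C (cod2 C)" "is_functor (cat2_cart C) C (dom2 C)"
    by (auto simp: is_functor_def cod2_def dom2_def category_axioms pb_squareD)
qed

end

section \<open>Generalized elements of pushforwards\<close>

lemma slice_simps [simp]:
  "f \<in> ob (slice E x) \<longleftrightarrow> f \<in> ar E \<and> cd E f = x"
  "(f, g, h) \<in> ar (slice E x) \<longleftrightarrow> f \<in> ar E \<and> cd E f = x \<and> g \<in> ar E \<and> cd E g = x \<and>
     h \<in> ar E \<and> dm E h = dm E f \<and> cd E h = dm E g \<and> g \<cdot>\<^bsub>E\<^esub> h = f"
  "dm (slice E x) (f, g, h) = f" "cd (slice E x) (f, g, h) = g"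
  "(g', k, h') \<cdot>\<^bsub>slice E x\<^esub> (f, g, h) = (f, k, h' \<cdot>\<^bsub>E\<^esub> h)"
  by (auto simp: slice_def diag_cat_simps)

lemma slice_fst_snd: "dm (slice E x) k = fst k" "cd (slice E x) k = fst (snd k)"
  by (cases k, simp)+

lemma components_simp [simp]: "components (x, y, t) = t"
  by (simp add: components_def)

text \<open>A generalized element of the fibre product of \<open>f\<close> and \<open>g\<close>. The
  equation between the domains is oriented towards \<open>x\<close> so that it can serve as a
  rewrite rule.\<close>

definition cone :: "('o, 'm, 'z) cat_scheme \<Rightarrow> 'm \<Rightarrow> 'm \<Rightarrow> 'm \<Rightarrow> 'm \<Rightarrow> bool" where
  "cone E f g x y \<longleftrightarrow> f \<in> ar E \<and> g \<in> ar E \<and> x \<in> ar E \<and> y \<in> ar E \<and> cd E f = cd E g \<and>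
     dm E y = dm E x \<and> cd E x = dm E f \<and> cd E y = dm E g \<and> f \<cdot>\<^bsub>E\<^esub> x = g \<cdot>\<^bsub>E\<^esub> y"

lemma coneD:
  assumes "cone E f g x y"
  shows "f \<in> ar E" "g \<in> ar E" "x \<in> ar E" "y \<in> ar E" "cd E f = cd E g" "dm E y = dm E x"
    "cd E x = dm E f" "cd E y = dm E g" "f \<cdot>\<^bsub>E\<^esub> x = g \<cdot>\<^bsub>E\<^esub> y"
  using assms by (auto simp: cone_def)

lemma (in category) cone_cmp:
  assumes "cone C f g x y" "h \<in> ar C" "cd C h = dm C x"
  shows "cone C f g (x \<cdot> h) (y \<cdot> h)"
  using assms cmp_reassoc[of f x "g \<cdot> y" h] by (auto simp: cone_def)

text \<open>
  Arrows with a common domain are treated as generalized elements.  An element \<open>f\<close> of the domain of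
  \<open>push E p q\<close> over \<open>x\<close> can be applied to the elements \<open>a\<close> of the domain of \<open>p\<close> over \<open>x\<close>, with
  values in the domain of \<open>q\<close>.
\<close>

definition app :: "('o, 'm, 'z) lcc_scheme \<Rightarrow> 'm \<Rightarrow> 'm \<Rightarrow> 'm \<Rightarrow> 'm \<Rightarrow> 'm" where
  "app E p q f a = components (pf_counit E p q) \<cdot>\<^bsub>E\<^esub> pb_pair E p (push E p q) a f"

context lcc_category
begin

lemma pb_typing [simp]:
  assumes "f \<in> ar E" "g \<in> ar E" "cd E f = cd E g"
  shows "pb1 E f g \<in> ar E" "pb2 E f g \<in> ar E" "cd E (pb1 E f g) = dm E f"
    "cd E (pb2 E f g) = dm E g" "dm E (pb2 E f g) = dm E (pb1 E f g)"
  using pullbacks[OF assms] by (auto simp: is_pullback_def)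

lemma pb_commutes:
  assumes "f \<in> ar E" "g \<in> ar E" "cd E f = cd E g"
  shows "f \<cdot> pb1 E f g = g \<cdot> pb2 E f g"
  using pullbacks[OF assms] by (auto simp: is_pullback_def)

lemma cone_pb:
  assumes "f \<in> ar E" "g \<in> ar E" "cd E f = cd E g"
  shows "cone E f g (pb1 E f g) (pb2 E f g)"
  using assms pb_commutes by (simp add: cone_def)

lemma pb_ext:
  assumes "f \<in> ar E" "g \<in> ar E" "cd E f = cd E g" "h \<in> ar E" "h' \<in> ar E" "dm E h = dm E h'"
    "cd E h = dm E (pb1 E f g)" "cd E h' = dm E (pb1 E f g)"
    "pb1 E f g \<cdot> h = pb1 E f g \<cdot> h'" "pb2 E f g \<cdot> h = pb2 E f g \<cdot> h'"
  shows "h = h'"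
  by (rule is_pullback_ext[OF pullbacks[OF assms(1-3)]]) (use assms in simp_all)

lemma pb_pair [simp]:
  assumes "cone E f g x y"
  shows "pb_pair E f g x y \<in> ar E" "dm E (pb_pair E f g x y) = dm E x"
    "cd E (pb_pair E f g x y) = dm E (pb1 E f g)"
    "pb1 E f g \<cdot> pb_pair E f g x y = x" "pb2 E f g \<cdot> pb_pair E f g x y = y"
proof -
  note c = coneD[OF assms]
  have "\<exists>!h. h \<in> hom E (dm E x) (dm E (pb1 E f g)) \<and> pb1 E f g \<cdot> h = x \<and> pb2 E f g \<cdot> h = y"
    using pullbacks[of f g] c unfolding is_pullback_def by metis
  from theI'[OF this] show "pb_pair E f g x y \<in> ar E" "dm E (pb_pair E f g x y) = dm E x"
    "cd E (pb_pair E f g x y) = dm E (pb1 E f g)"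
    "pb1 E f g \<cdot> pb_pair E f g x y = x" "pb2 E f g \<cdot> pb_pair E f g x y = y"
    by (auto simp: pb_pair_def)
qed

lemma pb_pair_cmp [simp]:
  assumes "cone E f g x y" "h \<in> ar E" "cd E h = dm E x"
  shows "pb_pair E f g x y \<cdot> h = pb_pair E f g (x \<cdot> h) (y \<cdot> h)"
proof -
  note [simp] = coneD[OF assms(1)] assms cone_cmp[OF assms]
  show ?thesis
    by (rule pb_ext[of f g]) (simp_all add: cmp_reassoc[OF pb_pair(4)] cmp_reassoc[OF pb_pair(5)])
qed

lemma pb_pair_eta:
  assumes "f \<in> ar E" "g \<in> ar E" "cd E f = cd E g" "h \<in> ar E" "cd E h = dm E (pb1 E f g)"
  shows "pb_pair E f g (pb1 E f g \<cdot> h) (pb2 E f g \<cdot> h) = h"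
proof -
  have "cone E f g (pb1 E f g \<cdot> h) (pb2 E f g \<cdot> h)"
    using assms by (intro cone_cmp cone_pb)
  then show ?thesis by - (rule pb_ext[of f g], use assms in simp_all)
qed

section \<open>Pushforward as a dependent function space\<close>

lemma pushD:
  assumes "p \<in> ar E"
  shows "is_functor (slice E (dm E p)) (slice E (cd E p)) (pf E p)"
    "\<And>q. q \<in> ar E \<Longrightarrow> cd E q = dm E p \<Longrightarrow>
      pf_counit E p q \<in> hom (slice E (dm E p)) (pb1 E p (push E p q)) q"
    "\<And>k. k \<in> ar (slice E (dm E p)) \<Longrightarrow>
      k \<cdot>\<^bsub>slice E (dm E p)\<^esub> pf_counit E p (fst k) =
      pf_counit E p (fst (snd k)) \<cdot>\<^bsub>slice E (dm E p)\<^esub> FA (pullback_ftor E p) (FA (pf E p) k)"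
    "\<And>x q f. x \<in> ar E \<Longrightarrow> cd E x = cd E p \<Longrightarrow> q \<in> ar E \<Longrightarrow> cd E q = dm E p \<Longrightarrow>
      f \<in> hom (slice E (dm E p)) (pb1 E p x) q \<Longrightarrow>
      \<exists>!g. g \<in> hom (slice E (cd E p)) x (push E p q) \<and>
        pf_counit E p q \<cdot>\<^bsub>slice E (dm E p)\<^esub> FA (pullback_ftor E p) g = f"
  using pushforward[OF assms] unfolding adjunction_def push_def
  by (auto simp: pullback_ftor_def slice_fst_snd simp del: in_hom_iff)

context
  fixes p q assumes qp [simp]: "p \<in> ar E" "q \<in> ar E" "cd E q = dm E p"
begin

lemma push_typing [simp]: "push E p q \<in> ar E" "cd E (push E p q) = cd E p"
  using is_functorD(3)[OF pushD(1)[OF qp(1)], of q] by (simp_all add: push_def)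

lemma counit_eq: "pf_counit E p q = (pb1 E p (push E p q), q, components (pf_counit E p q))"
  using pushD(2)[OF qp] by (cases "pf_counit E p q") auto

lemma counit_typing [simp]:
  shows "components (pf_counit E p q) \<in> ar E"
    "dm E (components (pf_counit E p q)) = dm E (pb1 E p (push E p q))"
    "cd E (components (pf_counit E p q)) = dm E q"
    "q \<cdot> components (pf_counit E p q) = pb1 E p (push E p q)"
  using pushD(2)[OF qp] by (subst (asm) counit_eq, simp)+

lemma app [simp]:
  assumes "cone E p (push E p q) a f"
  shows "app E p q f a \<in> ar E" "dm E (app E p q f a) = dm E a" "cd E (app E p q f a) = dm E q"
    "q \<cdot> app E p q f a = a"
  using assms cmp_reassoc[OF counit_typing(4)] by (simp_all add: app_def)

lemma app_cmp [simp]: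
  assumes "cone E p (push E p q) a f" "h \<in> ar E" "cd E h = dm E a"
  shows "app E p q f a \<cdot> h = app E p q (f \<cdot> h) (a \<cdot> h)"
  using assms by (simp add: app_def)

text \<open>Transposition under the adjunction, read as function abstraction: \<open>x\<close> is
  the base, and \<open>m\<close> is the body, depending on a point of the domain of \<open>p\<close>
  above \<open>x\<close>. The last clause is the beta rule, stated at every later stage
  \<open>h\<close> so that naturality needs no separate argument.\<close>

lemma pushforward_lam:
  assumes x: "x \<in> ar E" "cd E x = cd E p"
    and m: "m \<in> ar E" "dm E m = dm E (pb1 E p x)" "cd E m = dm E q" "q \<cdot> m = pb1 E p x"
  obtains g where "g \<in> ar E" "dm E g = dm E x" "cd E g = dm E (push E p q)" "push E p q \<cdot> g = x"
    "\<And>h a. cone E p x a h \<Longrightarrow> app E p q (g \<cdot> h) a = m \<cdot> pb_pair E p x a h"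
proof -
  have "(pb1 E p x, q, m) \<in> hom (slice E (dm E p)) (pb1 E p x) q" using x m by simp
  from pushD(4)[OF qp(1) x qp(2,3) this] obtain g'
    where g': "g' \<in> hom (slice E (cd E p)) x (push E p q)"
      and e: "pf_counit E p q \<cdot>\<^bsub>slice E (dm E p)\<^esub> FA (pullback_ftor E p) g' = (pb1 E p x, q, m)"
    by blast
  obtain g where geq: "g' = (x, push E p q, g)" using g' by (cases g') auto
  have g [simp]: "g \<in> ar E" "dm E g = dm E x" "cd E g = dm E (push E p q)"
    and gx: "push E p q \<cdot> g = x"
    using g' by (auto simp: geq)
  have c: "cone E p (push E p q) (pb1 E p x) (g \<cdot> pb2 E p x)"
    using x pb_commutes[of p x] cmp_reassoc[OF gx, of "pb2 E p x"] by (simp add: cone_def)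
  \<comment> \<open>The beta rule at the generic cone, formed by the two projections of the
    pullback. Every other cone factors through this one by \<open>pb_pair\<close>.\<close>
  have "components (pf_counit E p q) \<cdot> pb_pair E p (push E p q) (pb1 E p x) (g \<cdot> pb2 E p x) = m"
    using e by (subst (asm) counit_eq) (simp add: geq pullback_ftor_def)
  then have m0: "app E p q (g \<cdot> pb2 E p x) (pb1 E p x) = m" by (simp add: app_def)
  have "app E p q (g \<cdot> h) a = m \<cdot> pb_pair E p x a h" if "cone E p x a h" for h a
  proof -
    note [simp] = pb_pair[OF that]
    have "app E p q (g \<cdot> pb2 E p x \<cdot> pb_pair E p x a h) (pb1 E p x \<cdot> pb_pair E p x a h) =
        m \<cdot> pb_pair E p x a h"
      using app_cmp[OF c, of "pb_pair E p x a h"] x m0 by simp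
    moreover have "g \<cdot> pb2 E p x \<cdot> pb_pair E p x a h = g \<cdot> h" using x by simp
    ultimately show ?thesis by simp
  qed
  with g gx show thesis by (rule that)
qed

text \<open>Function extensionality. Uniqueness of transposes needs agreement at the generic cone
  only, and that cone is among the arguments over which the last assumption ranges.\<close>

lemma pushforward_ext:
  assumes g: "g \<in> ar E" "g' \<in> ar E" "dm E g = dm E g'" "cd E g = dm E (push E p q)"
    "cd E g' = dm E (push E p q)" "push E p q \<cdot> g = push E p q \<cdot> g'"
    and ext: "\<And>h a. cone E p (push E p q \<cdot> g) a h \<Longrightarrow> app E p q (g \<cdot> h) a = app E p q (g' \<cdot> h) a"
  shows "g = g'"
proof -
  define x where "x = push E p q \<cdot> g"
  note [simp] = g(1-5)
  have x [simp]: "x \<in> ar E" "dm E x = dm E g" "cd E x = cd E p" by (simp_all add: x_def)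
  have c: "cone E p (push E p q) (pb1 E p x) (g \<cdot> pb2 E p x)"
    "cone E p (push E p q) (pb1 E p x) (g' \<cdot> pb2 E p x)"
    using pb_commutes[of p x] cmp_reassoc[OF x_def[symmetric], of "pb2 E p x"]
      cmp_reassoc[OF trans[OF g(6)[symmetric] x_def[symmetric]], of "pb2 E p x"]
    by (simp_all add: cone_def)
  have "\<exists>!k. k \<in> hom (slice E (cd E p)) x (push E p q) \<and>
        pf_counit E p q \<cdot>\<^bsub>slice E (dm E p)\<^esub> FA (pullback_ftor E p) k =
          (pb1 E p x, q, app E p q (g \<cdot> pb2 E p x) (pb1 E p x))"
    by (rule pushD(4)) (use c in simp_all)
  moreover have "pf_counit E p q \<cdot>\<^bsub>slice E (dm E p)\<^esub> FA (pullback_ftor E p) (x, push E p q, g) =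
          (pb1 E p x, q, app E p q (g \<cdot> pb2 E p x) (pb1 E p x))"
    by (subst counit_eq) (simp add: pullback_ftor_def app_def)
  moreover have "app E p q (g \<cdot> pb2 E p x) (pb1 E p x) = app E p q (g' \<cdot> pb2 E p x) (pb1 E p x)"
    by (rule ext) (simp add: cone_pb flip: x_def)
  then have "pf_counit E p q \<cdot>\<^bsub>slice E (dm E p)\<^esub> FA (pullback_ftor E p) (x, push E p q, g') =
          (pb1 E p x, q, app E p q (g \<cdot> pb2 E p x) (pb1 E p x))"
    by (subst counit_eq) (simp add: pullback_ftor_def app_def)
  moreover have "(x, push E p q, k) \<in> hom (slice E (cd E p)) x (push E p q)" if "k = g \<or> k = g'" for k
    using that g(6) by (auto simp: x_def)
  ultimately have "(x, push E p q, g) = (x, push E p q, g')" by blast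
  then show ?thesis by simp
qed

end

text \<open>Naturality of the counit at the arrow \<open>r\<close> of the slice says that the
  pushforward functor acts by postcomposition with \<open>r\<close>. It is read off at the generic
  cone and then carried along the factorization of an arbitrary cone.\<close>

lemma push_arr:
  assumes p [simp]: "p \<in> ar E" "q \<in> ar E" "cd E q = dm E p" "r \<in> ar E" "cd E r = dm E q"
  shows "push_arr E p q r \<in> ar E" "dm E (push_arr E p q r) = dm E (push E p (q \<cdot> r))"
    "cd E (push_arr E p q r) = dm E (push E p q)"
    "push E p q \<cdot> push_arr E p q r = push E p (q \<cdot> r)"
    "\<And>f a. cone E p (push E p (q \<cdot> r)) a f \<Longrightarrow>
      app E p q (push_arr E p q r \<cdot> f) a = r \<cdot> app E p (q \<cdot> r) f a"
proof -
  let ?k = "(q \<cdot> r, q, r)"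
  let ?P = "pb1 E p (push E p (q \<cdot> r))"
  note F = is_functorD[OF pushD(1)[OF p(1)]]
  have k: "?k \<in> ar (slice E (dm E p))" by simp
  define t where "t = push_arr E p q r"
  have Fk: "FA (pf E p) ?k = (push E p (q \<cdot> r), push E p q, t)"
    using F(5)[OF k] F(6)[OF k]
    by (cases "FA (pf E p) ?k") (simp add: push_def t_def push_arr_def slice_fst_snd)
  have t [simp]: "t \<in> ar E" "dm E t = dm E (push E p (q \<cdot> r))" "cd E t = dm E (push E p q)"
    and tq: "push E p q \<cdot> t = push E p (q \<cdot> r)"
    using F(4)[OF k] by (simp_all add: Fk)
  show "push_arr E p q r \<in> ar E" "dm E (push_arr E p q r) = dm E (push E p (q \<cdot> r))"
    "cd E (push_arr E p q r) = dm E (push E p q)"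
    "push E p q \<cdot> push_arr E p q r = push E p (q \<cdot> r)"
    using tq by (simp_all flip: t_def)
  have c: "cone E p (push E p q) ?P (t \<cdot> pb2 E p (push E p (q \<cdot> r)))"
    using pb_commutes[of p "push E p (q \<cdot> r)"] cmp_reassoc[OF tq] by (simp add: cone_def)
  have "r \<cdot> components (pf_counit E p (q \<cdot> r)) = components (pf_counit E p q) \<cdot>
      pb_pair E p (push E p q) ?P (t \<cdot> pb2 E p (push E p (q \<cdot> r)))"
    using pushD(3)[OF p(1) k] unfolding Fk
    by (simp add: pullback_ftor_def, subst (asm) (1 2) counit_eq) simp_all
  then have e: "r \<cdot> components (pf_counit E p (q \<cdot> r)) =
      app E p q (t \<cdot> pb2 E p (push E p (q \<cdot> r))) ?P" by (simp add: app_def)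
  fix f a assume af [simp]: "cone E p (push E p (q \<cdot> r)) a f"
  note [simp] = coneD(3,4,6-8)[OF af]
  let ?f = "pb_pair E p (push E p (q \<cdot> r)) a f"
  have "r \<cdot> app E p (q \<cdot> r) f a = r \<cdot> components (pf_counit E p (q \<cdot> r)) \<cdot> ?f"
    by (simp add: app_def)
  also have "\<dots> = app E p q (t \<cdot> pb2 E p (push E p (q \<cdot> r)) \<cdot> ?f) (?P \<cdot> ?f)"
    unfolding e by (rule app_cmp) (use c in simp_all)
  also have "\<dots> = app E p q (t \<cdot> f) a" by simp
  finally show "app E p q (push_arr E p q r \<cdot> f) a = r \<cdot> app E p (q \<cdot> r) f a"
    by (simp add: t_def)
qed

end

section \<open>The action of pushforward on cartesian transformations\<close>

context lcc_category
begin

text \<open>Since \<open>sq\<close> is a pullback, every point of the domain of \<open>p'\<close>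
  above \<open>c \<cdot> x\<close> is the image under \<open>b\<close> of a point of the domain of
  \<open>p\<close>. Testing functions on such images is therefore enough.\<close>

lemma pushforward_ext_cart:
  assumes qp [simp]: "p' \<in> ar E" "q' \<in> ar E" "cd E q' = dm E p'"
    and sq: "pb_square E p p' b c"
    and g [simp]: "g \<in> ar E" "g' \<in> ar E" "dm E g = dm E x" "dm E g' = dm E x"
      "cd E g = dm E (push E p' q')" "cd E g' = dm E (push E p' q')"
    and x [simp]: "x \<in> ar E" "cd E x = cd E p"
    and e: "push E p' q' \<cdot> g = c \<cdot> x" "push E p' q' \<cdot> g' = c \<cdot> x"
    and ext: "\<And>h a. cone E p x a h \<Longrightarrow> app E p' q' (g \<cdot> h) (b \<cdot> a) = app E p' q' (g' \<cdot> h) (b \<cdot> a)"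
  shows "g = g'"
proof (rule pushforward_ext[OF qp])
  note s [simp] = pb_squareD(1-8)[OF sq]
  fix h a' assume "cone E p' (push E p' q' \<cdot> g) a' h"
  then have c: "cone E p' (c \<cdot> x) a' h" by (simp add: e)
  note [simp] = coneD(3,4,6-8)[OF c]
  have [simp]: "cd E h = dm E x" using coneD(8)[OF c] by simp
  obtain a where [simp]: "a \<in> ar E" "cd E a = dm E p" and a: "dm E a = dm E a'" "b \<cdot> a = a'"
    "p \<cdot> a = x \<cdot> h"
    by (rule pb_square_lift[OF sq, of a' "x \<cdot> h"]) (use coneD(9)[OF c] in simp_all)
  have "cone E p x a h" by (simp add: cone_def a)
  from ext[OF this] show "app E p' q' (g \<cdot> h) a' = app E p' q' (g' \<cdot> h) a'"
    by (simp add: a)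
qed (use e in simp_all)

lemma squareD:
  assumes "square E q q' a b"
  shows "a \<in> ar E" "dm E a = dm E q" "cd E a = dm E q'" "q' \<cdot> a = b \<cdot> q"
  using assms by (auto simp: square_def)

context
  fixes p q p' q' a b c
  assumes qp [simp]: "p \<in> ar E" "q \<in> ar E" "cd E q = dm E p"
    and qp' [simp]: "p' \<in> ar E" "q' \<in> ar E" "cd E q' = dm E p'"
    and sq: "square E q q' a b" and sq': "pb_square E p p' b c"
begin

lemma transport_cone:
  assumes "cone E p x y h"
  shows "cone E p' (c \<cdot> x) (b \<cdot> y) h"
proof -
  note [simp] = squareD[OF sq] pb_squareD(1-8)[OF sq']
  note [simp] = coneD(2-4,6-8)[OF assms] coneD(5)[OF assms, symmetric]
  show ?thesis
    using cmp_reassoc[OF pb_squareD(9)[OF sq'], of y] coneD(9)[OF assms] by (simp add: cone_def)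
qed

text \<open>The map is defined by abstraction over a point of the domain of \<open>p'\<close>: the
  pullback square turns it into a point \<open>y\<close> of the domain of \<open>p\<close>, to which
  the given function and then \<open>a\<close> are applied.\<close>

lemma push_map_ex:
  "\<exists>e\<in>ar E. dm E e = dm E (push E p q) \<and> cd E e = dm E (push E p' q') \<and>
    push E p' q' \<cdot> e = c \<cdot> push E p q \<and>
    (\<forall>f x. cone E p (push E p q) x f \<longrightarrow> app E p' q' (e \<cdot> f) (b \<cdot> x) = a \<cdot> app E p q f x)"
proof -
  note [simp] = squareD[OF sq] pb_squareD(1-8)[OF sq']
  let ?x = "c \<cdot> push E p q"
  let ?h = "pb2 E p' ?x"
  obtain y where [simp]: "y \<in> ar E" "cd E y = dm E p"
    and y: "dm E y = dm E (pb1 E p' ?x)" "b \<cdot> y = pb1 E p' ?x" "p \<cdot> y = push E p q \<cdot> ?h"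
    by (rule pb_square_lift[OF sq', of "pb1 E p' ?x" "push E p q \<cdot> ?h"])
      (simp_all add: pb_commutes)
  have c: "cone E p (push E p q) y ?h" by (simp add: cone_def y)
  let ?m = "a \<cdot> app E p q ?h y"
  have "q' \<cdot> ?m = pb1 E p' ?x"
    using c y cmp_reassoc[OF squareD(4)[OF sq], of "app E p q ?h y"] by simp
  then obtain e where e: "e \<in> ar E" "dm E e = dm E ?x" "cd E e = dm E (push E p' q')"
    "push E p' q' \<cdot> e = ?x"
    "\<And>f x. cone E p' ?x x f \<Longrightarrow> app E p' q' (e \<cdot> f) x = ?m \<cdot> pb_pair E p' ?x x f"
    by (rule pushforward_lam[OF qp', of ?x ?m, rotated -2]) (use c y in simp_all)
  have "app E p' q' (e \<cdot> f) (b \<cdot> x) = a \<cdot> app E p q f x" if fx: "cone E p (push E p q) x f" for f x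
  proof -
    note c' = transport_cone[OF fx]
    note [simp] = coneD(3,4,6-8)[OF fx] pb_pair[OF c'] c
    let ?p = "pb_pair E p' ?x (b \<cdot> x) f"
    \<comment> \<open>A point of the domain of \<open>p\<close> is determined by its images under
      \<open>b\<close> and \<open>p\<close>, so transporting an argument forward and back returns
      it.\<close>
    have "y \<cdot> ?p = x"
      by (rule pb_square_ext[OF sq'])
        (simp_all add: cmp_reassoc[OF y(2)] cmp_reassoc[OF y(3)] y(1) coneD(9)[OF fx])
    then show ?thesis using e(5)[OF c'] by (simp add: y(1))
  qed
  with e(1-4) show ?thesis by (intro bexI[of _ e]) simp_all
qed

text \<open>The definition of \<open>push_map\<close> imposes the equation at the generic cone only,
  where \<open>app\<close> is the bare counit. Any arrow satisfying it there satisfies it at every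
  cone, so extensionality identifies it with \<open>e\<close>.\<close>

lemma push_map_unique:
  assumes "e \<in> ar E" "dm E e = dm E (push E p q)" "cd E e = dm E (push E p' q')"
    "push E p' q' \<cdot> e = c \<cdot> push E p q"
    "\<And>f x. cone E p (push E p q) x f \<Longrightarrow> app E p' q' (e \<cdot> f) (b \<cdot> x) = a \<cdot> app E p q f x"
  shows "push_map E (q, p) (q', p') (a, b, c) = e"
proof -
  note [simp] = squareD[OF sq] pb_squareD(1-8)[OF sq']
  let ?p1 = "pb1 E p (push E p q)" let ?p2 = "pb2 E p (push E p q)"
  have ce: "cone E p (push E p q) ?p1 ?p2" by (simp add: cone_pb)
  have "pb_pair E p (push E p q) ?p1 ?p2 = idt E (dm E ?p1)"
    using pb_pair_eta[of p "push E p q" "idt E (dm E ?p1)"] by simp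
  then have id: "app E p q ?p2 ?p1 = components (pf_counit E p q)" by (simp add: app_def)
  show ?thesis unfolding push_map_def prod.case
  proof (rule the_equality)
    show "e \<in> hom E (dm E (push E p q)) (dm E (push E p' q')) \<and>
       push E p' q' \<cdot> e = c \<cdot> push E p q \<and>
       components (pf_counit E p' q') \<cdot> pb_pair E p' (push E p' q') (b \<cdot> ?p1) (e \<cdot> ?p2)
         = a \<cdot> components (pf_counit E p q)"
      using assms(1-4) assms(5)[OF ce] by (simp add: app_def id[unfolded app_def])
  next
    fix e' assume e': "e' \<in> hom E (dm E (push E p q)) (dm E (push E p' q')) \<and>
       push E p' q' \<cdot> e' = c \<cdot> push E p q \<and>
       components (pf_counit E p' q') \<cdot> pb_pair E p' (push E p' q') (b \<cdot> ?p1) (e' \<cdot> ?p2)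
         = a \<cdot> components (pf_counit E p q)"
    then have [simp]: "e' \<in> ar E" "dm E e' = dm E (push E p q)" "cd E e' = dm E (push E p' q')"
      and e2: "push E p' q' \<cdot> e' = c \<cdot> push E p q" by auto
    have e3: "app E p' q' (e' \<cdot> ?p2) (b \<cdot> ?p1) = a \<cdot> components (pf_counit E p q)"
      using e' by (simp add: app_def)
    show "e' = e"
    proof (rule pushforward_ext_cart[OF qp' sq', where x = "push E p q"])
      fix f x assume fx: "cone E p (push E p q) x f"
      note [simp] = coneD(3,4,6-8)[OF fx] pb_pair[OF fx]
      let ?p = "pb_pair E p (push E p q) x f"
      have c2: "cone E p' (push E p' q') (b \<cdot> ?p1) (e' \<cdot> ?p2)"
        using transport_cone[OF ce] cmp_reassoc[OF e2, of ?p2] by (simp add: cone_def)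
      have "app E p' q' (e' \<cdot> ?p2) (b \<cdot> ?p1) \<cdot> ?p = app E p' q' (e' \<cdot> ?p2 \<cdot> ?p) (b \<cdot> ?p1 \<cdot> ?p)"
        by (rule app_cmp) (use c2 in simp_all)
      then have "app E p' q' (e' \<cdot> f) (b \<cdot> x) = a \<cdot> app E p q f x"
        unfolding e3 by (simp add: app_def)
      then show "app E p' q' (e' \<cdot> f) (b \<cdot> x) = app E p' q' (e \<cdot> f) (b \<cdot> x)"
        using assms(5)[OF fx] by simp
    qed (use assms e2 in simp_all)
  qed
qed

lemma push_map:
  defines "e \<equiv> push_map E (q, p) (q', p') (a, b, c)"
  shows "e \<in> ar E" "dm E e = dm E (push E p q)" "cd E e = dm E (push E p' q')"
    "push E p' q' \<cdot> e = c \<cdot> push E p q"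
    "\<And>f x. cone E p (push E p q) x f \<Longrightarrow> app E p' q' (e \<cdot> f) (b \<cdot> x) = a \<cdot> app E p q f x"
proof -
  obtain e' where e': "e' \<in> ar E" "dm E e' = dm E (push E p q)" "cd E e' = dm E (push E p' q')"
    "push E p' q' \<cdot> e' = c \<cdot> push E p q"
    "\<And>f x. cone E p (push E p q) x f \<Longrightarrow> app E p' q' (e' \<cdot> f) (b \<cdot> x) = a \<cdot> app E p q f x"
    using push_map_ex by blast
  have "e = e'" unfolding e_def by (rule push_map_unique) (use e' in simp_all)
  with e' show "e \<in> ar E" "dm E e = dm E (push E p q)" "cd E e = dm E (push E p' q')"
    "push E p' q' \<cdot> e = c \<cdot> push E p q"
    "\<And>f x. cone E p (push E p q) x f \<Longrightarrow> app E p' q' (e \<cdot> f) (b \<cdot> x) = a \<cdot> app E p q f x"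
    by simp_all
qed

text \<open>An element over \<open>c \<cdot> x\<close> has its values on points
  \<open>b \<cdot> y\<close> in the domain of \<open>q'\<close>. As the square from \<open>q\<close>
  to \<open>q'\<close> is a pullback, each value comes from a unique element of the domain of
  \<open>q\<close> over \<open>y\<close>; abstracting over \<open>y\<close> gives the
  filler.\<close>

lemma beck_chevalley:
  assumes sqa: "pb_square E q q' a b"
  shows "pb_square E (push E p q) (push E p' q') (push_map E (q, p) (q', p') (a, b, c)) c"
proof -
  note [simp] = squareD[OF sq] pb_squareD(1-8)[OF sq']
  define e where "e = push_map E (q, p) (q', p') (a, b, c)"
  note e [simp] = push_map(1-3)[folded e_def] and e4 = push_map(4)[folded e_def]
    and e5 = push_map(5)[folded e_def]
  have "pb_square E (push E p q) (push E p' q') e c"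
  proof (rule pb_squareI)
    fix g' x assume [simp]: "g' \<in> ar E" "x \<in> ar E" "cd E g' = dm E (push E p' q')"
      "cd E x = cd E (push E p q)" "dm E g' = dm E x" and gx: "push E p' q' \<cdot> g' = c \<cdot> x"
    have [simp]: "cd E x = cd E p" by simp
    let ?p1 = "pb1 E p x" let ?p2 = "pb2 E p x"
    have cx: "cone E p x ?p1 ?p2" by (simp add: cone_pb)
    have c': "cone E p' (push E p' q') (b \<cdot> y) (g' \<cdot> h)" if y: "cone E p x y h" for y h
      using transport_cone[OF y] coneD(3,4,6-9)[OF y] cmp_reassoc[OF gx, of h] by (simp add: cone_def)
    obtain m where [simp]: "m \<in> ar E" "cd E m = dm E q" "dm E m = dm E ?p1"
      and m: "a \<cdot> m = app E p' q' (g' \<cdot> ?p2) (b \<cdot> ?p1)" "q \<cdot> m = ?p1"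
      by (rule pb_square_lift[OF sqa, of "app E p' q' (g' \<cdot> ?p2) (b \<cdot> ?p1)" ?p1])
        (use c'[OF cx] in simp_all)
    obtain g where g [simp]: "g \<in> ar E" "dm E g = dm E x" "cd E g = dm E (push E p q)"
      and g4: "push E p q \<cdot> g = x"
      and g5: "\<And>h a. cone E p x a h \<Longrightarrow> app E p q (g \<cdot> h) a = m \<cdot> pb_pair E p x a h"
      by (rule pushforward_lam[OF qp, of x m]) (use m in simp_all)
    have "e \<cdot> g = g'"
    proof (rule pushforward_ext_cart[OF qp' sq', where x = x])
      fix h y assume y: "cone E p x y h"
      note [simp] = coneD(3,4,6-8)[OF y] pb_pair[OF y]
      let ?p = "pb_pair E p x y h"
      have "cone E p (push E p q) y (g \<cdot> h)"
        using coneD(9)[OF y] cmp_reassoc[OF g4, of h] by (simp add: cone_def)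
      then have "app E p' q' (e \<cdot> (g \<cdot> h)) (b \<cdot> y) = a \<cdot> app E p q (g \<cdot> h) y" by (rule e5)
      also have "\<dots> = app E p' q' (g' \<cdot> ?p2) (b \<cdot> ?p1) \<cdot> ?p"
        using g5[OF y] cmp_reassoc[OF m(1)] by simp
      also have "\<dots> = app E p' q' (g' \<cdot> ?p2 \<cdot> ?p) (b \<cdot> ?p1 \<cdot> ?p)"
        by (rule app_cmp) (use c'[OF cx] in simp_all)
      also have "\<dots> = app E p' q' (g' \<cdot> h) (b \<cdot> y)" by simp
      finally show "app E p' q' (e \<cdot> g \<cdot> h) (b \<cdot> y) = app E p' q' (g' \<cdot> h) (b \<cdot> y)" by simp
    qed (use cmp_reassoc[OF e4, of g] gx g4 in simp_all)
    then show "\<exists>h\<in>ar E. dm E h = dm E g' \<and> cd E h = dm E (push E p q) \<and> e \<cdot> h = g' \<and> push E p q \<cdot> h = x"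
      using g4 by (intro bexI[of _ g]) simp_all
  next
    fix g g' assume [simp]: "g \<in> ar E" "g' \<in> ar E" "cd E g = dm E (push E p q)"
      "cd E g' = dm E (push E p q)" "dm E g = dm E g'"
      and eg: "e \<cdot> g = e \<cdot> g'" and pg: "push E p q \<cdot> g = push E p q \<cdot> g'"
    show "g = g'"
    proof (rule pushforward_ext[OF qp])
      fix h y assume y: "cone E p (push E p q \<cdot> g) y h"
      note [simp] = coneD(3,4,6,7)[OF y]
      have [simp]: "cd E h = dm E g'" using coneD(8)[OF y] by simp
      have c1: "cone E p (push E p q) y (g \<cdot> h)" using coneD(9)[OF y] by (simp add: cone_def)
      have c2: "cone E p (push E p q) y (g' \<cdot> h)"
        using coneD(9)[OF y] cmp_reassoc[OF pg, of h] by (simp add: cone_def)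
      show "app E p q (g \<cdot> h) y = app E p q (g' \<cdot> h) y"
      proof (rule pb_square_ext[OF sqa])
        show "a \<cdot> app E p q (g \<cdot> h) y = a \<cdot> app E p q (g' \<cdot> h) y"
          using e5[OF c1] e5[OF c2] cmp_reassoc[OF eg, of h] by simp
      qed (use c1 c2 in simp_all)
    qed (use pg in simp_all)
  qed (use e4 in simp_all)
  then show ?thesis by (simp add: e_def)
qed

end

lemma push_map_idt:
  assumes [simp]: "p \<in> ar E" "q \<in> ar E" "cd E q = dm E p"
  shows "push_map E (q, p) (q, p) (idt E (dm E q), idt E (dm E p), idt E (cd E p)) =
    idt E (dm E (push E p q))"
proof (rule push_map_unique)
  fix f x assume fx: "cone E p (push E p q) x f"
  show "app E p q (idt E (dm E (push E p q)) \<cdot> f) (idt E (dm E p) \<cdot> x) =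
      idt E (dm E q) \<cdot> app E p q f x"
    using fx coneD(3,4,6-8)[OF fx] by simp
next
  show "pb_square E p p (idt E (dm E p)) (idt E (cd E p))" by (rule pb_square_idt) simp
qed (simp_all add: square_def)

text \<open>By \<open>push_map_unique\<close> it suffices to chain the application equations of the
  two factors.\<close>

lemma push_map_cmp:
  assumes qp: "p \<in> ar E" "q \<in> ar E" "cd E q = dm E p" "p' \<in> ar E" "q' \<in> ar E" "cd E q' = dm E p'"
      "p'' \<in> ar E" "q'' \<in> ar E" "cd E q'' = dm E p''"
    and s: "square E q q' a b" "pb_square E p p' b c"
    and s': "square E q' q'' a' b'" "pb_square E p' p'' b' c'"
  shows "push_map E (q, p) (q'', p'') (a' \<cdot> a, b' \<cdot> b, c' \<cdot> c) =
    push_map E (q', p') (q'', p'') (a', b', c') \<cdot> push_map E (q, p) (q', p') (a, b, c)"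
proof -
  note m = push_map[OF qp(1-6) s] and m' = push_map[OF qp(4-9) s']
  note [simp] = qp squareD[OF s(1)] pb_squareD[OF s(2)] squareD[OF s'(1)] pb_squareD[OF s'(2)]
    m(1-3) m'(1-3)
  show ?thesis
  proof (rule push_map_unique)
    show "square E q q'' (a' \<cdot> a) (b' \<cdot> b)"
      by (simp add: square_def cmp_reassoc[OF squareD(4)[OF s'(1)]])
    show "pb_square E p p'' (b' \<cdot> b) (c' \<cdot> c)"
      by (rule pb_square_paste[OF s(2) s'(2)])
    show "push E p'' q'' \<cdot> (push_map E (q', p') (q'', p'') (a', b', c') \<cdot>
      push_map E (q, p) (q', p') (a, b, c)) = c' \<cdot> c \<cdot> push E p q"
      using cmp_reassoc[OF m'(4), of "push_map E (q, p) (q', p') (a, b, c)"] m(4) by simp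
  next
    fix f x assume fx: "cone E p (push E p q) x f"
    note [simp] = coneD(3,4,6-8)[OF fx]
    have "cone E p' (push E p' q') (b \<cdot> x) (push_map E (q, p) (q', p') (a, b, c) \<cdot> f)"
      using cmp_reassoc[OF m(4), of f] cmp_reassoc[OF pb_squareD(9)[OF s(2)], of x] coneD(9)[OF fx]
      by (simp add: cone_def)
    from m'(5)[OF this] m(5)[OF fx] fx
    show "app E p'' q'' (push_map E (q', p') (q'', p'') (a', b', c') \<cdot>
        push_map E (q, p) (q', p') (a, b, c) \<cdot> f) (b' \<cdot> b \<cdot> x) = a' \<cdot> a \<cdot> app E p q f x"
      by simp
  qed simp_all
qed

end

section \<open>Paths and the functor \<open>delta_ftor\<close>\<close>

context category
begin

text \<open>Pasting cancellation in the vertical direction: the lower square and the whole rectangle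
  being pullbacks, a filler of the rectangle is also one of the upper square.\<close>

lemma pb_square_left:
  assumes s: "pb_square C g k a' b'" and t: "pb_square C (g \<cdot> f) (k \<cdot> h) a b'"
    and f [simp]: "f \<in> ar C" "h \<in> ar C" "cd C f = dm C g" "cd C h = dm C k"
    and ha: "h \<cdot> a = a' \<cdot> f"
  shows "pb_square C f h a a'"
proof -
  note [simp] = pb_squareD(1-8)[OF s]
  have [simp]: "a \<in> ar C" "dm C a = dm C f" "cd C a = dm C h" using pb_squareD[OF t] by simp_all
  show ?thesis
  proof (rule pb_squareI)
    fix x y assume [simp]: "x \<in> ar C" "y \<in> ar C" "dm C x = dm C y" "cd C x = dm C h"
      "cd C y = cd C f" and e: "h \<cdot> x = a' \<cdot> y"
    have "k \<cdot> h \<cdot> x = b' \<cdot> (g \<cdot> y)" using e cmp_reassoc[OF pb_squareD(9)[OF s], of y] by simp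
    then obtain z where z: "z \<in> ar C" "dm C z = dm C x" "cd C z = dm C (g \<cdot> f)" "a \<cdot> z = x"
      "g \<cdot> f \<cdot> z = g \<cdot> y"
      by (rule pb_square_lift[OF t, of x "g \<cdot> y", rotated -2]) simp_all
    have "f \<cdot> z = y"
      by (rule pb_square_ext[OF s])
        (use z e cmp_reassoc[OF ha, of z] in simp_all)
    with z show "\<exists>z\<in>ar C. dm C z = dm C x \<and> cd C z = dm C f \<and> a \<cdot> z = x \<and> f \<cdot> z = y"
      by (intro bexI[of _ z]) simp_all
  next
    fix z z' assume [simp]: "z \<in> ar C" "z' \<in> ar C" "cd C z = dm C f" "cd C z' = dm C f"
      "dm C z = dm C z'" and e: "a \<cdot> z = a \<cdot> z'" "f \<cdot> z = f \<cdot> z'"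
    show "z = z'" by (rule pb_square_ext[OF t]) (use e in simp_all)
  qed (use ha in simp_all)
qed

end

text \<open>Base change of a pullback square along a compatible pair \<open>e\<close>,
  \<open>e'\<close>. Over \<open>k \<cdot> y\<close> the second component of an element of the
  target lies above \<open>b \<cdot> (e \<cdot> y)\<close>, so it lifts through the given
  square.\<close>

lemma (in lcc_category) pb_square_base_change:
  assumes s: "pb_square E p p' a b"
    and e [simp]: "e \<in> ar E" "e' \<in> ar E" "cd E e = cd E p" "cd E e' = cd E p'"
    and k [simp]: "k \<in> ar E" "dm E k = dm E e" "cd E k = dm E e'" and ek: "e' \<cdot> k = b \<cdot> e"
  defines "l \<equiv> pb_pair E e' p' (k \<cdot> pb1 E e p) (a \<cdot> pb2 E e p)"
  shows "pb_square E (pb1 E e p) (pb1 E e' p') l k" "l \<in> ar E" "dm E l = dm E (pb1 E e p)"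
    "cd E l = dm E (pb1 E e' p')" "pb1 E e' p' \<cdot> l = k \<cdot> pb1 E e p" "pb2 E e' p' \<cdot> l = a \<cdot> pb2 E e p"
proof -
  note [simp] = pb_squareD(1-8)[OF s]
  have c: "cone E e' p' (k \<cdot> pb1 E e p) (a \<cdot> pb2 E e p)"
    using cmp_reassoc[OF ek, of "pb1 E e p"] cmp_reassoc[OF pb_squareD(9)[OF s], of "pb2 E e p"]
      pb_commutes[of e p] by (simp add: cone_def)
  from pb_pair[OF c] show l [simp]: "l \<in> ar E" "dm E l = dm E (pb1 E e p)"
    "cd E l = dm E (pb1 E e' p')" and l1: "pb1 E e' p' \<cdot> l = k \<cdot> pb1 E e p"
    and l2: "pb2 E e' p' \<cdot> l = a \<cdot> pb2 E e p"
    by (simp_all add: l_def)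
  show "pb_square E (pb1 E e p) (pb1 E e' p') l k"
  proof (rule pb_squareI)
    fix x y assume [simp]: "x \<in> ar E" "y \<in> ar E" "dm E x = dm E y" "cd E x = dm E (pb1 E e' p')"
      "cd E y = cd E (pb1 E e p)" and xy: "pb1 E e' p' \<cdot> x = k \<cdot> y"
    have [simp]: "cd E y = dm E e" by simp
    have "p' \<cdot> (pb2 E e' p' \<cdot> x) = b \<cdot> (e \<cdot> y)"
      using cmp_reassoc[OF pb_commutes[of e' p'], of x] cmp_reassoc[OF ek, of y] xy by simp
    then obtain z where z [simp]: "z \<in> ar E" "dm E z = dm E y" "cd E z = dm E p"
      and z': "a \<cdot> z = pb2 E e' p' \<cdot> x" "p \<cdot> z = e \<cdot> y"
      by (rule pb_square_lift[OF s, of "pb2 E e' p' \<cdot> x" "e \<cdot> y", rotated -2]) simp_all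
    have cz: "cone E e p y z" using z' by (simp add: cone_def)
    let ?h = "pb_pair E e p y z"
    note [simp] = pb_pair[OF cz]
    have "l \<cdot> ?h = x"
      by (rule pb_ext[of e' p']) (simp_all add: cmp_reassoc[OF l1] cmp_reassoc[OF l2] xy z')
    then show "\<exists>h\<in>ar E. dm E h = dm E x \<and> cd E h = dm E (pb1 E e p) \<and> l \<cdot> h = x \<and> pb1 E e p \<cdot> h = y"
      by (intro bexI[of _ ?h]) simp_all
  next
    fix h h' assume [simp]: "h \<in> ar E" "h' \<in> ar E" "cd E h = dm E (pb1 E e p)"
      "cd E h' = dm E (pb1 E e p)" "dm E h = dm E h'"
      and e1: "l \<cdot> h = l \<cdot> h'" and e2: "pb1 E e p \<cdot> h = pb1 E e p \<cdot> h'"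
    have "pb2 E e p \<cdot> h = pb2 E e p \<cdot> h'"
    proof (rule pb_square_ext[OF s])
      show "a \<cdot> (pb2 E e p \<cdot> h) = a \<cdot> (pb2 E e p \<cdot> h')"
        using cmp_reassoc[OF l2, of h] cmp_reassoc[OF l2, of h'] e1 by simp
      show "p \<cdot> (pb2 E e p \<cdot> h) = p \<cdot> (pb2 E e p \<cdot> h')"
        using cmp_reassoc[OF pb_commutes[of e p], of h] cmp_reassoc[OF pb_commutes[of e p], of h'] e2
        by simp
    qed simp_all
    with e2 show "h = h'" by - (rule pb_ext[of e p], simp_all)
  qed (use l1 in simp_all)
qed

definition pr_pair :: "('o, 'm, 'z) lcc_interval_scheme \<Rightarrow> 'o \<Rightarrow> 'm \<Rightarrow> 'm \<Rightarrow> 'm" where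
  "pr_pair E x s t =
     (THE h. h \<in> hom E (dm E s) (dm E (prX E x)) \<and> prX E x \<cdot>\<^bsub>E\<^esub> h = s \<and> prI E x \<cdot>\<^bsub>E\<^esub> h = t)"

text \<open>The value of the path \<open>g\<close> in \<open>x\<close> at \<open>i\<close>, for generalized elements \<open>g\<close> and \<open>i\<close>.\<close>

definition pap :: "('o, 'm, 'z) lcc_interval_scheme \<Rightarrow> 'o \<Rightarrow> 'm \<Rightarrow> 'm \<Rightarrow> 'm" where
  "pap E x g i = eval E x \<cdot>\<^bsub>E\<^esub> pr_pair E (FO (path_ftor E) x) g i"

section \<open>Paths as functions on the interval\<close>

context lcc_interval_category
begin

text \<open>\<open>cyl x\<close> is X^I \<times> I, whose elements are a path (\<open>pfst\<close>)
  together with a time (\<open>psnd\<close>). The time need not be related to any time at which the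
  path is evaluated.\<close>

abbreviation "P \<equiv> FO (path_ftor E)"
abbreviation "cyl x \<equiv> dm E (prX E (P x))"
abbreviation "pfst x \<equiv> prX E (P x)"
abbreviation "psnd x \<equiv> prI E (P x)"

lemma product_typing [simp]:
  assumes "x \<in> ob E"
  shows "prX E x \<in> ar E" "prI E x \<in> ar E" "cd E (prX E x) = x" "cd E (prI E x) = intv E"
    "dm E (prI E x) = dm E (prX E x)"
  using products[OF assms] by (auto simp: is_product_def)

lemma product_ex1:
  assumes "x \<in> ob E" "s \<in> ar E" "t \<in> ar E" "dm E t = dm E s" "cd E s = x" "cd E t = intv E"
  shows "\<exists>!h. h \<in> hom E (dm E s) (dm E (prX E x)) \<and> prX E x \<cdot> h = s \<and> prI E x \<cdot> h = t"
proof -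
  have "dm E s \<in> ob E" "s \<in> hom E (dm E s) x" "t \<in> hom E (dm E s) (intv E)" using assms by auto
  then show ?thesis using products[OF assms(1)] unfolding is_product_def by blast
qed

lemma pr_pair [simp]:
  assumes "x \<in> ob E" "s \<in> ar E" "t \<in> ar E" "dm E t = dm E s" "cd E s = x" "cd E t = intv E"
  shows "pr_pair E x s t \<in> ar E" "dm E (pr_pair E x s t) = dm E s"
    "cd E (pr_pair E x s t) = dm E (prX E x)"
    "prX E x \<cdot> pr_pair E x s t = s" "prI E x \<cdot> pr_pair E x s t = t"
  using theI'[OF product_ex1[OF assms]] by (auto simp: pr_pair_def)

lemma pr_ext:
  assumes x: "x \<in> ob E" and "h \<in> ar E" "h' \<in> ar E" "dm E h = dm E h'"
    "cd E h = dm E (prX E x)" "cd E h' = dm E (prX E x)"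
    "prX E x \<cdot> h = prX E x \<cdot> h'" "prI E x \<cdot> h = prI E x \<cdot> h'"
  shows "h = h'"
  using product_ex1[of x "prX E x \<cdot> h" "prI E x \<cdot> h"] assms by auto

lemma pr_pair_cmp [simp]:
  assumes "x \<in> ob E" "s \<in> ar E" "t \<in> ar E" "dm E t = dm E s" "cd E s = x" "cd E t = intv E"
    "h \<in> ar E" "cd E h = dm E s"
  shows "pr_pair E x s t \<cdot> h = pr_pair E x (s \<cdot> h) (t \<cdot> h)"
  by (rule pr_ext[OF assms(1)])
    (use assms cmp_reassoc[OF pr_pair(4)[OF assms(1-6)]] cmp_reassoc[OF pr_pair(5)[OF assms(1-6)]]
      in simp_all)

lemma pr_pair_eta:
  assumes "x \<in> ob E" "h \<in> ar E" "cd E h = dm E (prX E x)"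
  shows "pr_pair E x (prX E x \<cdot> h) (prI E x \<cdot> h) = h"
  by (rule pr_ext[OF assms(1)]) (use assms in simp_all)

lemma prod_ftor_FO: "FO (prod_ftor E) x = dm E (prX E x)"
  by (simp add: prod_ftor_def)

lemma prod_ftor_FA [simp]:
  assumes "f \<in> ar E"
  shows "FA (prod_ftor E) f \<in> ar E" "dm E (FA (prod_ftor E) f) = dm E (prX E (dm E f))"
    "cd E (FA (prod_ftor E) f) = dm E (prX E (cd E f))"
    "prX E (cd E f) \<cdot> FA (prod_ftor E) f = f \<cdot> prX E (dm E f)"
    "prI E (cd E f) \<cdot> FA (prod_ftor E) f = prI E (dm E f)"
proof -
  have "FA (prod_ftor E) f = pr_pair E (cd E f) (f \<cdot> prX E (dm E f)) (prI E (dm E f))"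
    using assms by (simp add: prod_ftor_def pr_pair_def)
  then show "FA (prod_ftor E) f \<in> ar E" "dm E (FA (prod_ftor E) f) = dm E (prX E (dm E f))"
    "cd E (FA (prod_ftor E) f) = dm E (prX E (cd E f))"
    "prX E (cd E f) \<cdot> FA (prod_ftor E) f = f \<cdot> prX E (dm E f)"
    "prI E (cd E f) \<cdot> FA (prod_ftor E) f = prI E (dm E f)"
    using assms by simp_all
qed

lemma prod_ftor_pr_pair:
  assumes f: "f \<in> ar E" and "s \<in> ar E" "t \<in> ar E" "dm E t = dm E s" "cd E s = dm E f" "cd E t = intv E"
  shows "FA (prod_ftor E) f \<cdot> pr_pair E (dm E f) s t = pr_pair E (cd E f) (f \<cdot> s) t"
  by (rule pr_ext[of "cd E f"])
    (use assms cmp_reassoc[OF prod_ftor_FA(4)[OF f]] cmp_reassoc[OF prod_ftor_FA(5)[OF f]]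
      in simp_all)

lemma exponentialD:
  shows "is_functor E E (prod_ftor E)" "is_functor E E (path_ftor E)"
    "\<And>y. y \<in> ob E \<Longrightarrow> eval E y \<in> hom E (cyl y) y"
    "\<And>k. k \<in> ar E \<Longrightarrow> k \<cdot> eval E (dm E k) = eval E (cd E k) \<cdot> path_prod E k"
    "\<And>x y f. x \<in> ob E \<Longrightarrow> y \<in> ob E \<Longrightarrow> f \<in> hom E (dm E (prX E x)) y \<Longrightarrow>
      \<exists>!g. g \<in> hom E x (P y) \<and> eval E y \<cdot> FA (prod_ftor E) g = f"
  using exponentials unfolding adjunction_def path_prod_def prod_ftor_FO by blast+

lemmas path_ftor_typing [simp] = is_functorD(3-6)[OF exponentialD(2)]

lemma path_ftor_functor:
  "x \<in> ob E \<Longrightarrow> FA (path_ftor E) (idt E x) = idt E (P x)"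
  "f \<in> ar E \<Longrightarrow> g \<in> ar E \<Longrightarrow> cd E f = dm E g \<Longrightarrow>
    FA (path_ftor E) (g \<cdot> f) = FA (path_ftor E) g \<cdot> FA (path_ftor E) f"
  using is_functorD(7,8)[OF exponentialD(2)] by blast+

lemma eval_typing [simp]:
  "x \<in> ob E \<Longrightarrow> eval E x \<in> ar E" "x \<in> ob E \<Longrightarrow> dm E (eval E x) = cyl x"
  "x \<in> ob E \<Longrightarrow> cd E (eval E x) = x"
  using exponentialD(3)[of x] by auto

lemma path_prod [simp]:
  assumes "f \<in> ar E"
  shows "path_prod E f \<in> ar E" "dm E (path_prod E f) = cyl (dm E f)"
    "cd E (path_prod E f) = cyl (cd E f)"
  using assms by (simp_all add: path_prod_def)

text \<open>Stated with a trailing element \<open>w\<close>, so that the equations apply inside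
  composites associated to the right.\<close>

lemma pfst_path_prod [simp]:
  assumes "f \<in> ar E" "cd E f = y" "w \<in> ar E" "cd E w = cyl (dm E f)"
  shows "pfst y \<cdot> (path_prod E f \<cdot> w) = FA (path_ftor E) f \<cdot> (pfst (dm E f) \<cdot> w)"
    "psnd y \<cdot> (path_prod E f \<cdot> w) = psnd (dm E f) \<cdot> w"
  using assms cmp_reassoc[OF prod_ftor_FA(4)[of "FA (path_ftor E) f"], of w]
    cmp_reassoc[OF prod_ftor_FA(5)[of "FA (path_ftor E) f"], of w] by (auto simp: path_prod_def)

lemma path_prod_idt: "x \<in> ob E \<Longrightarrow> path_prod E (idt E x) = idt E (cyl x)"
  using is_functorD(7)[OF exponentialD(1), of "P x"]
  by (simp add: path_prod_def path_ftor_functor prod_ftor_FO)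

lemma path_prod_cmp:
  "f \<in> ar E \<Longrightarrow> g \<in> ar E \<Longrightarrow> cd E f = dm E g \<Longrightarrow>
    path_prod E (g \<cdot> f) = path_prod E g \<cdot> path_prod E f"
  using is_functorD(8)[OF exponentialD(1), of "FA (path_ftor E) f" "FA (path_ftor E) g"]
  by (simp add: path_prod_def path_ftor_functor)

lemma eval_natural: "k \<in> ar E \<Longrightarrow> dm E k = x \<Longrightarrow> cd E k = y \<Longrightarrow>
    eval E y \<cdot> path_prod E k = k \<cdot> eval E x"
  using exponentialD(4)[of k] by simp

lemma pap [simp]:
  assumes "x \<in> ob E" "g \<in> ar E" "i \<in> ar E" "dm E i = dm E g" "cd E g = P x" "cd E i = intv E"
  shows "pap E x g i \<in> ar E" "dm E (pap E x g i) = dm E g" "cd E (pap E x g i) = x"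
  using assms by (simp_all add: pap_def)

lemma pap_cmp [simp]:
  assumes "x \<in> ob E" "g \<in> ar E" "i \<in> ar E" "dm E i = dm E g" "cd E g = P x" "cd E i = intv E"
    "h \<in> ar E" "cd E h = dm E g"
  shows "pap E x g i \<cdot> h = pap E x (g \<cdot> h) (i \<cdot> h)"
  using assms by (simp add: pap_def)

lemma eval_eq_pap:
  assumes "x \<in> ob E" "w \<in> ar E" "cd E w = cyl x"
  shows "eval E x \<cdot> w = pap E x (pfst x \<cdot> w) (psnd x \<cdot> w)"
  using assms by (simp add: pap_def pr_pair_eta)

lemma pap_path_ftor:
  assumes f: "f \<in> ar E" "dm E f = x" "cd E f = y"
    and g: "g \<in> ar E" "i \<in> ar E" "dm E i = dm E g" "cd E g = P x" "cd E i = intv E"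
  shows "pap E y (FA (path_ftor E) f \<cdot> g) i = f \<cdot> pap E x g i"
proof -
  have "pap E y (FA (path_ftor E) f \<cdot> g) i = eval E y \<cdot> (path_prod E f \<cdot> pr_pair E (P x) g i)"
    using prod_ftor_pr_pair[of "FA (path_ftor E) f" g i] assms by (auto simp: pap_def path_prod_def)
  also have "\<dots> = f \<cdot> pap E x g i"
    using cmp_reassoc[OF eval_natural[OF f], of "pr_pair E (P x) g i"] assms
    by (auto simp: pap_def)
  finally show ?thesis .
qed

text \<open>Abstraction over time with its beta rule, the counterpart of
  \<open>pushforward_lam\<close> for the exponential adjunction.\<close>

lemma path_lam:
  assumes "x \<in> ob E" "f \<in> ar E" "dm E f = dm E (prX E x)" "cd E f = y"
  obtains g where "g \<in> ar E" "dm E g = x" "cd E g = P y"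
    "\<And>h i. h \<in> ar E \<Longrightarrow> i \<in> ar E \<Longrightarrow> dm E i = dm E h \<Longrightarrow> cd E h = x \<Longrightarrow> cd E i = intv E \<Longrightarrow>
      pap E y (g \<cdot> h) i = f \<cdot> pr_pair E x h i"
proof -
  have y: "y \<in> ob E" using assms(2,4) by auto
  have "\<exists>!g. g \<in> hom E x (P y) \<and> eval E y \<cdot> FA (prod_ftor E) g = f"
    using assms y by (intro exponentialD(5)) simp_all
  then obtain g where "g \<in> hom E x (P y) \<and> eval E y \<cdot> FA (prod_ftor E) g = f" by blast
  then have g: "g \<in> ar E" "dm E g = x" "cd E g = P y" "eval E y \<cdot> FA (prod_ftor E) g = f"
    by simp_all
  have "pap E y (g \<cdot> h) i = f \<cdot> pr_pair E x h i"
    if "h \<in> ar E" "i \<in> ar E" "dm E i = dm E h" "cd E h = x" "cd E i = intv E" for h i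
    using that g y assms(1) prod_ftor_pr_pair[of g h i] cmp_reassoc[OF g(4), of "pr_pair E x h i"]
    by (simp add: pap_def)
  with g show thesis by (intro that[of g])
qed

lemma path_ext:
  assumes g: "g \<in> ar E" "g' \<in> ar E" "dm E g = dm E g'" "cd E g = P y" "cd E g' = P y" "y \<in> ob E"
    and ext: "\<And>h i. h \<in> ar E \<Longrightarrow> i \<in> ar E \<Longrightarrow> dm E i = dm E h \<Longrightarrow> cd E h = dm E g' \<Longrightarrow>
      cd E i = intv E \<Longrightarrow> pap E y (g \<cdot> h) i = pap E y (g' \<cdot> h) i"
  shows "g = g'"
proof -
  let ?x = "dm E g'"
  have x: "?x \<in> ob E" using g by simp
  have e: "eval E y \<cdot> FA (prod_ftor E) k = pap E y (k \<cdot> prX E ?x) (prI E ?x)"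
    if "k \<in> ar E" "dm E k = ?x" "cd E k = P y" for k
    using that x g(6) prod_ftor_FA[of k] eval_eq_pap[of y "FA (prod_ftor E) k"] by simp
  have "eval E y \<cdot> FA (prod_ftor E) g = eval E y \<cdot> FA (prod_ftor E) g'"
    using e[of g] e[of g'] ext[of "prX E ?x" "prI E ?x"] g x by simp
  moreover have "\<exists>!k. k \<in> hom E ?x (P y) \<and> eval E y \<cdot> FA (prod_ftor E) k = eval E y \<cdot> FA (prod_ftor E) g'"
    using g x by (intro exponentialD(5)) simp_all
  ultimately show ?thesis using g by auto
qed

text \<open>The path functor preserves pullbacks as a right adjoint, and the product with the
  interval preserves them because times are carried along unchanged.\<close>

lemma pb_square_path_prod:
  assumes s: "pb_square E f g a b"
  shows "pb_square E (path_prod E f) (path_prod E g) (path_prod E a) (path_prod E b)"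
proof -
  note s' [simp] = pb_squareD(1-8)[OF s]
  have ga: "g \<cdot> a = b \<cdot> f" by (rule pb_squareD(9)[OF s])
  show ?thesis
  proof (rule pb_squareI)
    show "path_prod E g \<cdot> path_prod E a = path_prod E b \<cdot> path_prod E f"
      by (simp add: ga flip: path_prod_cmp)
  next
    fix x y assume [simp]: "x \<in> ar E" "y \<in> ar E" "dm E x = dm E y" "cd E x = dm E (path_prod E g)"
      "cd E y = cd E (path_prod E f)" and xy: "path_prod E g \<cdot> x = path_prod E b \<cdot> y"
    have [simp]: "cd E x = cyl (dm E g)" "cd E y = cyl (cd E f)" by simp_all
    let ?T = "dm E y" let ?s = "prX E ?T" let ?t = "prI E ?T"
    have fst: "FA (path_ftor E) g \<cdot> (pfst (dm E g) \<cdot> x) = FA (path_ftor E) b \<cdot> (pfst (cd E f) \<cdot> y)"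
      using pfst_path_prod(1)[of g "cd E g" x] pfst_path_prod(1)[of b "cd E g" y] xy by simp
    have snd: "psnd (dm E g) \<cdot> x = psnd (cd E f) \<cdot> y"
      using pfst_path_prod(2)[of g "cd E g" x] pfst_path_prod(2)[of b "cd E g" y] xy by simp
    \<comment> \<open>At the stage \<open>prX E ?T\<close>, with the generic time \<open>?t\<close>,
      both paths become points, for which the given pullback square has a filler. Abstracting the
      time makes the filler a path again.\<close>
    let ?x = "pap E (dm E g) (pfst (dm E g) \<cdot> x \<cdot> ?s) ?t"
    let ?y = "pap E (cd E f) (pfst (cd E f) \<cdot> y \<cdot> ?s) ?t"
    have "g \<cdot> ?x = b \<cdot> ?y"
      using cmp_reassoc[OF fst, of ?s] by (simp flip: pap_path_ftor)
    then obtain h where h [simp]: "h \<in> ar E" "dm E h = dm E ?x" "cd E h = dm E f"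
      and h': "a \<cdot> h = ?x" "f \<cdot> h = ?y"
      by (rule pb_square_lift[OF s, of ?x ?y, rotated -2]) simp_all
    obtain k where k [simp]: "k \<in> ar E" "dm E k = ?T" "cd E k = P (dm E f)"
      and k': "\<And>m i. m \<in> ar E \<Longrightarrow> i \<in> ar E \<Longrightarrow> dm E i = dm E m \<Longrightarrow> cd E m = ?T \<Longrightarrow> cd E i = intv E \<Longrightarrow>
        pap E (dm E f) (k \<cdot> m) i = h \<cdot> pr_pair E ?T m i"
      by (rule path_lam[of ?T h "dm E f"]) simp_all
    let ?w = "pr_pair E (P (dm E f)) k (psnd (cd E f) \<cdot> y)"
    have 1: "FA (path_ftor E) a \<cdot> k = pfst (dm E g) \<cdot> x"
      by (rule path_ext[of _ _ "dm E g"])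
        (simp_all add: pap_path_ftor k' cmp_reassoc[OF h'(1)])
    have 2: "FA (path_ftor E) f \<cdot> k = pfst (cd E f) \<cdot> y"
      by (rule path_ext[of _ _ "cd E f"])
        (simp_all add: pap_path_ftor k' cmp_reassoc[OF h'(2)])
    have "path_prod E a \<cdot> ?w = x"
      by (rule pr_ext[of "P (dm E g)"]) (simp_all add: 1 snd)
    moreover have "path_prod E f \<cdot> ?w = y"
      by (rule pr_ext[of "P (cd E f)"]) (simp_all add: 2)
    ultimately show "\<exists>h\<in>ar E. dm E h = dm E x \<and> cd E h = dm E (path_prod E f) \<and>
        path_prod E a \<cdot> h = x \<and> path_prod E f \<cdot> h = y"
      by (intro bexI[of _ ?w]) simp_all
  next
    fix h h' assume [simp]: "h \<in> ar E" "h' \<in> ar E" "cd E h = dm E (path_prod E f)"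
      "cd E h' = dm E (path_prod E f)" "dm E h = dm E h'"
      and e: "path_prod E a \<cdot> h = path_prod E a \<cdot> h'" "path_prod E f \<cdot> h = path_prod E f \<cdot> h'"
    have [simp]: "cd E h = cyl (dm E f)" "cd E h' = cyl (dm E f)" by simp_all
    have fa: "FA (path_ftor E) a \<cdot> (pfst (dm E f) \<cdot> h) = FA (path_ftor E) a \<cdot> (pfst (dm E f) \<cdot> h')"
      using pfst_path_prod(1)[of a "dm E g" h] pfst_path_prod(1)[of a "dm E g" h'] e(1) by simp
    have ff: "FA (path_ftor E) f \<cdot> (pfst (dm E f) \<cdot> h) = FA (path_ftor E) f \<cdot> (pfst (dm E f) \<cdot> h')"
      using pfst_path_prod(1)[of f "cd E f" h] pfst_path_prod(1)[of f "cd E f" h'] e(2) by simp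
    show "h = h'"
    proof (rule pr_ext[of "P (dm E f)"])
      show "psnd (dm E f) \<cdot> h = psnd (dm E f) \<cdot> h'"
        using pfst_path_prod(2)[of f "cd E f" h] pfst_path_prod(2)[of f "cd E f" h'] e(2) by simp
      show "pfst (dm E f) \<cdot> h = pfst (dm E f) \<cdot> h'"
      proof (rule path_ext[of _ _ "dm E f"])
        fix m i assume [simp]: "m \<in> ar E" "i \<in> ar E" "dm E i = dm E m"
          "cd E m = dm E (pfst (dm E f) \<cdot> h')" "cd E i = intv E"
        have [simp]: "cd E m = dm E h'" by simp
        show "pap E (dm E f) (pfst (dm E f) \<cdot> h \<cdot> m) i = pap E (dm E f) (pfst (dm E f) \<cdot> h' \<cdot> m) i"
          by (rule pb_square_ext[OF s])
            (use cmp_reassoc[OF fa, of m] cmp_reassoc[OF ff, of m]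
              in \<open>simp_all flip: pap_path_ftor\<close>)
      qed simp_all
    qed simp_all
  qed simp_all
qed

section \<open>The map \<open>\<delta> \<Rightarrow> p\<close> and its action on pullback
  squares\<close>

lemma delta_cone:
  "p \<in> ar E \<Longrightarrow> cone E (eval E (cd E p)) p (path_prod E p) (eval E (dm E p))"
  by (simp add: cone_def eval_natural)

lemma delta [simp]:
  assumes "p \<in> ar E"
  shows "delta_arr E p \<in> ar E" "dm E (delta_arr E p) = cyl (dm E p)"
    "cd E (delta_arr E p) = dm E (pb1 E (eval E (cd E p)) p)"
    "pb1 E (eval E (cd E p)) p \<cdot> delta_arr E p = path_prod E p"
    "pb2 E (eval E (cd E p)) p \<cdot> delta_arr E p = eval E (dm E p)"
  using pb_pair[OF delta_cone[OF assms]] assms by (simp_all add: delta_arr_def)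

lemma delta_base_change:
  assumes s: "pb_square E p p' a b"
  defines "l \<equiv> pb_pair E (eval E (cd E p')) p' (path_prod E b \<cdot> pb1 E (eval E (cd E p)) p)
            (a \<cdot> pb2 E (eval E (cd E p)) p)"
  shows "pb_square E (pb1 E (eval E (cd E p)) p) (pb1 E (eval E (cd E p')) p') l (path_prod E b)"
    "l \<in> ar E" "dm E l = dm E (pb1 E (eval E (cd E p)) p)"
    "cd E l = dm E (pb1 E (eval E (cd E p')) p')"
    "pb1 E (eval E (cd E p')) p' \<cdot> l = path_prod E b \<cdot> pb1 E (eval E (cd E p)) p"
    "pb2 E (eval E (cd E p')) p' \<cdot> l = a \<cdot> pb2 E (eval E (cd E p)) p"
proof -
  note [simp] = pb_squareD(1-8)[OF s]
  note * = pb_square_base_change[OF s, of "eval E (cd E p)" "eval E (cd E p')" "path_prod E b"]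
  show "pb_square E (pb1 E (eval E (cd E p)) p) (pb1 E (eval E (cd E p')) p') l (path_prod E b)"
    "l \<in> ar E" "dm E l = dm E (pb1 E (eval E (cd E p)) p)"
    "cd E l = dm E (pb1 E (eval E (cd E p')) p')"
    "pb1 E (eval E (cd E p')) p' \<cdot> l = path_prod E b \<cdot> pb1 E (eval E (cd E p)) p"
    "pb2 E (eval E (cd E p')) p' \<cdot> l = a \<cdot> pb2 E (eval E (cd E p)) p"
    unfolding l_def by (rule *; simp add: eval_natural)+
qed

text \<open>Vertical cancellation: \<open>path_prod E p\<close> factors as
  \<open>delta_arr E p\<close> followed by the base change of \<open>p\<close> along evaluation. The
  rectangle is a pullback by \<open>pb_square_path_prod\<close>, the lower square by base
  change.\<close>

lemma pb_square_delta:
  assumes s: "pb_square E p p' a b"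
  shows "pb_square E (delta_arr E p) (delta_arr E p') (path_prod E a)
    (pb_pair E (eval E (cd E p')) p' (path_prod E b \<cdot> pb1 E (eval E (cd E p)) p)
            (a \<cdot> pb2 E (eval E (cd E p)) p))"
proof -
  note [simp] = pb_squareD(1-8)[OF s]
  note l = delta_base_change[OF s] pb_square_path_prod[OF s]
  show ?thesis
  proof (rule pb_square_left[OF l(1)])
    show "delta_arr E p' \<cdot> path_prod E a = pb_pair E (eval E (cd E p')) p'
       (path_prod E b \<cdot> pb1 E (eval E (cd E p)) p) (a \<cdot> pb2 E (eval E (cd E p)) p) \<cdot> delta_arr E p"
      (is "_ = ?l \<cdot> _")
    proof (rule pb_ext[of "eval E (cd E p')" p'])
      show "pb1 E (eval E (cd E p')) p' \<cdot> (delta_arr E p' \<cdot> path_prod E a) =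
          pb1 E (eval E (cd E p')) p' \<cdot> (?l \<cdot> delta_arr E p)"
        using cmp_reassoc[OF l(5), of "delta_arr E p"] l(2-4) pb_squareD(9)[OF l(7)]
          cmp_reassoc[OF delta(4)[of p'], of "path_prod E a"] by simp
      show "pb2 E (eval E (cd E p')) p' \<cdot> (delta_arr E p' \<cdot> path_prod E a) =
          pb2 E (eval E (cd E p')) p' \<cdot> (?l \<cdot> delta_arr E p)"
        using cmp_reassoc[OF l(6), of "delta_arr E p"] l(2-4)
          cmp_reassoc[OF delta(5)[of p'], of "path_prod E a"] by (simp add: eval_natural)
    qed (use l(2-4) in simp_all)
  qed (use l(7) in simp_all)
qed

lemma delta_functor: "is_functor (cat2_cart E) (cat2_cart E) (delta_ftor E)"
  unfolding is_functor_def
proof (intro conjI ballI impI)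
  show "category (cat2_cart E)" "category (cat2_cart E)"
    using is_functorD(1)[OF cat2_cart_functors(1)] by simp_all
next
  fix f assume "f \<in> ar (cat2_cart E)"
  then show "FA (delta_ftor E) f \<in> hom (cat2_cart E) (FO (delta_ftor E) (dm (cat2_cart E) f))
      (FO (delta_ftor E) (cd (cat2_cart E) f))"
    by (cases f) (simp add: delta_ftor_def pb_square_delta)
next
  fix p assume "p \<in> ob (cat2_cart E)"
  then have p [simp]: "p \<in> ar E" by simp
  have "pb_pair E (eval E (cd E p)) p (pb1 E (eval E (cd E p)) p) (pb2 E (eval E (cd E p)) p) =
      idt E (dm E (pb1 E (eval E (cd E p)) p))"
    using pb_pair_eta[of "eval E (cd E p)" p "idt E (dm E (pb1 E (eval E (cd E p)) p))"] by simp
  then show "FA (delta_ftor E) (idt (cat2_cart E) p) = idt (cat2_cart E) (FO (delta_ftor E) p)"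
    by (simp add: delta_ftor_def path_prod_idt)
next
  fix k l assume kl: "k \<in> ar (cat2_cart E)" "l \<in> ar (cat2_cart E)"
    "cd (cat2_cart E) k = dm (cat2_cart E) l"
  obtain p p' a b where k: "k = (p, p', (a, b))" by (cases k) auto
  obtain p'' a' b' where l: "l = (p', p'', (a', b'))" using kl(3) unfolding k by (cases l) auto
  have s: "pb_square E p p' a b" and s': "pb_square E p' p'' a' b'" using kl unfolding k l by simp_all
  note [simp] = pb_squareD(1-8)[OF s] pb_squareD(1-8)[OF s']
  note d = delta_base_change[OF s] and d' = delta_base_change[OF s']
  note d'' = delta_base_change[OF pb_square_paste[OF s s']]
  have "pb_pair E (eval E (cd E p'')) p'' (path_prod E (b' \<cdot> b) \<cdot> pb1 E (eval E (cd E p)) p)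
      (a' \<cdot> a \<cdot> pb2 E (eval E (cd E p)) p) =
    pb_pair E (eval E (cd E p'')) p'' (path_prod E b' \<cdot> pb1 E (eval E (cd E p')) p')
      (a' \<cdot> pb2 E (eval E (cd E p')) p') \<cdot>
    pb_pair E (eval E (cd E p')) p' (path_prod E b \<cdot> pb1 E (eval E (cd E p)) p)
      (a \<cdot> pb2 E (eval E (cd E p)) p)" (is "?m = ?l' \<cdot> ?l")
    by (rule pb_ext[of "eval E (cd E p'')" p''])
      (use d(2-6) d'(2-4) d''(2-6) cmp_reassoc[OF d'(5), of ?l] cmp_reassoc[OF d'(6), of ?l]
        in \<open>simp_all add: path_prod_cmp\<close>)
  then show "FA (delta_ftor E) (l \<cdot>\<^bsub>cat2_cart E\<^esub> k) =
      FA (delta_ftor E) l \<cdot>\<^bsub>cat2_cart E\<^esub> FA (delta_ftor E) k"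
    unfolding k l by (simp add: delta_ftor_def path_prod_cmp)
qed (simp add: delta_ftor_def)

end

section \<open>The retract\<close>

text \<open>Such a section is a path lifting operation: from a path with a time and a point above
  its value at that time, it produces a lift of the path through the point, with the same
  time.\<close>

definition sectioned :: "('o, 'm, 'z) lcc_interval_scheme \<Rightarrow> 'm \<Rightarrow> 'm \<Rightarrow> bool" where
  "sectioned E p s \<longleftrightarrow> p \<in> ar E \<and> s \<in> ar E \<and> dm E s = cd E (delta_arr E p) \<and>
     cd E s = dm E (delta_arr E p) \<and> delta_arr E p \<cdot>\<^bsub>E\<^esub> s = idt E (cd E (delta_arr E p))"

definition sec :: "('o, 'm, 'z) lcc_interval_scheme \<Rightarrow> 'm \<Rightarrow> 'm \<Rightarrow> 'm \<Rightarrow> 'm \<Rightarrow> 'm" where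
  "sec E p s y a = s \<cdot>\<^bsub>E\<^esub> pb_pair E (eval E (cd E p)) p y a"

text \<open>\<open>a\<close> is a point over the path underlying \<open>y\<close>, at the time \<open>i\<close>.\<close>

definition over :: "('o, 'm, 'z) lcc_interval_scheme \<Rightarrow> 'm \<Rightarrow> 'm \<Rightarrow> 'm \<Rightarrow> 'm \<Rightarrow> bool" where
  "over E p y i a \<longleftrightarrow> y \<in> ar E \<and> cd E y = dm E (prX E (FO (path_ftor E) (cd E p))) \<and>
     i \<in> ar E \<and> cd E i = intv E \<and> dm E i = dm E y \<and> a \<in> ar E \<and> dm E a = dm E y \<and>
     cd E a = dm E p \<and> p \<cdot>\<^bsub>E\<^esub> a = pap E (cd E p) (prX E (FO (path_ftor E) (cd E p)) \<cdot>\<^bsub>E\<^esub> y) i"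

text \<open>The path through \<open>a\<close> at the time \<open>i\<close> that the section provides, with the time of \<open>y\<close>.\<close>

definition lift_path :: "('o, 'm, 'z) lcc_interval_scheme \<Rightarrow> 'm \<Rightarrow> 'm \<Rightarrow> 'm \<Rightarrow> 'm \<Rightarrow> 'm \<Rightarrow> 'm" where
  "lift_path E p s y i a = pr_pair E (FO (path_ftor E) (dm E p))
     (prX E (FO (path_ftor E) (dm E p)) \<cdot>\<^bsub>E\<^esub>
        sec E p s (pr_pair E (FO (path_ftor E) (cd E p)) (prX E (FO (path_ftor E) (cd E p)) \<cdot>\<^bsub>E\<^esub> y) i) a)
     (prI E (FO (path_ftor E) (cd E p)) \<cdot>\<^bsub>E\<^esub> y)"

context lcc_interval_category
begin

lemma pb_commutes_reassoc:
  assumes "f \<in> ar E" "g \<in> ar E" "cd E f = cd E g" "h \<in> ar E" "cd E h = dm E (pb1 E f g)"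
  shows "f \<cdot> (pb1 E f g \<cdot> h) = g \<cdot> (pb2 E f g \<cdot> h)"
  using cmp_reassoc[OF pb_commutes[OF assms(1-3)], of h] assms by simp

lemma delta_simp [simp]:
  assumes "p \<in> ar E" "cd E p = x"
  shows "pb1 E (eval E x) p \<cdot> delta_arr E p = path_prod E p"
    "pb2 E (eval E x) p \<cdot> delta_arr E p = eval E (dm E p)"
    "cd E (delta_arr E p) = dm E (pb1 E (eval E x) p)"
  using delta[OF assms(1)] assms(2) by simp_all

lemma delta_reassoc:
  assumes "p \<in> ar E" "cd E p = x" "w \<in> ar E" "cd E w = cyl (dm E p)"
  shows "pb1 E (eval E x) p \<cdot> (delta_arr E p \<cdot> w) = path_prod E p \<cdot> w"
    "pb2 E (eval E x) p \<cdot> (delta_arr E p \<cdot> w) = eval E (dm E p) \<cdot> w"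
  using cmp_reassoc[OF delta_simp(1)[OF assms(1,2)], of w]
    cmp_reassoc[OF delta_simp(2)[OF assms(1,2)], of w] assms by auto

lemma eval_path_prod:
  assumes "k \<in> ar E" "dm E k = x" "cd E k = y" "w \<in> ar E" "cd E w = cyl x"
  shows "eval E y \<cdot> (path_prod E k \<cdot> w) = k \<cdot> (eval E x \<cdot> w)"
  using cmp_reassoc[OF eval_natural[OF assms(1-3)], of w] assms by auto

lemma path_prod_pr_pair:
  assumes "f \<in> ar E" "dm E f = x" "cd E f = y"
    "g \<in> ar E" "i \<in> ar E" "dm E i = dm E g" "cd E g = P x" "cd E i = intv E"
  shows "path_prod E f \<cdot> pr_pair E (P x) g i = pr_pair E (P y) (FA (path_ftor E) f \<cdot> g) i"
  using prod_ftor_pr_pair[of "FA (path_ftor E) f" g i] assms by (auto simp: path_prod_def)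

lemma sectionedD:
  assumes "sectioned E p s"
  shows "p \<in> ar E" "s \<in> ar E" "dm E s = dm E (pb1 E (eval E (cd E p)) p)" "cd E s = cyl (dm E p)"
    "path_prod E p \<cdot> s = pb1 E (eval E (cd E p)) p" "eval E (dm E p) \<cdot> s = pb2 E (eval E (cd E p)) p"
proof -
  show p [simp]: "p \<in> ar E" and s [simp]: "s \<in> ar E" "dm E s = dm E (pb1 E (eval E (cd E p)) p)"
    "cd E s = cyl (dm E p)"
    using assms by (auto simp: sectioned_def)
  have "delta_arr E p \<cdot> s = idt E (dm E (pb1 E (eval E (cd E p)) p))"
    using assms by (simp add: sectioned_def)
  then show "path_prod E p \<cdot> s = pb1 E (eval E (cd E p)) p"
    "eval E (dm E p) \<cdot> s = pb2 E (eval E (cd E p)) p"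
    by (simp_all flip: delta_reassoc)
qed

lemma sec:
  assumes s: "sectioned E p s" and c: "cone E (eval E (cd E p)) p y a"
  shows "sec E p s y a \<in> ar E" "dm E (sec E p s y a) = dm E y" "cd E (sec E p s y a) = cyl (dm E p)"
    "path_prod E p \<cdot> sec E p s y a = y" "eval E (dm E p) \<cdot> sec E p s y a = a"
    "psnd (dm E p) \<cdot> sec E p s y a = psnd (cd E p) \<cdot> y"
proof -
  note [simp] = sectionedD(1-4)[OF s] pb_pair[OF c]
  show 1 [simp]: "sec E p s y a \<in> ar E" "dm E (sec E p s y a) = dm E y"
    "cd E (sec E p s y a) = cyl (dm E p)"
    by (simp_all add: sec_def)
  show 2: "path_prod E p \<cdot> sec E p s y a = y" "eval E (dm E p) \<cdot> sec E p s y a = a"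
    using cmp_reassoc[OF sectionedD(5)[OF s], of "pb_pair E (eval E (cd E p)) p y a"]
      cmp_reassoc[OF sectionedD(6)[OF s], of "pb_pair E (eval E (cd E p)) p y a"]
    by (simp_all add: sec_def)
  show "psnd (dm E p) \<cdot> sec E p s y a = psnd (cd E p) \<cdot> y"
    using pfst_path_prod(2)[of p "cd E p" "sec E p s y a"] by (simp add: 2)
qed

lemma sec_cmp:
  assumes s: "sectioned E p s" and c: "cone E (eval E (cd E p)) p y a"
    and "h \<in> ar E" "cd E h = dm E y"
  shows "sec E p s y a \<cdot> h = sec E p s (y \<cdot> h) (a \<cdot> h)"
  using assms sectionedD(1-4)[OF s] by (simp add: sec_def)

lemma overD:
  assumes "over E p y i a"
  shows "y \<in> ar E" "cd E y = cyl (cd E p)" "i \<in> ar E" "cd E i = intv E" "dm E i = dm E y" "a \<in> ar E"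
    "dm E a = dm E y" "cd E a = dm E p" "p \<cdot> a = pap E (cd E p) (pfst (cd E p) \<cdot> y) i"
  using assms by (auto simp: over_def)

lemma over_cone:
  assumes o: "over E p y i a" and p: "p \<in> ar E"
  shows "cone E (eval E (cd E p)) p (pr_pair E (P (cd E p)) (pfst (cd E p) \<cdot> y) i) a"
  using overD(1-8)[OF o] p overD(9)[OF o] by (simp add: cone_def pap_def)

text \<open>Replacing the time coordinate leaves the lifted path itself alone, so it still passes
  through \<open>a\<close> at \<open>i\<close>, while the pair now lies over \<open>y\<close>. When
  \<open>i\<close> is the time of \<open>y\<close> nothing is replaced, which is the last clause and
  the reason why the retraction commutes with \<open>delta_arr\<close>.\<close>

lemma lift_path:
  assumes s: "sectioned E p s" and o: "over E p y i a"
  shows "lift_path E p s y i a \<in> ar E" "dm E (lift_path E p s y i a) = dm E y"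
    "cd E (lift_path E p s y i a) = cyl (dm E p)"
    "path_prod E p \<cdot> lift_path E p s y i a = y"
    "pap E (dm E p) (pfst (dm E p) \<cdot> lift_path E p s y i a) i = a"
    "h \<in> ar E \<Longrightarrow> cd E h = dm E y \<Longrightarrow>
      lift_path E p s y i a \<cdot> h = lift_path E p s (y \<cdot> h) (i \<cdot> h) (a \<cdot> h)"
    "i = psnd (cd E p) \<cdot> y \<Longrightarrow> lift_path E p s y i a = sec E p s y a"
proof -
  note [simp] = sectionedD(1-4)[OF s] overD(1-8)[OF o]
  let ?y = "pr_pair E (P (cd E p)) (pfst (cd E p) \<cdot> y) i"
  note c = over_cone[OF o sectionedD(1)[OF s]]
  note S = sec[OF s c] and [simp] = sec(1-3)[OF s c]
  have S1: "FA (path_ftor E) p \<cdot> (pfst (dm E p) \<cdot> sec E p s ?y a) = pfst (cd E p) \<cdot> y"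
    using pfst_path_prod(1)[of p "cd E p" "sec E p s ?y a"] by (simp add: S)
  show t [simp]: "lift_path E p s y i a \<in> ar E" "dm E (lift_path E p s y i a) = dm E y"
    "cd E (lift_path E p s y i a) = cyl (dm E p)"
    by (simp_all add: lift_path_def)
  show "path_prod E p \<cdot> lift_path E p s y i a = y"
    by (rule pr_ext[of "P (cd E p)"]) (simp_all add: lift_path_def path_prod_pr_pair S1)
  have "pap E (dm E p) (pfst (dm E p) \<cdot> lift_path E p s y i a) i = eval E (dm E p) \<cdot> sec E p s ?y a"
    using eval_eq_pap[of "dm E p" "sec E p s ?y a"] S(6) by (simp add: lift_path_def)
  then show "pap E (dm E p) (pfst (dm E p) \<cdot> lift_path E p s y i a) i = a" by (simp add: S)
  show "lift_path E p s y i a \<cdot> h = lift_path E p s (y \<cdot> h) (i \<cdot> h) (a \<cdot> h)"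
    if "h \<in> ar E" "cd E h = dm E y"
    using that sec_cmp[OF s c, of h] by (simp add: lift_path_def)
  show "lift_path E p s y i a = sec E p s y a" if i: "i = psnd (cd E p) \<cdot> y"
  proof -
    have "?y = y" using pr_pair_eta[of "P (cd E p)" y] i by simp
    with S pr_pair_eta[of "P (dm E p)" "sec E p s y a"] show ?thesis
      by (simp add: lift_path_def)
  qed
qed

lemma pap_cone:
  assumes c: "cone E (path_prod E f) (path_prod E g) w m" and [simp]: "f \<in> ar E" "g \<in> ar E"
    "cd E f = cd E g" "i \<in> ar E" "dm E i = dm E w" "cd E i = intv E"
  shows "cone E f g (pap E (dm E f) (pfst (dm E f) \<cdot> w) i) (pap E (dm E g) (pfst (dm E g) \<cdot> m) i)"
proof -
  note [simp] = coneD(3,4,6)[OF c]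
  have [simp]: "cd E w = cyl (dm E f)" "cd E m = cyl (dm E g)" using coneD(7,8)[OF c] by simp_all
  have "FA (path_ftor E) f \<cdot> (pfst (dm E f) \<cdot> w) = FA (path_ftor E) g \<cdot> (pfst (dm E g) \<cdot> m)"
    using pfst_path_prod(1)[of f "cd E g" w] pfst_path_prod(1)[of g "cd E g" m] coneD(9)[OF c]
    by simp
  then show ?thesis by (simp add: cone_def flip: pap_path_ftor)
qed

text \<open>
  For \<open>q\<close> and \<open>p\<close> composable, \<open>delta_arr E (push E p q)\<close> is a retract of the image of
  \<open>delta_arr E q\<close> under the pushforward along \<open>path_prod E p\<close>.  The sections \<open>it\<close>, \<open>ib\<close> precompose
  with the projection from the path object of \<open>p\<close>, the retractions \<open>rt\<close>, \<open>rb\<close> with the section \<open>s\<close>.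
\<close>

definition section_top where
  "section_top q p it \<longleftrightarrow> it \<in> ar E \<and> dm E it = cyl (dm E (push E p q)) \<and>
     cd E it = dm E (push E (path_prod E p) (path_prod E q)) \<and>
     push E (path_prod E p) (path_prod E q) \<cdot> it = path_prod E (push E p q) \<and>
     (\<forall>m w i. cone E (path_prod E p) (path_prod E (push E p q)) w m \<longrightarrow>
        i \<in> ar E \<longrightarrow> dm E i = dm E w \<longrightarrow> cd E i = intv E \<longrightarrow>
        pap E (dm E q) (pfst (dm E q) \<cdot> app E (path_prod E p) (path_prod E q) (it \<cdot> m) w) i =
        app E p q (pap E (dm E (push E p q)) (pfst (dm E (push E p q)) \<cdot> m) i)
          (pap E (dm E p) (pfst (dm E p) \<cdot> w) i))"

text \<open>The codomain of \<open>delta_arr\<close> retains only a value at the time carried along,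
  so evaluation at that time stands in place of the free time \<open>i\<close> of
  \<open>section_top\<close>.\<close>

definition section_bot where
  "section_bot q p ib \<longleftrightarrow> ib \<in> ar E \<and> dm E ib = dm E (pb1 E (eval E (cd E p)) (push E p q)) \<and>
     cd E ib = dm E (push E (path_prod E p) (pb1 E (eval E (dm E p)) q)) \<and>
     push E (path_prod E p) (pb1 E (eval E (dm E p)) q) \<cdot> ib = pb1 E (eval E (cd E p)) (push E p q) \<and>
     (\<forall>k w. cone E (path_prod E p) (pb1 E (eval E (cd E p)) (push E p q)) w k \<longrightarrow>
        pb2 E (eval E (dm E p)) q \<cdot>
          app E (path_prod E p) (pb1 E (eval E (dm E p)) q) (ib \<cdot> k) w =
        app E p q (pb2 E (eval E (cd E p)) (push E p q) \<cdot> k) (eval E (dm E p) \<cdot> w))"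

text \<open>The function \<open>n\<close> accepts only lifts carrying the time of its base point,
  while values are wanted at every time \<open>i\<close>; \<open>lift_path\<close> reconciles the
  two.\<close>

definition retraction_top where
  "retraction_top q p s rt \<longleftrightarrow> rt \<in> ar E \<and>
     dm E rt = dm E (push E (path_prod E p) (path_prod E q)) \<and>
     cd E rt = cyl (dm E (push E p q)) \<and>
     path_prod E (push E p q) \<cdot> rt = push E (path_prod E p) (path_prod E q) \<and>
     (\<forall>n i a. n \<in> ar E \<longrightarrow> cd E n = dm E (push E (path_prod E p) (path_prod E q)) \<longrightarrow>
        over E p (push E (path_prod E p) (path_prod E q) \<cdot> n) i a \<longrightarrow>
        app E p q (pap E (dm E (push E p q)) (pfst (dm E (push E p q)) \<cdot> (rt \<cdot> n)) i) a =
        pap E (dm E q) (pfst (dm E q) \<cdot> app E (path_prod E p) (path_prod E q) n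
          (lift_path E p s (push E (path_prod E p) (path_prod E q) \<cdot> n) i a)) i)"

text \<open>Only the time of the base point enters here, so the section can be used directly,
  through \<open>sec\<close>.\<close>

definition retraction_bot where
  "retraction_bot q p s rb \<longleftrightarrow> rb \<in> ar E \<and>
     dm E rb = dm E (push E (path_prod E p) (pb1 E (eval E (dm E p)) q)) \<and>
     cd E rb = dm E (pb1 E (eval E (cd E p)) (push E p q)) \<and>
     pb1 E (eval E (cd E p)) (push E p q) \<cdot> rb = push E (path_prod E p) (pb1 E (eval E (dm E p)) q) \<and>
     (\<forall>l a. l \<in> ar E \<longrightarrow> cd E l = dm E (push E (path_prod E p) (pb1 E (eval E (dm E p)) q)) \<longrightarrow>
        cone E (eval E (cd E p)) p (push E (path_prod E p) (pb1 E (eval E (dm E p)) q) \<cdot> l) a \<longrightarrow>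
        app E p q (pb2 E (eval E (cd E p)) (push E p q) \<cdot> (rb \<cdot> l)) a =
        pb2 E (eval E (dm E p)) q \<cdot> app E (path_prod E p) (pb1 E (eval E (dm E p)) q) l
          (sec E p s (push E (path_prod E p) (pb1 E (eval E (dm E p)) q) \<cdot> l) a))"

section \<open>Existence of the four retract maps\<close>

context
  fixes q p
  assumes qp [simp]: "p \<in> ar E" "q \<in> ar E" "cd E q = dm E p"
begin

text \<open>The value is built from the inside: at the generic cone and the generic time, the path
  of functions and the path of arguments are both evaluated and one is applied to the other. The
  time is abstracted first, the argument last.\<close>

lemma section_top_ex: "\<exists>it. section_top q p it"
proof -
  let ?pp = "path_prod E p" let ?qq = "path_prod E q"
  let ?\<Pi> = "push E p q" let ?PP = "path_prod E (push E p q)"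
  let ?w = "pb1 E ?pp ?PP" let ?m = "pb2 E ?pp ?PP"
  let ?T = "dm E ?w"
  have c0: "cone E ?pp ?PP ?w ?m" by (rule cone_pb) simp_all
  have c1: "cone E ?pp ?PP (?w \<cdot> prX E ?T) (?m \<cdot> prX E ?T)"
    by (rule cone_cmp[OF c0]) simp_all
  have c2: "cone E p ?\<Pi> (pap E (dm E p) (pfst (dm E p) \<cdot> (?w \<cdot> prX E ?T)) (prI E ?T))
      (pap E (dm E ?\<Pi>) (pfst (dm E ?\<Pi>) \<cdot> (?m \<cdot> prX E ?T)) (prI E ?T))"
    (is "cone _ _ _ ?a ?f")
    by (rule pap_cone[OF c1]) simp_all
  note [simp] = app[OF qp c2]
  obtain g where g [simp]: "g \<in> ar E" "dm E g = ?T" "cd E g = P (dm E q)" and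
    g': "\<And>h i. h \<in> ar E \<Longrightarrow> i \<in> ar E \<Longrightarrow> dm E i = dm E h \<Longrightarrow> cd E h = ?T \<Longrightarrow> cd E i = intv E \<Longrightarrow>
      pap E (dm E q) (g \<cdot> h) i = app E p q ?f ?a \<cdot> pr_pair E ?T h i"
    by (rule path_lam[of ?T "app E p q ?f ?a" "dm E q"]) simp_all
  \<comment> \<open>The value must lie over the argument \<open>?w\<close>, which forces its time to
    be that of \<open>?w\<close>.\<close>
  let ?z = "pr_pair E (P (dm E q)) g (psnd (dm E p) \<cdot> ?w)"
  have "FA (path_ftor E) q \<cdot> g = pfst (dm E p) \<cdot> ?w"
    by (rule path_ext[of _ _ "dm E p"])
      (simp_all add: pap_path_ftor g' cmp_reassoc[OF app(4)[OF qp c2]])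
  then have z: "?qq \<cdot> ?z = ?w"
    by (simp add: path_prod_pr_pair pr_pair_eta)
  obtain it where it: "it \<in> ar E" "dm E it = dm E ?PP" "cd E it = dm E (push E ?pp ?qq)"
    "push E ?pp ?qq \<cdot> it = ?PP"
    "\<And>h a. cone E ?pp ?PP a h \<Longrightarrow> app E ?pp ?qq (it \<cdot> h) a = ?z \<cdot> pb_pair E ?pp ?PP a h"
    by (rule pushforward_lam[of ?pp ?qq ?PP ?z]) (use z in simp_all)
  have "pap E (dm E q) (pfst (dm E q) \<cdot> app E ?pp ?qq (it \<cdot> m) w) i =
        app E p q (pap E (dm E ?\<Pi>) (pfst (dm E ?\<Pi>) \<cdot> m) i) (pap E (dm E p) (pfst (dm E p) \<cdot> w) i)"
    if c: "cone E ?pp ?PP w m" and [simp]: "i \<in> ar E" "dm E i = dm E w" "cd E i = intv E" for m w i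
  proof -
    let ?h = "pb_pair E ?pp ?PP w m"
    note [simp] = coneD(3,4,6-8)[OF c] pb_pair[OF c]
    have "pap E (dm E q) (pfst (dm E q) \<cdot> app E ?pp ?qq (it \<cdot> m) w) i =
      pap E (dm E q) (g \<cdot> ?h) i"
      using it(5)[OF c] by simp
    also have "\<dots> = app E p q (?f \<cdot> pr_pair E ?T ?h i) (?a \<cdot> pr_pair E ?T ?h i)"
      using g'[of ?h i] app_cmp[OF qp c2, of "pr_pair E ?T ?h i"] by simp
    finally show ?thesis by simp
  qed
  with it have "section_top q p it" by (simp add: section_top_def)
  then show ?thesis ..
qed

text \<open>A value in the pullback of \<open>q\<close> along evaluation is a pair whose first
  component is forced to be the argument. Only the point \<open>?b\<close> has to be supplied, by
  applying the given function to the value of the path \<open>?w\<close> at its time.\<close>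

lemma section_bot_ex: "\<exists>ib. section_bot q p ib"
proof -
  let ?pp = "path_prod E p" let ?r = "pb1 E (eval E (dm E p)) q"
  let ?\<Pi> = "push E p q" let ?k1 = "pb1 E (eval E (cd E p)) ?\<Pi>"
  let ?k2 = "pb2 E (eval E (cd E p)) ?\<Pi>"
  let ?w = "pb1 E ?pp ?k1" let ?k = "pb2 E ?pp ?k1"
  have c: "cone E p ?\<Pi> (eval E (dm E p) \<cdot> w) (?k2 \<cdot> k)" if c: "cone E ?pp ?k1 w k" for w k
    using coneD(3,4,6-8)[OF c] coneD(9)[OF c] eval_path_prod[of p "dm E p" "cd E p" w]
      cmp_reassoc[OF pb_commutes[of "eval E (cd E p)" ?\<Pi>], of k] by (simp add: cone_def)
  have c0: "cone E ?pp ?k1 ?w ?k" by (rule cone_pb) simp_all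
  note [simp] = app[OF qp c[OF c0]]
  let ?b = "app E p q (?k2 \<cdot> ?k) (eval E (dm E p) \<cdot> ?w)"
  have c1: "cone E (eval E (dm E p)) q ?w ?b" by (simp add: cone_def)
  note [simp] = pb_pair[OF c1]
  obtain ib where ib: "ib \<in> ar E" "dm E ib = dm E ?k1" "cd E ib = dm E (push E ?pp ?r)"
    "push E ?pp ?r \<cdot> ib = ?k1"
    "\<And>h a. cone E ?pp ?k1 a h \<Longrightarrow> app E ?pp ?r (ib \<cdot> h) a =
      pb_pair E (eval E (dm E p)) q ?w ?b \<cdot> pb_pair E ?pp ?k1 a h"
    by (rule pushforward_lam[of ?pp ?r ?k1 "pb_pair E (eval E (dm E p)) q ?w ?b"]) simp_all
  have "pb2 E (eval E (dm E p)) q \<cdot> app E ?pp ?r (ib \<cdot> k) w =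
      app E p q (?k2 \<cdot> k) (eval E (dm E p) \<cdot> w)" if ck: "cone E ?pp ?k1 w k" for w k
  proof -
    let ?h = "pb_pair E ?pp ?k1 w k"
    note [simp] = coneD(3,4,6-8)[OF ck] pb_pair[OF ck]
    have "pb2 E (eval E (dm E p)) q \<cdot> app E ?pp ?r (ib \<cdot> k) w = ?b \<cdot> ?h"
      using ib(5)[OF ck] cmp_reassoc[OF pb_pair(5)[OF c1], of ?h] by (simp del: pb_pair_cmp app_cmp)
    also have "\<dots> = app E p q (?k2 \<cdot> ?k \<cdot> ?h) (eval E (dm E p) \<cdot> ?w \<cdot> ?h)"
      by (rule app_cmp[OF qp c[OF c0]]) simp_all
    finally show ?thesis by simp
  qed
  with ib have "section_bot q p ib" by (simp add: section_bot_def)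
  then show ?thesis ..
qed

text \<open>The first component is forced by the base. The second is a function of a point
  \<open>?a\<close> above the value of the base path: the section lifts the path through
  \<open>?a\<close>, and the lift is an admissible argument of the given function.\<close>

lemma retraction_bot_ex:
  assumes s: "sectioned E p s"
  shows "\<exists>rb. retraction_bot q p s rb"
proof -
  let ?pp = "path_prod E p" let ?r = "pb1 E (eval E (dm E p)) q" let ?L = "push E ?pp ?r"
  let ?\<Pi> = "push E p q" let ?k1 = "pb1 E (eval E (cd E p)) ?\<Pi>"
  let ?k2 = "pb2 E (eval E (cd E p)) ?\<Pi>"
  let ?x = "eval E (cd E p) \<cdot> ?L" let ?a = "pb1 E p ?x" let ?l = "pb2 E p ?x"
  have cs: "cone E (eval E (cd E p)) p (?L \<cdot> l) a" if "cone E p ?x a l" for a l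
    using coneD(3,4,6-9)[OF that] by (simp add: cone_def)
  have ca: "cone E ?pp ?L (sec E p s (?L \<cdot> l) a) l"
    if "cone E (eval E (cd E p)) p (?L \<cdot> l) a" "l \<in> ar E" "cd E l = dm E ?L" for a l
    using sec[OF s that(1)] that(2,3) by (simp add: cone_def)
  have c0: "cone E p ?x ?a ?l" by (rule cone_pb) simp_all
  note c1 = cs[OF c0]
  have c2: "cone E ?pp ?L (sec E p s (?L \<cdot> ?l) ?a) ?l" by (rule ca[OF c1]) simp_all
  note [simp] = sec(1-3,5)[OF s c1] app[OF _ _ _ c2]
  let ?m = "pb2 E (eval E (dm E p)) q \<cdot> app E ?pp ?r ?l (sec E p s (?L \<cdot> ?l) ?a)"
  \<comment> \<open>That the result lies over \<open>?a\<close> amounts to the lifted path passing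
    through \<open>?a\<close>.\<close>
  have "q \<cdot> ?m = eval E (dm E p) \<cdot> (?r \<cdot> app E ?pp ?r ?l (sec E p s (?L \<cdot> ?l) ?a))"
    by (rule pb_commutes_reassoc[symmetric]) simp_all
  then have m: "q \<cdot> ?m = ?a" by simp
  have t: "?x \<in> ar E" "cd E ?x = cd E p" "?m \<in> ar E" "dm E ?m = dm E ?a" "cd E ?m = dm E q"
    by simp_all
  obtain f where f [simp]: "f \<in> ar E" "dm E f = dm E ?x" "cd E f = dm E ?\<Pi>" and
    f4: "?\<Pi> \<cdot> f = ?x" and
    f5: "\<And>h a. cone E p ?x a h \<Longrightarrow> app E p q (f \<cdot> h) a = ?m \<cdot> pb_pair E p ?x a h"
    by (rule pushforward_lam[OF qp t m]) (rule that; blast)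
  let ?rb = "pb_pair E (eval E (cd E p)) ?\<Pi> ?L f"
  have cf: "cone E (eval E (cd E p)) ?\<Pi> ?L f" using f4 by (simp add: cone_def)
  note [simp] = pb_pair[OF cf]
  have "app E p q (?k2 \<cdot> (?rb \<cdot> l)) a = pb2 E (eval E (dm E p)) q \<cdot> app E ?pp ?r l
          (sec E p s (?L \<cdot> l) a)"
    if l [simp]: "l \<in> ar E" "cd E l = dm E ?L" and c: "cone E (eval E (cd E p)) p (?L \<cdot> l) a" for l a
  proof -
    note [simp] = coneD(3,6,7)[OF c]
    have [simp]: "a \<in> ar E" "dm E a = dm E l" "cd E a = dm E p" using coneD(4,6,8)[OF c] by simp_all
    have cx: "cone E p ?x a l" using coneD(9)[OF c] by (simp add: cone_def)
    note [simp] = pb_pair[OF cx]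
    let ?h = "pb_pair E p ?x a l"
    have "app E p q (?k2 \<cdot> (?rb \<cdot> l)) a = ?m \<cdot> ?h"
      using f5[OF cx] cmp_reassoc[OF pb_pair(5)[OF cf], of l] by (simp del: pb_pair_cmp app_cmp)
    also have "\<dots> = pb2 E (eval E (dm E p)) q \<cdot> (app E ?pp ?r ?l (sec E p s (?L \<cdot> ?l) ?a) \<cdot> ?h)"
      by (simp del: app_cmp)
    also have "app E ?pp ?r ?l (sec E p s (?L \<cdot> ?l) ?a) \<cdot> ?h =
        app E ?pp ?r (?l \<cdot> ?h) (sec E p s (?L \<cdot> ?l) ?a \<cdot> ?h)"
      by (rule app_cmp[OF _ _ _ c2]) simp_all
    also have "sec E p s (?L \<cdot> ?l) ?a \<cdot> ?h = sec E p s (?L \<cdot> l) a"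
      using sec_cmp[OF s c1, of ?h] by simp
    finally show ?thesis by simp
  qed
  then have "retraction_bot q p s ?rb" by (simp add: retraction_bot_def)
  then show ?thesis ..
qed

text \<open>The abstractions are nested the other way round than for \<open>section_top\<close>: at
  the generic time the argument is abstracted, giving \<open>f\<close>, and afterwards the time,
  giving the path of functions \<open>g\<close>.\<close>

lemma retraction_top_ex:
  assumes s: "sectioned E p s"
  shows "\<exists>rt. retraction_top q p s rt"
proof -
  let ?pp = "path_prod E p" let ?qq = "path_prod E q" let ?N = "push E ?pp ?qq"
  let ?\<Pi> = "push E p q" let ?PP = "path_prod E (push E p q)"
  let ?n = "prX E (dm E ?N)" let ?i = "prI E (dm E ?N)"
  let ?x = "pap E (cd E p) (pfst (cd E p) \<cdot> (?N \<cdot> ?n)) ?i"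
  let ?a = "pb1 E p ?x" let ?t = "pb2 E p ?x"
  have co: "over E p (?N \<cdot> (?n \<cdot> t)) (?i \<cdot> t) a" if "cone E p ?x a t" for a t
    using coneD(3,4,6-9)[OF that] by (simp add: over_def)
  have ca: "cone E ?pp ?N (lift_path E p s (?N \<cdot> n) i a) n"
    if "over E p (?N \<cdot> n) i a" "n \<in> ar E" "cd E n = dm E ?N" for a n i
    using lift_path[OF s that(1)] that(2,3) by (simp add: cone_def)
  have c0: "cone E p ?x ?a ?t" by (rule cone_pb) simp_all
  note o = co[OF c0]
  let ?w = "lift_path E p s (?N \<cdot> (?n \<cdot> ?t)) (?i \<cdot> ?t) ?a"
  have c2: "cone E ?pp ?N ?w (?n \<cdot> ?t)" by (rule ca[OF o]) simp_all
  note [simp] = lift_path(1-3,5)[OF s o] app(1-3)[OF _ _ _ c2]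
  let ?z = "app E ?pp ?qq (?n \<cdot> ?t) ?w"
  let ?m = "pap E (dm E q) (pfst (dm E q) \<cdot> ?z) (?i \<cdot> ?t)"
  \<comment> \<open>The result lies over \<open>?a\<close> because the path \<open>?w\<close> passes
    through \<open>?a\<close> at the generic time \<open>?i \<cdot> ?t\<close>, even though it
    carries another time.\<close>
  have "q \<cdot> ?m = pap E (dm E p) (pfst (dm E p) \<cdot> (?qq \<cdot> ?z)) (?i \<cdot> ?t)"
    by (simp flip: pap_path_ftor)
  also have "?qq \<cdot> ?z = ?w" by (rule app(4)[OF _ _ _ c2]) simp_all
  finally have m: "q \<cdot> ?m = ?a" by simp
  have t: "?x \<in> ar E" "cd E ?x = cd E p" "?m \<in> ar E" "dm E ?m = dm E ?a" "cd E ?m = dm E q"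
    by simp_all
  obtain f where f [simp]: "f \<in> ar E" "dm E f = dm E ?x" "cd E f = dm E ?\<Pi>" and
    f4: "?\<Pi> \<cdot> f = ?x" and
    f5: "\<And>h a. cone E p ?x a h \<Longrightarrow> app E p q (f \<cdot> h) a = ?m \<cdot> pb_pair E p ?x a h"
    by (rule pushforward_lam[OF qp t m]) (rule that; blast)
  obtain g where g [simp]: "g \<in> ar E" "dm E g = dm E ?N" "cd E g = P (dm E ?\<Pi>)" and
    g': "\<And>h i. h \<in> ar E \<Longrightarrow> i \<in> ar E \<Longrightarrow> dm E i = dm E h \<Longrightarrow> cd E h = dm E ?N \<Longrightarrow> cd E i = intv E \<Longrightarrow>
      pap E (dm E ?\<Pi>) (g \<cdot> h) i = f \<cdot> pr_pair E (dm E ?N) h i"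
    by (rule path_lam[of "dm E ?N" f "dm E ?\<Pi>"]) simp_all
  let ?rt = "pr_pair E (P (dm E ?\<Pi>)) g (psnd (cd E p) \<cdot> ?N)"
  have "FA (path_ftor E) ?\<Pi> \<cdot> g = pfst (cd E p) \<cdot> ?N"
    by (rule path_ext[of _ _ "cd E p"])
      (simp_all add: pap_path_ftor g' cmp_reassoc[OF f4])
  then have rt: "?PP \<cdot> ?rt = ?N"
    by (simp add: path_prod_pr_pair pr_pair_eta)
  have "app E p q (pap E (dm E ?\<Pi>) (pfst (dm E ?\<Pi>) \<cdot> (?rt \<cdot> n)) i) a =
        pap E (dm E q) (pfst (dm E q) \<cdot> app E ?pp ?qq n (lift_path E p s (?N \<cdot> n) i a)) i"
    if n [simp]: "n \<in> ar E" "cd E n = dm E ?N" and o': "over E p (?N \<cdot> n) i a" for n i a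
  proof -
    note [simp] = overD(3,4,6,8)[OF o']
    have [simp]: "dm E i = dm E n" "dm E a = dm E n" using overD(5,7)[OF o'] by simp_all
    let ?ni = "pr_pair E (dm E ?N) n i"
    have cx: "cone E p ?x a ?ni" using overD(9)[OF o'] by (simp add: cone_def)
    note [simp] = pb_pair[OF cx]
    let ?h = "pb_pair E p ?x a ?ni"
    have tn: "?n \<cdot> (?t \<cdot> ?h) = n" "?i \<cdot> (?t \<cdot> ?h) = i" by simp_all
    have "app E p q (pap E (dm E ?\<Pi>) (pfst (dm E ?\<Pi>) \<cdot> (?rt \<cdot> n)) i) a = ?m \<cdot> ?h"
      using f5[OF cx] g'[of n i] by (simp del: pap_cmp)
    also have "\<dots> = pap E (dm E q) (pfst (dm E q) \<cdot> (?z \<cdot> ?h)) (?i \<cdot> (?t \<cdot> ?h))"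
      by (simp del: app_cmp)
    also have "?z \<cdot> ?h = app E ?pp ?qq (?n \<cdot> ?t \<cdot> ?h) (?w \<cdot> ?h)"
      by (rule app_cmp[OF _ _ _ c2]) simp_all
    also have "?w \<cdot> ?h = lift_path E p s (?N \<cdot> n) i a"
      using lift_path(6)[OF s o, of ?h] by simp
    finally show ?thesis by simp
  qed
  with rt have "retraction_top q p s ?rt" by (simp add: retraction_top_def)
  then show ?thesis ..
qed

end

end

section \<open>Extensionality for paths of functions and for path-valued functions\<close>

context lcc_interval_category
begin

text \<open>Extensionality for products, paths and pushforwards in turn. The time components agree
  because both elements lie over the same element of the base, so only values at a time
  \<open>i\<close> and an argument remain to be compared.\<close>

lemma cylinder_push_ext:
  assumes qp [simp]: "p' \<in> ar E" "q' \<in> ar E" "cd E q' = dm E p'" and sq: "pb_square E p p' b c"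
    and m [simp]: "m \<in> ar E" "m' \<in> ar E" "dm E m = dm E x" "dm E m' = dm E x"
      "cd E m = cyl (dm E (push E p' q'))" "cd E m' = cyl (dm E (push E p' q'))"
    and x [simp]: "x \<in> ar E" "cd E x = cyl (cd E p)"
    and mx: "path_prod E (push E p' q') \<cdot> m = path_prod E c \<cdot> x"
      "path_prod E (push E p' q') \<cdot> m' = path_prod E c \<cdot> x"
    and ext: "\<And>h i a. h \<in> ar E \<Longrightarrow> cd E h = dm E x \<Longrightarrow> over E p (x \<cdot> h) i a \<Longrightarrow>
      app E p' q' (pap E (dm E (push E p' q')) (pfst (dm E (push E p' q')) \<cdot> (m \<cdot> h)) i) (b \<cdot> a) =
      app E p' q' (pap E (dm E (push E p' q')) (pfst (dm E (push E p' q')) \<cdot> (m' \<cdot> h)) i) (b \<cdot> a)"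
  shows "m = m'"
proof -
  let ?\<Pi> = "push E p' q'"
  note [simp] = pb_squareD(1-8)[OF sq]
  have fst: "FA (path_ftor E) ?\<Pi> \<cdot> (pfst (dm E ?\<Pi>) \<cdot> n) = FA (path_ftor E) c \<cdot> (pfst (cd E p) \<cdot> x)"
    and snd: "psnd (dm E ?\<Pi>) \<cdot> n = psnd (cd E p) \<cdot> x"
    if n: "path_prod E ?\<Pi> \<cdot> n = path_prod E c \<cdot> x" "n \<in> ar E" "cd E n = cyl (dm E ?\<Pi>)" for n
    using pfst_path_prod[of ?\<Pi> "cd E p'" n] pfst_path_prod[of c "cd E p'" x] n by simp_all
  show ?thesis
  proof (rule pr_ext[of "P (dm E ?\<Pi>)"])
    show "psnd (dm E ?\<Pi>) \<cdot> m = psnd (dm E ?\<Pi>) \<cdot> m'"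
      using snd[OF mx(1)] snd[OF mx(2)] by simp
    show "pfst (dm E ?\<Pi>) \<cdot> m = pfst (dm E ?\<Pi>) \<cdot> m'"
    proof (rule path_ext[of _ _ "dm E ?\<Pi>"])
      fix h i assume [simp]: "h \<in> ar E" "i \<in> ar E" "dm E i = dm E h" "cd E i = intv E"
        and "cd E h = dm E (pfst (dm E ?\<Pi>) \<cdot> m')"
      then have [simp]: "cd E h = dm E x" by simp
      have pi: "?\<Pi> \<cdot> pap E (dm E ?\<Pi>) (pfst (dm E ?\<Pi>) \<cdot> n \<cdot> h) i =
          c \<cdot> pap E (cd E p) (pfst (cd E p) \<cdot> (x \<cdot> h)) i"
        if n: "path_prod E ?\<Pi> \<cdot> n = path_prod E c \<cdot> x" "n \<in> ar E" "cd E n = cyl (dm E ?\<Pi>)"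
          "dm E n = dm E x" for n
        using n cmp_reassoc[OF fst[OF n(1-3)], of h] by (simp flip: pap_path_ftor)
      show "pap E (dm E ?\<Pi>) (pfst (dm E ?\<Pi>) \<cdot> m \<cdot> h) i = pap E (dm E ?\<Pi>) (pfst (dm E ?\<Pi>) \<cdot> m' \<cdot> h) i"
      proof (rule pushforward_ext_cart[OF qp sq, where x = "pap E (cd E p) (pfst (cd E p) \<cdot> (x \<cdot> h)) i"])
        fix k a assume c: "cone E p (pap E (cd E p) (pfst (cd E p) \<cdot> (x \<cdot> h)) i) a k"
        have k [simp]: "k \<in> ar E" "cd E k = dm E h" using coneD(4,8)[OF c] by simp_all
        note [simp] = coneD(3,7)[OF c]
        have [simp]: "dm E a = dm E k" using coneD(6)[OF c] by simp
        have "over E p (x \<cdot> (h \<cdot> k)) (i \<cdot> k) a"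
          using coneD(9)[OF c] by (simp add: over_def)
        from ext[OF _ _ this] show "app E p' q' (pap E (dm E ?\<Pi>) (pfst (dm E ?\<Pi>) \<cdot> m \<cdot> h) i \<cdot> k) (b \<cdot> a) =
          app E p' q' (pap E (dm E ?\<Pi>) (pfst (dm E ?\<Pi>) \<cdot> m' \<cdot> h) i \<cdot> k) (b \<cdot> a)"
          by simp
      qed (use pi[OF mx(1)] pi[OF mx(2)] in simp_all)
    qed simp_all
  qed simp_all
qed

text \<open>The same principles in the opposite order, for functions with values in paths. The time
  of a value is that of its argument, so only the path part is tested.\<close>

lemma push_cylinder_ext:
  assumes qp [simp]: "p' \<in> ar E" "q' \<in> ar E" "cd E q' = dm E p'" and sq: "pb_square E p p' b c"
    and g [simp]: "g \<in> ar E" "g' \<in> ar E" "dm E g = dm E x" "dm E g' = dm E x"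
      "cd E g = dm E (push E (path_prod E p') (path_prod E q'))"
      "cd E g' = dm E (push E (path_prod E p') (path_prod E q'))"
    and x [simp]: "x \<in> ar E" "cd E x = cyl (cd E p)"
    and gx: "push E (path_prod E p') (path_prod E q') \<cdot> g = path_prod E c \<cdot> x"
      "push E (path_prod E p') (path_prod E q') \<cdot> g' = path_prod E c \<cdot> x"
    and ext: "\<And>h w i. cone E (path_prod E p) x w h \<Longrightarrow> i \<in> ar E \<Longrightarrow> dm E i = dm E w \<Longrightarrow>
      cd E i = intv E \<Longrightarrow>
      pap E (dm E q') (pfst (dm E q') \<cdot>
        app E (path_prod E p') (path_prod E q') (g \<cdot> h) (path_prod E b \<cdot> w)) i =
      pap E (dm E q') (pfst (dm E q') \<cdot>
        app E (path_prod E p') (path_prod E q') (g' \<cdot> h) (path_prod E b \<cdot> w)) i"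
  shows "g = g'"
proof -
  note [simp] = pb_squareD(1-8)[OF sq]
  note ssq = pb_square_path_prod[OF sq]
  show ?thesis
  proof (rule pushforward_ext_cart[OF _ _ _ ssq g(1-4), rotated -1])
    fix h w assume c: "cone E (path_prod E p) x w h"
    note [simp] = coneD(3,4,6,8)[OF c]
    have [simp]: "cd E w = cyl (dm E p)" using coneD(7)[OF c] by simp
    have "path_prod E p' \<cdot> (path_prod E b \<cdot> w) = path_prod E c \<cdot> (x \<cdot> h)"
      using cmp_reassoc[OF pb_squareD(9)[OF ssq], of w] coneD(9)[OF c] by simp
    then have c': "cone E (path_prod E p') (push E (path_prod E p') (path_prod E q'))
        (path_prod E b \<cdot> w) (k \<cdot> h)"
      if "push E (path_prod E p') (path_prod E q') \<cdot> k = path_prod E c \<cdot> x" "k \<in> ar E"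
        "dm E k = dm E x" "cd E k = dm E (push E (path_prod E p') (path_prod E q'))" for k
      using that cmp_reassoc[OF that(1), of h] by (simp add: cone_def)
    note c1 = c'[OF gx(1) g(1,3,5)] and c2 = c'[OF gx(2) g(2,4,6)]
    note a1 = app[OF _ _ _ c1] and a2 = app[OF _ _ _ c2]
    note [simp] = a1(1-3) a2(1-3)
    let ?z = "app E (path_prod E p') (path_prod E q') (g \<cdot> h) (path_prod E b \<cdot> w)"
    let ?z' = "app E (path_prod E p') (path_prod E q') (g' \<cdot> h) (path_prod E b \<cdot> w)"
    show "?z = ?z'"
    proof (rule pr_ext[of "P (dm E q')"])
      have "psnd (dm E q') \<cdot> ?z = psnd (dm E p') \<cdot> (path_prod E q' \<cdot> ?z)"
        "psnd (dm E q') \<cdot> ?z' = psnd (dm E p') \<cdot> (path_prod E q' \<cdot> ?z')"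
        by (subst pfst_path_prod(2); simp)+
      then show "psnd (dm E q') \<cdot> ?z = psnd (dm E q') \<cdot> ?z'" using a1(4) a2(4) by simp
      show "pfst (dm E q') \<cdot> ?z = pfst (dm E q') \<cdot> ?z'"
      proof (rule path_ext[of _ _ "dm E q'"])
        fix k i assume [simp]: "k \<in> ar E" "i \<in> ar E" "dm E i = dm E k" "cd E i = intv E"
          and "cd E k = dm E (pfst (dm E q') \<cdot> ?z')"
        then have [simp]: "cd E k = dm E w" by simp
        from ext[OF cone_cmp[OF c, of k], of i] app_cmp[OF _ _ _ c1, of k] app_cmp[OF _ _ _ c2, of k]
        show "pap E (dm E q') (pfst (dm E q') \<cdot> ?z \<cdot> k) i = pap E (dm E q') (pfst (dm E q') \<cdot> ?z' \<cdot> k) i"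
          by simp
      qed simp_all
    qed simp_all
  qed (use gx in simp_all)
qed

text \<open>The first component of \<open>Pi4\<close> at \<open>delta_arr E q\<close> followed by
  the base change of \<open>q\<close> and by \<open>path_prod E p\<close>, so STF2 provides its
  structure. The first two arrows compose to \<open>path_prod E q\<close>, whence the form of its
  domain below.\<close>

definition center where
  "center q p = push_arr E (path_prod E p) (pb1 E (eval E (dm E p)) q) (delta_arr E q)"

lemma center:
  assumes [simp]: "p \<in> ar E" "q \<in> ar E" "cd E q = dm E p"
  shows "center q p \<in> ar E" "dm E (center q p) = dm E (push E (path_prod E p) (path_prod E q))"
    "cd E (center q p) = dm E (push E (path_prod E p) (pb1 E (eval E (dm E p)) q))"
    "push E (path_prod E p) (pb1 E (eval E (dm E p)) q) \<cdot> center q p =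
      push E (path_prod E p) (path_prod E q)"
    "\<And>n w. cone E (path_prod E p) (push E (path_prod E p) (path_prod E q)) w n \<Longrightarrow>
      app E (path_prod E p) (pb1 E (eval E (dm E p)) q) (center q p \<cdot> n) w =
      delta_arr E q \<cdot> app E (path_prod E p) (path_prod E q) n w"
  using push_arr[of "path_prod E p" "pb1 E (eval E (dm E p)) q" "delta_arr E q"]
  unfolding center_def by simp_all

section \<open>The retract equations\<close>

context
  fixes q p s it ib rt rb
  assumes qp [simp]: "p \<in> ar E" "q \<in> ar E" "cd E q = dm E p" and s: "sectioned E p s"
    and it: "section_top q p it" and ib: "section_bot q p ib"
    and rt: "retraction_top q p s rt" and rb: "retraction_bot q p s rb"
begin

text \<open>Lifting a path through \<open>a\<close> at time \<open>i\<close> and evaluating the lift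
  at \<open>i\<close> gives back \<open>a\<close>, and this survives the change of time in
  \<open>lift_path\<close>.\<close>

lemma retract_top: "rt \<cdot> it = idt E (cyl (dm E (push E p q)))"
proof -
  let ?\<Pi> = "push E p q" let ?pp = "path_prod E p" let ?qq = "path_prod E q"
  note it' = it[unfolded section_top_def] and rt' = rt[unfolded retraction_top_def]
  have [simp]: "it \<in> ar E" "dm E it = cyl (dm E ?\<Pi>)" "cd E it = dm E (push E ?pp ?qq)"
    "rt \<in> ar E" "dm E rt = dm E (push E ?pp ?qq)" "cd E rt = cyl (dm E ?\<Pi>)"
    using it' rt' by simp_all
  have it4: "push E ?pp ?qq \<cdot> it = path_prod E ?\<Pi>" and rt4: "path_prod E ?\<Pi> \<cdot> rt = push E ?pp ?qq"
    using it' rt' by simp_all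
  show ?thesis
  proof (rule cylinder_push_ext[OF qp pb_square_idt[OF qp(1)], where x = "path_prod E ?\<Pi>"])
    fix m i a assume [simp]: "m \<in> ar E" "cd E m = dm E (path_prod E ?\<Pi>)"
      and o: "over E p (path_prod E ?\<Pi> \<cdot> m) i a"
    have [simp]: "cd E m = cyl (dm E ?\<Pi>)" by simp
    note [simp] = overD(3,4,6,8)[OF o]
    have [simp]: "dm E i = dm E m" "dm E a = dm E m" using overD(5,7)[OF o] by simp_all
    note y = cmp_reassoc[OF it4, of m]
    let ?w = "lift_path E p s (path_prod E ?\<Pi> \<cdot> m) i a"
    note w = lift_path[OF s o] and [simp] = lift_path(1-3)[OF s o]
    have c: "cone E ?pp (path_prod E ?\<Pi>) ?w m" using w(4) by (simp add: cone_def)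
    have "app E p q (pap E (dm E ?\<Pi>) (pfst (dm E ?\<Pi>) \<cdot> (rt \<cdot> (it \<cdot> m))) i) a =
        pap E (dm E q) (pfst (dm E q) \<cdot> app E ?pp ?qq (it \<cdot> m) ?w) i"
      using rt' o y by simp
    also have "\<dots> = app E p q (pap E (dm E ?\<Pi>) (pfst (dm E ?\<Pi>) \<cdot> m) i)
        (pap E (dm E p) (pfst (dm E p) \<cdot> ?w) i)"
      using it' c by simp
    also have "\<dots> = app E p q (pap E (dm E ?\<Pi>) (pfst (dm E ?\<Pi>) \<cdot> m) i) a"
      using w(5) by simp
    finally show "app E p q (pap E (dm E ?\<Pi>) (pfst (dm E ?\<Pi>) \<cdot> (rt \<cdot> it \<cdot> m)) i) (idt E (dm E p) \<cdot> a) =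
       app E p q (pap E (dm E ?\<Pi>) (pfst (dm E ?\<Pi>) \<cdot> (idt E (cyl (dm E ?\<Pi>)) \<cdot> m)) i)
         (idt E (dm E p) \<cdot> a)"
      by simp
  qed (use it4 cmp_reassoc[OF rt4, of it] in \<open>simp_all add: path_prod_idt\<close>)
qed

text \<open>On the first projection both sides agree, as \<open>ib\<close> and \<open>rb\<close>
  preserve the base. On the second, the lift chosen by the section is evaluated at its own time and
  returns the argument \<open>a\<close>.\<close>

lemma retract_bot: "rb \<cdot> ib = idt E (dm E (pb1 E (eval E (cd E p)) (push E p q)))"
proof -
  let ?\<Pi> = "push E p q" let ?pp = "path_prod E p" let ?r = "pb1 E (eval E (dm E p)) q"
  let ?k1 = "pb1 E (eval E (cd E p)) ?\<Pi>" let ?k2 = "pb2 E (eval E (cd E p)) ?\<Pi>"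
  note ib' = ib[unfolded section_bot_def] and rb' = rb[unfolded retraction_bot_def]
  have [simp]: "ib \<in> ar E" "dm E ib = dm E ?k1" "cd E ib = dm E (push E ?pp ?r)"
    "rb \<in> ar E" "dm E rb = dm E (push E ?pp ?r)" "cd E rb = dm E ?k1"
    using ib' rb' by simp_all
  have ib4: "push E ?pp ?r \<cdot> ib = ?k1" and rb4: "?k1 \<cdot> rb = push E ?pp ?r"
    using ib' rb' by simp_all
  have 1: "?k1 \<cdot> (rb \<cdot> ib) = ?k1" using cmp_reassoc[OF rb4, of ib] ib4 by simp
  have "?k2 \<cdot> (rb \<cdot> ib) = ?k2"
  proof (rule pushforward_ext[OF qp])
    show "?\<Pi> \<cdot> (?k2 \<cdot> (rb \<cdot> ib)) = ?\<Pi> \<cdot> ?k2"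
      using pb_commutes_reassoc[of "eval E (cd E p)" ?\<Pi> "rb \<cdot> ib"] pb_commutes[of "eval E (cd E p)" ?\<Pi>] 1
      by simp
    then have pk: "?\<Pi> \<cdot> (?k2 \<cdot> (rb \<cdot> ib)) = eval E (cd E p) \<cdot> ?k1"
      using pb_commutes[of "eval E (cd E p)" ?\<Pi>] by simp
    fix k a assume c: "cone E p (?\<Pi> \<cdot> (?k2 \<cdot> (rb \<cdot> ib))) a k"
    note [simp] = coneD(3,4,7)[OF c]
    have [simp]: "cd E k = dm E ?k1" "dm E a = dm E k" using coneD(6,8)[OF c] by simp_all
    have c': "cone E (eval E (cd E p)) p (?k1 \<cdot> k) a"
      using coneD(9)[OF c] unfolding pk by (simp add: cone_def)
    let ?w = "sec E p s (?k1 \<cdot> k) a"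
    note w = sec[OF s c'] and [simp] = sec(1-3)[OF s c']
    have cw: "cone E ?pp ?k1 ?w k" using w(4) by (simp add: cone_def)
    note y = cmp_reassoc[OF ib4, of k]
    have "app E p q (?k2 \<cdot> (rb \<cdot> (ib \<cdot> k))) a = pb2 E (eval E (dm E p)) q \<cdot> app E ?pp ?r (ib \<cdot> k) ?w"
      using rb' c' y by simp
    also have "\<dots> = app E p q (?k2 \<cdot> k) (eval E (dm E p) \<cdot> ?w)" using ib' cw by simp
    also have "\<dots> = app E p q (?k2 \<cdot> k) a" using w(5) by simp
    finally show "app E p q (?k2 \<cdot> (rb \<cdot> ib) \<cdot> k) a = app E p q (?k2 \<cdot> k) a" by simp
  qed simp_all
  with 1 show ?thesis
    by - (rule pb_ext[of "eval E (cd E p)" ?\<Pi>], simp_all)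
qed

text \<open>Both composites evaluate the path of functions at the time of the argument
  \<open>w\<close>: the formula for \<open>it\<close>, taken at the time of \<open>w\<close>,
  becomes the formula for \<open>ib\<close>.\<close>

lemma section_square: "center q p \<cdot> it = ib \<cdot> delta_arr E (push E p q)"
proof -
  let ?\<Pi> = "push E p q" let ?pp = "path_prod E p" let ?r = "pb1 E (eval E (dm E p)) q"
  let ?k1 = "pb1 E (eval E (cd E p)) ?\<Pi>" let ?k2 = "pb2 E (eval E (cd E p)) ?\<Pi>"
  let ?qq = "path_prod E q"
  note it' = it[unfolded section_top_def] and ib' = ib[unfolded section_bot_def]
  have [simp]: "it \<in> ar E" "dm E it = cyl (dm E ?\<Pi>)" "cd E it = dm E (push E ?pp ?qq)"
    "ib \<in> ar E" "dm E ib = dm E ?k1" "cd E ib = dm E (push E ?pp ?r)"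
    using it' ib' by simp_all
  have it4: "push E ?pp ?qq \<cdot> it = path_prod E ?\<Pi>" and ib4: "push E ?pp ?r \<cdot> ib = ?k1"
    using it' ib' by simp_all
  note [simp] = center(1-3)[OF qp]
  have 1: "push E ?pp ?r \<cdot> (center q p \<cdot> it) = path_prod E ?\<Pi>"
    using cmp_reassoc[OF center(4)[OF qp], of it] it4 by simp
  have 2: "push E ?pp ?r \<cdot> (ib \<cdot> delta_arr E ?\<Pi>) = path_prod E ?\<Pi>"
    using cmp_reassoc[OF ib4, of "delta_arr E ?\<Pi>"] by simp
  show ?thesis
  proof (rule pushforward_ext[of ?pp ?r])
    fix m w assume "cone E ?pp (push E ?pp ?r \<cdot> (center q p \<cdot> it)) w m"
    then have c: "cone E ?pp (path_prod E ?\<Pi>) w m" unfolding 1 .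
    note [simp] = coneD(3,4)[OF c]
    have [simp]: "cd E w = cyl (dm E p)" "cd E m = cyl (dm E ?\<Pi>)" "dm E w = dm E m"
      using coneD(6,7,8)[OF c] by simp_all
    have c1: "cone E ?pp (push E ?pp ?qq) w (it \<cdot> m)"
      using coneD(9)[OF c] cmp_reassoc[OF it4, of m] by (simp add: cone_def)
    have c2: "cone E ?pp (push E ?pp ?r) w (ib \<cdot> (delta_arr E ?\<Pi> \<cdot> m))"
      using coneD(9)[OF c] cmp_reassoc[OF 2, of m] by (simp add: cone_def)
    have c3: "cone E ?pp ?k1 w (delta_arr E ?\<Pi> \<cdot> m)"
      using coneD(9)[OF c] by (simp add: cone_def delta_reassoc)
    let ?z = "app E ?pp ?qq (it \<cdot> m) w"
    let ?z' = "app E ?pp ?r (ib \<cdot> (delta_arr E ?\<Pi> \<cdot> m)) w"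
    note z = app[OF _ _ _ c1] app[OF _ _ _ c2]
    note [simp] = z(1-3,5-7)
    have sw: "psnd (dm E q) \<cdot> ?z = psnd (dm E p) \<cdot> w"
      using pfst_path_prod(2)[of q "dm E p" ?z] z(4) by simp
    \<comment> \<open>The path of functions and its argument carry the same time because they have
      the same image in the path cylinder of the base.\<close>
    have sm: "psnd (dm E ?\<Pi>) \<cdot> m = psnd (dm E p) \<cdot> w"
      using coneD(9)[OF c] pfst_path_prod(2)[of p "cd E p" w] pfst_path_prod(2)[of ?\<Pi> "cd E p" m]
      by simp
    have "delta_arr E q \<cdot> ?z = ?z'"
    proof (rule pb_ext[of "eval E (dm E p)" q])
      show "?r \<cdot> (delta_arr E q \<cdot> ?z) = ?r \<cdot> ?z'"
        using z(4,8) by (simp add: delta_reassoc)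
      have "pb2 E (eval E (dm E p)) q \<cdot> (delta_arr E q \<cdot> ?z) = eval E (dm E q) \<cdot> ?z"
        by (simp add: delta_reassoc)
      also have "\<dots> = pap E (dm E q) (pfst (dm E q) \<cdot> ?z) (psnd (dm E p) \<cdot> w)"
        using eval_eq_pap[of "dm E q" ?z] sw by simp
      also have "\<dots> = app E p q (pap E (dm E ?\<Pi>) (pfst (dm E ?\<Pi>) \<cdot> m) (psnd (dm E p) \<cdot> w))
          (pap E (dm E p) (pfst (dm E p) \<cdot> w) (psnd (dm E p) \<cdot> w))"
        using it' c by simp
      also have "\<dots> = app E p q (eval E (dm E ?\<Pi>) \<cdot> m) (eval E (dm E p) \<cdot> w)"
        using eval_eq_pap[of "dm E ?\<Pi>" m] eval_eq_pap[of "dm E p" w] sm by simp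
      also have "eval E (dm E ?\<Pi>) \<cdot> m = ?k2 \<cdot> (delta_arr E ?\<Pi> \<cdot> m)"
        by (simp add: delta_reassoc)
      also have "app E p q \<dots> (eval E (dm E p) \<cdot> w) = pb2 E (eval E (dm E p)) q \<cdot> ?z'"
        using ib' c3 by simp
      finally show "pb2 E (eval E (dm E p)) q \<cdot> (delta_arr E q \<cdot> ?z) =
        pb2 E (eval E (dm E p)) q \<cdot> ?z'" .
    qed simp_all
    then show "app E ?pp ?r (center q p \<cdot> it \<cdot> m) w = app E ?pp ?r (ib \<cdot> delta_arr E ?\<Pi> \<cdot> m) w"
      using center(5)[OF qp c1] by simp
  qed (use 1 2 in simp_all)
qed

text \<open>Evaluation looks at the result of \<open>rt\<close> only at the time \<open>?i\<close>
  of the base point. At that time \<open>lift_path\<close> coincides with \<open>sec\<close>, and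
  the formula for \<open>rt\<close> reduces to that for \<open>rb\<close>.\<close>

lemma retraction_square: "delta_arr E (push E p q) \<cdot> rt = rb \<cdot> center q p"
proof -
  let ?\<Pi> = "push E p q" let ?pp = "path_prod E p" let ?r = "pb1 E (eval E (dm E p)) q"
  let ?k1 = "pb1 E (eval E (cd E p)) ?\<Pi>" let ?k2 = "pb2 E (eval E (cd E p)) ?\<Pi>"
  let ?qq = "path_prod E q" let ?N = "push E ?pp ?qq"
  note rt' = rt[unfolded retraction_top_def] and rb' = rb[unfolded retraction_bot_def]
  have [simp]: "rt \<in> ar E" "dm E rt = dm E ?N" "cd E rt = cyl (dm E ?\<Pi>)"
    "rb \<in> ar E" "dm E rb = dm E (push E ?pp ?r)" "cd E rb = dm E ?k1"
    using rt' rb' by simp_all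
  have rt4: "path_prod E ?\<Pi> \<cdot> rt = ?N" and rb4: "?k1 \<cdot> rb = push E ?pp ?r"
    using rt' rb' by simp_all
  note [simp] = center(1-3)[OF qp]
  have 1: "?k1 \<cdot> (rb \<cdot> center q p) = ?N"
    using cmp_reassoc[OF rb4, of "center q p"] center(4)[OF qp] by simp
  have "eval E (dm E ?\<Pi>) \<cdot> rt = ?k2 \<cdot> (rb \<cdot> center q p)"
  proof (rule pushforward_ext[OF qp])
    have e: "?\<Pi> \<cdot> (eval E (dm E ?\<Pi>) \<cdot> rt) = eval E (cd E p) \<cdot> ?N"
      using eval_path_prod[of ?\<Pi> "dm E ?\<Pi>" "cd E p" rt] rt4 by simp
    show "?\<Pi> \<cdot> (eval E (dm E ?\<Pi>) \<cdot> rt) = ?\<Pi> \<cdot> (?k2 \<cdot> (rb \<cdot> center q p))"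
      using e pb_commutes_reassoc[of "eval E (cd E p)" ?\<Pi> "rb \<cdot> center q p"] 1 by simp
    fix n a assume "cone E p (?\<Pi> \<cdot> (eval E (dm E ?\<Pi>) \<cdot> rt)) a n"
    then have c: "cone E p (eval E (cd E p) \<cdot> ?N) a n" unfolding e .
    note [simp] = coneD(3,4,7)[OF c]
    have [simp]: "cd E n = dm E ?N" "dm E a = dm E n" using coneD(6,8)[OF c] by simp_all
    let ?i = "psnd (cd E p) \<cdot> (?N \<cdot> n)"
    have o: "over E p (?N \<cdot> n) ?i a"
      using coneD(9)[OF c] eval_eq_pap[of "cd E p" "?N \<cdot> n"] by (simp add: over_def)
    have cs: "cone E (eval E (cd E p)) p (?N \<cdot> n) a"
      using coneD(9)[OF c] by (simp add: cone_def)
    let ?w = "sec E p s (?N \<cdot> n) a"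
    note w = sec[OF s cs] and [simp] = sec(1-3)[OF s cs]
    have cw: "cone E ?pp ?N ?w n" using w(4) by (simp add: cone_def)
    let ?z = "app E ?pp ?qq n ?w"
    note z = app[OF _ _ _ cw] and [simp] = app(1-3)[OF _ _ _ cw]
    have sz: "psnd (dm E q) \<cdot> ?z = ?i"
      using pfst_path_prod(2)[of q "dm E p" ?z] z(4) w(6) by simp
    have si: "psnd (dm E ?\<Pi>) \<cdot> (rt \<cdot> n) = ?i"
      using pfst_path_prod(2)[of ?\<Pi> "cd E p" "rt \<cdot> n"] cmp_reassoc[OF rt4, of n] by simp
    have "app E p q (eval E (dm E ?\<Pi>) \<cdot> (rt \<cdot> n)) a =
        app E p q (pap E (dm E ?\<Pi>) (pfst (dm E ?\<Pi>) \<cdot> (rt \<cdot> n)) ?i) a"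
      using eval_eq_pap[of "dm E ?\<Pi>" "rt \<cdot> n"] si by simp
    also have "\<dots> = pap E (dm E q) (pfst (dm E q) \<cdot> app E ?pp ?qq n (lift_path E p s (?N \<cdot> n) ?i a)) ?i"
      using rt' o by simp
    also have "\<dots> = pap E (dm E q) (pfst (dm E q) \<cdot> ?z) ?i"
      using lift_path(7)[OF s o] by simp
    also have "\<dots> = eval E (dm E q) \<cdot> ?z"
      using eval_eq_pap[of "dm E q" ?z] sz by simp
    also have "\<dots> = pb2 E (eval E (dm E p)) q \<cdot> (delta_arr E q \<cdot> ?z)"
      by (simp add: delta_reassoc)
    also have "\<dots> = pb2 E (eval E (dm E p)) q \<cdot> app E ?pp ?r (center q p \<cdot> n) ?w"
      using center(5)[OF qp cw] by simp
    also have "\<dots> = app E p q (?k2 \<cdot> (rb \<cdot> (center q p \<cdot> n))) a"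
      using rb' cs cmp_reassoc[OF center(4)[OF qp], of n] by simp
    finally show "app E p q (eval E (dm E ?\<Pi>) \<cdot> rt \<cdot> n) a = app E p q (?k2 \<cdot> (rb \<cdot> center q p) \<cdot> n) a"
      by simp
  qed simp_all
  then show ?thesis
    by - (rule pb_ext[of "eval E (cd E p)" ?\<Pi>], use 1 rt4 in \<open>simp_all add: delta_reassoc\<close>)
qed

end

end

section \<open>Naturality of the retract\<close>

context lcc_interval_category
begin

text \<open>A variant of \<open>delta_base_change\<close> with the codomains named: for composable
  \<open>q\<close> and \<open>p\<close> the evaluation is written \<open>eval E (dm E p)\<close>,
  which equals but does not literally match \<open>eval E (cd E q)\<close>.\<close>

lemma delta_base_change_at:
  assumes s: "pb_square E p p' a b" and "cd E p = x" "cd E p' = x'"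
  defines "l \<equiv> pb_pair E (eval E x') p' (path_prod E b \<cdot> pb1 E (eval E x) p)
            (a \<cdot> pb2 E (eval E x) p)"
  shows "pb_square E (pb1 E (eval E x) p) (pb1 E (eval E x') p') l (path_prod E b)"
    "l \<in> ar E" "dm E l = dm E (pb1 E (eval E x) p)"
    "cd E l = dm E (pb1 E (eval E x') p')"
    "pb1 E (eval E x') p' \<cdot> l = path_prod E b \<cdot> pb1 E (eval E x) p"
    "pb2 E (eval E x') p' \<cdot> l = a \<cdot> pb2 E (eval E x) p"
  using delta_base_change[OF s] unfolding l_def assms(2,3) by blast+

section \<open>Compatibility of the retract with a cartesian transformation\<close>

context
  fixes q p s it ib rt rb q' p' s' it' ib' rt' rb' a b c
  assumes qp [simp]: "p \<in> ar E" "q \<in> ar E" "cd E q = dm E p" and s: "sectioned E p s"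
    and it: "section_top q p it" and ib: "section_bot q p ib"
    and rt: "retraction_top q p s rt" and rb: "retraction_bot q p s rb"
  assumes qp' [simp]: "p' \<in> ar E" "q' \<in> ar E" "cd E q' = dm E p'" and s': "sectioned E p' s'"
    and it': "section_top q' p' it'" and ib': "section_bot q' p' ib'"
    and rt': "retraction_top q' p' s' rt'" and rb': "retraction_bot q' p' s' rb'"
  assumes sq: "pb_square E q q' a b" and sp: "pb_square E p p' b c"
    and ss: "s' \<cdot> pb_pair E (eval E (cd E p')) p' (path_prod E c \<cdot> pb1 E (eval E (cd E p)) p)
            (b \<cdot> pb2 E (eval E (cd E p)) p) = path_prod E b \<cdot> s"
begin

text \<open>The hypothesis \<open>ss\<close> is the square between the chosen sections that
  functoriality in STF1 provides. Composing it with an element of the pullback gives compatibility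
  on elements.\<close>

lemma sec_natural:
  assumes cn: "cone E (eval E (cd E p)) p y x"
  shows "cone E (eval E (cd E p')) p' (path_prod E c \<cdot> y) (b \<cdot> x)"
    "sec E p' s' (path_prod E c \<cdot> y) (b \<cdot> x) = path_prod E b \<cdot> sec E p s y x"
proof -
  note [simp] = pb_squareD(1-8)[OF sp] coneD(3,4,6,8)[OF cn] pb_pair[OF cn]
  have [simp]: "cd E y = cyl (cd E p)" using coneD(7)[OF cn] by simp
  show c': "cone E (eval E (cd E p')) p' (path_prod E c \<cdot> y) (b \<cdot> x)"
    using coneD(9)[OF cn] cmp_reassoc[OF pb_squareD(9)[OF sp], of x]
    by (simp add: cone_def eval_path_prod)
  note [simp] = sectionedD(1-4)[OF s] sectionedD(1-4)[OF s']
  let ?l = "pb_pair E (eval E (cd E p')) p' (path_prod E c \<cdot> pb1 E (eval E (cd E p)) p)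
            (b \<cdot> pb2 E (eval E (cd E p)) p)"
  note l = delta_base_change[OF sp] and [simp] = delta_base_change(2-4)[OF sp]
  have "?l \<cdot> pb_pair E (eval E (cd E p)) p y x =
      pb_pair E (eval E (cd E p')) p' (path_prod E c \<cdot> y) (b \<cdot> x)"
    by (rule pb_ext[of "eval E (cd E p')" p'])
      (simp_all add: cmp_reassoc[OF l(5)] cmp_reassoc[OF l(6)] pb_pair[OF c'] del: pb_pair_cmp)
  then show "sec E p' s' (path_prod E c \<cdot> y) (b \<cdot> x) = path_prod E b \<cdot> sec E p s y x"
    using cmp_reassoc[OF ss, of "pb_pair E (eval E (cd E p)) p y x"]
    by (simp add: sec_def del: pb_pair_cmp)
qed

text \<open>Besides \<open>sec_natural\<close>, the reason is that \<open>path_prod\<close> acts on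
  the path and fixes the time, so it commutes with the exchange of times.\<close>

lemma lift_path_natural:
  assumes o: "over E p y i x"
  shows "over E p' (path_prod E c \<cdot> y) i (b \<cdot> x)"
    "lift_path E p' s' (path_prod E c \<cdot> y) i (b \<cdot> x) = path_prod E b \<cdot> lift_path E p s y i x"
proof -
  note [simp] = pb_squareD(1-8)[OF sp] overD(1-8)[OF o]
  have "p' \<cdot> (b \<cdot> x) = c \<cdot> pap E (cd E p) (pfst (cd E p) \<cdot> y) i"
    using overD(9)[OF o] cmp_reassoc[OF pb_squareD(9)[OF sp], of x] by simp
  then show o': "over E p' (path_prod E c \<cdot> y) i (b \<cdot> x)"
    by (simp add: over_def pap_path_ftor)
  note w = lift_path[OF s o] and [simp] = lift_path(1-3)[OF s o] lift_path(1-3)[OF s' o']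
  note cn = over_cone[OF o qp(1)]
  note [simp] = sec(1-3)[OF s cn]
  let ?y = "pr_pair E (P (cd E p)) (pfst (cd E p) \<cdot> y) i"
  have 1: "pr_pair E (P (cd E p')) (pfst (cd E p') \<cdot> (path_prod E c \<cdot> y)) i = path_prod E c \<cdot> ?y"
    by (simp add: path_prod_pr_pair)
  show "lift_path E p' s' (path_prod E c \<cdot> y) i (b \<cdot> x) = path_prod E b \<cdot> lift_path E p s y i x"
    unfolding lift_path_def 1 sec_natural(2)[OF cn]
    by (simp add: path_prod_pr_pair)
qed

text \<open>\<open>e\<close> is the component of the pushed forward transformation.
  \<open>lq\<close> and \<open>eK\<close> are the codomain components of \<open>delta_ftor\<close>
  on the squares of \<open>q\<close> and of the pushforward; \<open>eN\<close> and \<open>eL\<close>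
  are the first two components of \<open>Pi4\<close> on the induced transformation of
  triples.\<close>

private abbreviation "e \<equiv> push_map E (q, p) (q', p') (a, b, c)"
private abbreviation "lq \<equiv> pb_pair E (eval E (dm E p')) q' (path_prod E b \<cdot> pb1 E (eval E (dm E p)) q)
            (a \<cdot> pb2 E (eval E (dm E p)) q)"
private abbreviation "eN \<equiv> push_map E (path_prod E q, path_prod E p) (path_prod E q', path_prod E p')
  (path_prod E a, path_prod E b, path_prod E c)"
private abbreviation "eL \<equiv> push_map E (pb1 E (eval E (dm E p)) q, path_prod E p)
  (pb1 E (eval E (dm E p')) q', path_prod E p') (lq, path_prod E b, path_prod E c)"
private abbreviation "eK \<equiv> pb_pair E (eval E (cd E p')) (push E p' q')
   (path_prod E c \<cdot> pb1 E (eval E (cd E p)) (push E p q))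
   (e \<cdot> pb2 E (eval E (cd E p)) (push E p q))"

private lemma squares:
  "square E q q' a b"
  "pb_square E (path_prod E p) (path_prod E p') (path_prod E b) (path_prod E c)"
  "square E (path_prod E q) (path_prod E q') (path_prod E a) (path_prod E b)"
  "square E (pb1 E (eval E (dm E p)) q) (pb1 E (eval E (dm E p')) q') lq (path_prod E b)"
  using sq pb_square_path_prod[OF sq] pb_square_path_prod[OF sp] delta_base_change_at(1)[OF sq qp(3) qp'(3)]
  by (auto simp: pb_square_def)

private lemmas e = push_map[OF qp qp' squares(1) sp]

private lemma eN:
  shows "eN \<in> ar E" "dm E eN = dm E (push E (path_prod E p) (path_prod E q))"
    "cd E eN = dm E (push E (path_prod E p') (path_prod E q'))"
    "push E (path_prod E p') (path_prod E q') \<cdot> eN =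
      path_prod E c \<cdot> push E (path_prod E p) (path_prod E q)"
    "\<And>n w. cone E (path_prod E p) (push E (path_prod E p) (path_prod E q)) w n \<Longrightarrow>
      app E (path_prod E p') (path_prod E q') (eN \<cdot> n) (path_prod E b \<cdot> w) =
      path_prod E a \<cdot> app E (path_prod E p) (path_prod E q) n w"
  by (rule push_map[OF _ _ _ _ _ _ squares(3,2)]; simp)+

private lemma eL:
  shows "eL \<in> ar E" "dm E eL = dm E (push E (path_prod E p) (pb1 E (eval E (dm E p)) q))"
    "cd E eL = dm E (push E (path_prod E p') (pb1 E (eval E (dm E p')) q'))"
    "push E (path_prod E p') (pb1 E (eval E (dm E p')) q') \<cdot> eL =
      path_prod E c \<cdot> push E (path_prod E p) (pb1 E (eval E (dm E p)) q)"
    "\<And>l w. cone E (path_prod E p) (push E (path_prod E p) (pb1 E (eval E (dm E p)) q)) w l \<Longrightarrow>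
      app E (path_prod E p') (pb1 E (eval E (dm E p')) q') (eL \<cdot> l) (path_prod E b \<cdot> w) =
      lq \<cdot> app E (path_prod E p) (pb1 E (eval E (dm E p)) q) l w"
  by (rule push_map[OF _ _ _ _ _ _ squares(4,2)]; simp)+

text \<open>Beck-Chevalley makes the square of \<open>e\<close> a pullback, so that the base change
  along evaluation applies to it.\<close>

private lemma eK:
  shows "eK \<in> ar E" "dm E eK = dm E (pb1 E (eval E (cd E p)) (push E p q))"
    "cd E eK = dm E (pb1 E (eval E (cd E p')) (push E p' q'))"
    "pb1 E (eval E (cd E p')) (push E p' q') \<cdot> eK =
      path_prod E c \<cdot> pb1 E (eval E (cd E p)) (push E p q)"
    "pb2 E (eval E (cd E p')) (push E p' q') \<cdot> eK = e \<cdot> pb2 E (eval E (cd E p)) (push E p q)"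
proof -
  have P: "pb_square E (push E p q) (push E p' q') e c"
    by (rule beck_chevalley[OF qp qp' squares(1) sp sq])
  show "eK \<in> ar E" "dm E eK = dm E (pb1 E (eval E (cd E p)) (push E p q))"
    "cd E eK = dm E (pb1 E (eval E (cd E p')) (push E p' q'))"
    "pb1 E (eval E (cd E p')) (push E p' q') \<cdot> eK =
      path_prod E c \<cdot> pb1 E (eval E (cd E p)) (push E p q)"
    "pb2 E (eval E (cd E p')) (push E p' q') \<cdot> eK = e \<cdot> pb2 E (eval E (cd E p)) (push E p q)"
    by (rule delta_base_change_at[OF P]; simp)+
qed

text \<open>It is enough to test on arguments in the image of \<open>path_prod E b\<close>. There
  the characterizations of \<open>e\<close> and \<open>eN\<close> move \<open>a\<close> outside, and
  both sides become \<open>a\<close> applied to the same value in the domain of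
  \<open>q\<close>.\<close>

lemma section_top_natural: "it' \<cdot> path_prod E e = eN \<cdot> it"
proof -
  let ?\<Pi> = "push E p q" let ?\<Pi>' = "push E p' q'"
  note I = it[unfolded section_top_def] and I' = it'[unfolded section_top_def]
  note [simp] = e(1-3) eN(1-3) pb_squareD(1-8)[OF sq] pb_squareD(1-8)[OF sp]
  have [simp]: "it \<in> ar E" "dm E it = cyl (dm E ?\<Pi>)"
    "cd E it = dm E (push E (path_prod E p) (path_prod E q))"
    "it' \<in> ar E" "dm E it' = cyl (dm E ?\<Pi>')"
    "cd E it' = dm E (push E (path_prod E p') (path_prod E q'))"
    using I I' by simp_all
  have I4: "push E (path_prod E p) (path_prod E q) \<cdot> it = path_prod E ?\<Pi>"
    "push E (path_prod E p') (path_prod E q') \<cdot> it' = path_prod E ?\<Pi>'"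
    using I I' by simp_all
  have ee: "path_prod E ?\<Pi>' \<cdot> path_prod E e = path_prod E c \<cdot> path_prod E ?\<Pi>"
    using e(4) by (simp flip: path_prod_cmp)
  show ?thesis
  proof (rule push_cylinder_ext[OF qp' sp, where x = "path_prod E ?\<Pi>"])
    fix m w i assume cn: "cone E (path_prod E p) (path_prod E ?\<Pi>) w m"
      and i [simp]: "i \<in> ar E" "dm E i = dm E w" "cd E i = intv E"
    note [simp] = coneD(3,4,6)[OF cn]
    have [simp]: "cd E w = cyl (dm E p)" "cd E m = cyl (dm E ?\<Pi>)" using coneD(7,8)[OF cn] by simp_all
    have cn': "cone E (path_prod E p') (path_prod E ?\<Pi>') (path_prod E b \<cdot> w) (path_prod E e \<cdot> m)"
      using cmp_reassoc[OF ee, of m] cmp_reassoc[OF pb_squareD(9)[OF squares(2)], of w] coneD(9)[OF cn]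
      by (simp add: cone_def)
    have c1: "cone E (path_prod E p) (push E (path_prod E p) (path_prod E q)) w (it \<cdot> m)"
      using coneD(9)[OF cn] cmp_reassoc[OF I4(1), of m] by (simp add: cone_def)
    have cp: "cone E p ?\<Pi> (pap E (dm E p) (pfst (dm E p) \<cdot> w) i) (pap E (dm E ?\<Pi>) (pfst (dm E ?\<Pi>) \<cdot> m) i)"
      by (rule pap_cone[OF cn]) simp_all
    let ?z = "app E (path_prod E p) (path_prod E q) (it \<cdot> m) w"
    note [simp] = app(1-3)[OF _ _ _ c1]
    have "pap E (dm E q') (pfst (dm E q') \<cdot>
        app E (path_prod E p') (path_prod E q') (it' \<cdot> (path_prod E e \<cdot> m)) (path_prod E b \<cdot> w)) i =
      app E p' q' (pap E (dm E ?\<Pi>') (pfst (dm E ?\<Pi>') \<cdot> (path_prod E e \<cdot> m)) i)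
        (pap E (dm E p') (pfst (dm E p') \<cdot> (path_prod E b \<cdot> w)) i)"
      using I' cn' i by simp
    also have "\<dots> = app E p' q' (e \<cdot> pap E (dm E ?\<Pi>) (pfst (dm E ?\<Pi>) \<cdot> m) i)
        (b \<cdot> pap E (dm E p) (pfst (dm E p) \<cdot> w) i)"
      by (simp add: pap_path_ftor)
    also have "\<dots> = a \<cdot> app E p q (pap E (dm E ?\<Pi>) (pfst (dm E ?\<Pi>) \<cdot> m) i)
        (pap E (dm E p) (pfst (dm E p) \<cdot> w) i)"
      by (rule e(5)[OF cp])
    also have "\<dots> = a \<cdot> pap E (dm E q) (pfst (dm E q) \<cdot> ?z) i"
      using I cn i by simp
    also have "\<dots> = pap E (dm E q') (pfst (dm E q') \<cdot> (path_prod E a \<cdot> ?z)) i"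
      by (simp add: pap_path_ftor)
    also have "path_prod E a \<cdot> ?z =
        app E (path_prod E p') (path_prod E q') (eN \<cdot> (it \<cdot> m)) (path_prod E b \<cdot> w)"
      using eN(5)[OF c1] by simp
    finally show "pap E (dm E q') (pfst (dm E q') \<cdot>
        app E (path_prod E p') (path_prod E q') (it' \<cdot> path_prod E e \<cdot> m) (path_prod E b \<cdot> w)) i =
      pap E (dm E q') (pfst (dm E q') \<cdot>
        app E (path_prod E p') (path_prod E q') (eN \<cdot> it \<cdot> m) (path_prod E b \<cdot> w)) i"
      by simp
  qed (use I4 ee cmp_reassoc[OF I4(2), of "path_prod E e"] cmp_reassoc[OF eN(4), of it]
      in simp_all)
qed

text \<open>Values are pairs in a pullback. The first components are the argument; the second are
  compared through the characterization of \<open>e\<close>, as evaluation is natural in the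
  argument.\<close>

lemma section_bot_natural: "ib' \<cdot> eK = eL \<cdot> ib"
proof -
  let ?\<Pi> = "push E p q" let ?\<Pi>' = "push E p' q'"
  let ?r = "pb1 E (eval E (dm E p)) q" let ?r' = "pb1 E (eval E (dm E p')) q'"
  let ?k1 = "pb1 E (eval E (cd E p)) ?\<Pi>" let ?k2 = "pb2 E (eval E (cd E p)) ?\<Pi>"
  let ?k1' = "pb1 E (eval E (cd E p')) ?\<Pi>'" let ?k2' = "pb2 E (eval E (cd E p')) ?\<Pi>'"
  note I = ib[unfolded section_bot_def] and I' = ib'[unfolded section_bot_def]
  note l = delta_base_change_at[OF sq qp(3) qp'(3)]
  note [simp] = e(1-3) eL(1-3) eK(1-3) l(2-4) pb_squareD(1-8)[OF sq] pb_squareD(1-8)[OF sp]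
  have [simp]: "ib \<in> ar E" "dm E ib = dm E ?k1" "cd E ib = dm E (push E (path_prod E p) ?r)"
    "ib' \<in> ar E" "dm E ib' = dm E ?k1'" "cd E ib' = dm E (push E (path_prod E p') ?r')"
    using I I' by simp_all
  have I4: "push E (path_prod E p) ?r \<cdot> ib = ?k1" "push E (path_prod E p') ?r' \<cdot> ib' = ?k1'"
    using I I' by simp_all
  show ?thesis
  proof (rule pushforward_ext_cart[of "path_prod E p'" ?r', OF _ _ _ squares(2), where x = ?k1])
    fix k w assume cn: "cone E (path_prod E p) ?k1 w k"
    note [simp] = coneD(3,4,8)[OF cn]
    have [simp]: "cd E w = cyl (dm E p)" "dm E w = dm E k" using coneD(6,7)[OF cn] by simp_all
    have bw: "path_prod E p' \<cdot> (path_prod E b \<cdot> w) = path_prod E c \<cdot> (?k1 \<cdot> k)"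
      using cmp_reassoc[OF pb_squareD(9)[OF squares(2)], of w] coneD(9)[OF cn] by simp
    have cn': "cone E (path_prod E p') ?k1' (path_prod E b \<cdot> w) (eK \<cdot> k)"
      using bw cmp_reassoc[OF eK(4), of k] by (simp add: cone_def del: pb_pair_cmp)
    have c1: "cone E (path_prod E p) (push E (path_prod E p) ?r) w (ib \<cdot> k)"
      using coneD(9)[OF cn] cmp_reassoc[OF I4(1), of k] by (simp add: cone_def)
    have c1': "cone E (path_prod E p') (push E (path_prod E p') ?r') (path_prod E b \<cdot> w) (ib' \<cdot> (eK \<cdot> k))"
      using coneD(9)[OF cn'] cmp_reassoc[OF I4(2), of "eK \<cdot> k"] by (simp add: cone_def del: pb_pair_cmp)
    have cp: "cone E p ?\<Pi> (eval E (dm E p) \<cdot> w) (?k2 \<cdot> k)"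
      using coneD(9)[OF cn] eval_path_prod[of p "dm E p" "cd E p" w]
        pb_commutes_reassoc[of "eval E (cd E p)" ?\<Pi> k] by (simp add: cone_def)
    let ?z = "app E (path_prod E p) ?r (ib \<cdot> k) w"
    let ?z' = "app E (path_prod E p') ?r' (ib' \<cdot> (eK \<cdot> k)) (path_prod E b \<cdot> w)"
    note z = app[OF _ _ _ c1] and z' = app[OF _ _ _ c1']
    note [simp] = z(1-3) z'(1-3)
    have "?z' = lq \<cdot> ?z"
    proof (rule pb_ext[of "eval E (dm E p')" q'])
      show "?r' \<cdot> ?z' = ?r' \<cdot> (lq \<cdot> ?z)"
        using z(4) z'(4) cmp_reassoc[OF l(5), of ?z] by (simp del: pb_pair_cmp)
      have "pb2 E (eval E (dm E p')) q' \<cdot> ?z' =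
          app E p' q' (?k2' \<cdot> (eK \<cdot> k)) (eval E (dm E p') \<cdot> (path_prod E b \<cdot> w))"
        using I' cn' by (simp del: pb_pair_cmp)
      also have "\<dots> = app E p' q' (e \<cdot> (?k2 \<cdot> k)) (b \<cdot> (eval E (dm E p) \<cdot> w))"
        using cmp_reassoc[OF eK(5), of k] by (simp add: eval_path_prod del: pb_pair_cmp)
      also have "\<dots> = a \<cdot> app E p q (?k2 \<cdot> k) (eval E (dm E p) \<cdot> w)"
        by (rule e(5)[OF cp])
      also have "\<dots> = a \<cdot> (pb2 E (eval E (dm E p)) q \<cdot> ?z)"
        using I cn by simp
      also have "\<dots> = pb2 E (eval E (dm E p')) q' \<cdot> (lq \<cdot> ?z)"
        using cmp_reassoc[OF l(6), of ?z] by (simp del: pb_pair_cmp)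
      finally show "pb2 E (eval E (dm E p')) q' \<cdot> ?z' = pb2 E (eval E (dm E p')) q' \<cdot> (lq \<cdot> ?z)" .
    qed (simp_all del: pb_pair_cmp)
    then show "app E (path_prod E p') ?r' (ib' \<cdot> eK \<cdot> k) (path_prod E b \<cdot> w) =
        app E (path_prod E p') ?r' (eL \<cdot> ib \<cdot> k) (path_prod E b \<cdot> w)"
      using eL(5)[OF c1] by (simp del: pb_pair_cmp)
  qed (use I4 cmp_reassoc[OF I4(2), of eK] cmp_reassoc[OF eL(4), of ib] eK(4)
      in \<open>simp_all del: pb_pair_cmp\<close>)
qed

text \<open>The new ingredient is \<open>lift_path_natural\<close>: the lift chosen on the primed
  side through \<open>b \<cdot> y\<close> is the image of the one chosen through \<open>y\<close>,
  so the two functions are evaluated at corresponding arguments.\<close>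

lemma retraction_top_natural: "rt' \<cdot> eN = path_prod E e \<cdot> rt"
proof -
  let ?\<Pi> = "push E p q" let ?\<Pi>' = "push E p' q'"
  let ?N = "push E (path_prod E p) (path_prod E q)" let ?N' = "push E (path_prod E p') (path_prod E q')"
  note R = rt[unfolded retraction_top_def] and R' = rt'[unfolded retraction_top_def]
  note [simp] = e(1-3) eN(1-3) pb_squareD(1-8)[OF sq] pb_squareD(1-8)[OF sp]
  have [simp]: "rt \<in> ar E" "dm E rt = dm E ?N" "cd E rt = cyl (dm E ?\<Pi>)"
    "rt' \<in> ar E" "dm E rt' = dm E ?N'" "cd E rt' = cyl (dm E ?\<Pi>')"
    using R R' by simp_all
  have R4: "path_prod E ?\<Pi> \<cdot> rt = ?N" "path_prod E ?\<Pi>' \<cdot> rt' = ?N'"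
    using R R' by simp_all
  have ee: "path_prod E ?\<Pi>' \<cdot> path_prod E e = path_prod E c \<cdot> path_prod E ?\<Pi>"
    using e(4) by (simp flip: path_prod_cmp)
  show ?thesis
  proof (rule cylinder_push_ext[OF qp' sp, where x = ?N])
    fix n i y assume [simp]: "n \<in> ar E" "cd E n = dm E ?N" and o: "over E p (?N \<cdot> n) i y"
    note [simp] = overD(3,4,6,8)[OF o]
    have [simp]: "dm E i = dm E n" "dm E y = dm E n" using overD(5,7)[OF o] by simp_all
    note o' = lift_path_natural[OF o]
    note N' = cmp_reassoc[OF eN(4), of n]
    let ?w = "lift_path E p s (?N \<cdot> n) i y"
    note w = lift_path[OF s o] and [simp] = lift_path(1-3)[OF s o]
    have cw: "cone E (path_prod E p) ?N ?w n" using w(4) by (simp add: cone_def)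
    let ?z = "app E (path_prod E p) (path_prod E q) n ?w"
    note [simp] = app(1-3)[OF _ _ _ cw]
    have co: "cone E p ?\<Pi> y (pap E (dm E ?\<Pi>) (pfst (dm E ?\<Pi>) \<cdot> (rt \<cdot> n)) i)"
      using overD(9)[OF o] cmp_reassoc[OF R4(1), of n]
        pfst_path_prod(1)[of ?\<Pi> "cd E p" "rt \<cdot> n"]
      by (simp add: cone_def flip: pap_path_ftor)
    have "app E p' q' (pap E (dm E ?\<Pi>') (pfst (dm E ?\<Pi>') \<cdot> (rt' \<cdot> (eN \<cdot> n))) i) (b \<cdot> y) =
      pap E (dm E q') (pfst (dm E q') \<cdot> app E (path_prod E p') (path_prod E q') (eN \<cdot> n)
        (lift_path E p' s' (?N' \<cdot> (eN \<cdot> n)) i (b \<cdot> y))) i"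
      using R' o'(1) N' by simp
    also have "lift_path E p' s' (?N' \<cdot> (eN \<cdot> n)) i (b \<cdot> y) = path_prod E b \<cdot> ?w"
      using o'(2) N' by simp
    also have "app E (path_prod E p') (path_prod E q') (eN \<cdot> n) (path_prod E b \<cdot> ?w) = path_prod E a \<cdot> ?z"
      by (rule eN(5)[OF cw])
    also have "pap E (dm E q') (pfst (dm E q') \<cdot> (path_prod E a \<cdot> ?z)) i =
        a \<cdot> pap E (dm E q) (pfst (dm E q) \<cdot> ?z) i"
      by (simp add: pap_path_ftor)
    also have "\<dots> = a \<cdot> app E p q (pap E (dm E ?\<Pi>) (pfst (dm E ?\<Pi>) \<cdot> (rt \<cdot> n)) i) y"
      using R o by simp
    also have "\<dots> = app E p' q' (e \<cdot> pap E (dm E ?\<Pi>) (pfst (dm E ?\<Pi>) \<cdot> (rt \<cdot> n)) i) (b \<cdot> y)"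
      using e(5)[OF co] by simp
    also have "\<dots> = app E p' q' (pap E (dm E ?\<Pi>') (pfst (dm E ?\<Pi>') \<cdot> (path_prod E e \<cdot> (rt \<cdot> n))) i) (b \<cdot> y)"
      by (simp add: pap_path_ftor)
    finally show "app E p' q' (pap E (dm E ?\<Pi>') (pfst (dm E ?\<Pi>') \<cdot> (rt' \<cdot> eN \<cdot> n)) i) (b \<cdot> y) =
      app E p' q' (pap E (dm E ?\<Pi>') (pfst (dm E ?\<Pi>') \<cdot> (path_prod E e \<cdot> rt \<cdot> n)) i) (b \<cdot> y)"
      by simp
  qed (use R4 eN(4) cmp_reassoc[OF R4(2), of eN] cmp_reassoc[OF ee, of rt] in simp_all)
qed

text \<open>First projections agree because all maps cover \<open>path_prod E c\<close>. Second
  projections are functions, compared on arguments \<open>b \<cdot> y\<close>, where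
  \<open>sec_natural\<close> matches the lifts.\<close>

lemma retraction_bot_natural: "rb' \<cdot> eL = eK \<cdot> rb"
proof -
  let ?\<Pi> = "push E p q" let ?\<Pi>' = "push E p' q'"
  let ?r = "pb1 E (eval E (dm E p)) q" let ?r' = "pb1 E (eval E (dm E p')) q'"
  let ?k1 = "pb1 E (eval E (cd E p)) ?\<Pi>" let ?k2 = "pb2 E (eval E (cd E p)) ?\<Pi>"
  let ?k1' = "pb1 E (eval E (cd E p')) ?\<Pi>'" let ?k2' = "pb2 E (eval E (cd E p')) ?\<Pi>'"
  let ?L = "push E (path_prod E p) ?r" let ?L' = "push E (path_prod E p') ?r'"
  note R = rb[unfolded retraction_bot_def] and R' = rb'[unfolded retraction_bot_def]
  note l = delta_base_change_at[OF sq qp(3) qp'(3)]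
  note [simp] = e(1-3) eL(1-3) eK(1-3) l(2-4) pb_squareD(1-8)[OF sq] pb_squareD(1-8)[OF sp]
  \<comment> \<open>\<open>lq\<close> and \<open>eK\<close> are pairings into pullbacks; composites
    with them are kept whole so that their projection equations apply.\<close>
  note [simp del] = pb_pair_cmp
  have [simp]: "rb \<in> ar E" "dm E rb = dm E ?L" "cd E rb = dm E ?k1"
    "rb' \<in> ar E" "dm E rb' = dm E ?L'" "cd E rb' = dm E ?k1'"
    using R R' by simp_all
  have R4: "?k1 \<cdot> rb = ?L" "?k1' \<cdot> rb' = ?L'"
    using R R' by simp_all
  have k2: "?\<Pi> \<cdot> (?k2 \<cdot> rb) = eval E (cd E p) \<cdot> ?L"
    using pb_commutes_reassoc[of "eval E (cd E p)" ?\<Pi> rb] R4(1) by simp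
  have 1: "?k1' \<cdot> (rb' \<cdot> eL) = ?k1' \<cdot> (eK \<cdot> rb)"
    using cmp_reassoc[OF R4(2), of eL] eL(4) cmp_reassoc[OF eK(4), of rb] R4(1) by simp
  have "?k2' \<cdot> (rb' \<cdot> eL) = ?k2' \<cdot> (eK \<cdot> rb)"
  proof (rule pushforward_ext_cart[OF qp' sp, where x = "eval E (cd E p) \<cdot> ?L"])
    show "?\<Pi>' \<cdot> (?k2' \<cdot> (rb' \<cdot> eL)) = c \<cdot> (eval E (cd E p) \<cdot> ?L)"
      using pb_commutes_reassoc[of "eval E (cd E p')" ?\<Pi>' "rb' \<cdot> eL"] cmp_reassoc[OF R4(2), of eL] eL(4)
      by (simp add: eval_path_prod)
    show "?\<Pi>' \<cdot> (?k2' \<cdot> (eK \<cdot> rb)) = c \<cdot> (eval E (cd E p) \<cdot> ?L)"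
      using pb_commutes_reassoc[of "eval E (cd E p')" ?\<Pi>' "eK \<cdot> rb"] cmp_reassoc[OF eK(4), of rb] R4(1)
      by (simp add: eval_path_prod)
    fix k y assume cn: "cone E p (eval E (cd E p) \<cdot> ?L) y k"
    note [simp] = coneD(3,4,7)[OF cn]
    have [simp]: "cd E k = dm E ?L" "dm E y = dm E k" using coneD(6,8)[OF cn] by simp_all
    have cs: "cone E (eval E (cd E p)) p (?L \<cdot> k) y"
      using coneD(9)[OF cn] by (simp add: cone_def)
    note cs' = sec_natural[OF cs]
    note L' = cmp_reassoc[OF eL(4), of k]
    let ?w = "sec E p s (?L \<cdot> k) y"
    note w = sec[OF s cs] and [simp] = sec(1-3)[OF s cs]
    have cw: "cone E (path_prod E p) ?L ?w k" using w(4) by (simp add: cone_def)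
    let ?z = "app E (path_prod E p) ?r k ?w"
    note [simp] = app(1-3)[OF _ _ _ cw]
    have co: "cone E p ?\<Pi> y (?k2 \<cdot> (rb \<cdot> k))"
      using coneD(9)[OF cn] cmp_reassoc[OF k2, of k] by (simp add: cone_def)
    have "app E p' q' (?k2' \<cdot> (rb' \<cdot> (eL \<cdot> k))) (b \<cdot> y) =
      pb2 E (eval E (dm E p')) q' \<cdot> app E (path_prod E p') ?r' (eL \<cdot> k) (sec E p' s' (?L' \<cdot> (eL \<cdot> k)) (b \<cdot> y))"
      using R' cs'(1) L' by simp
    also have "sec E p' s' (?L' \<cdot> (eL \<cdot> k)) (b \<cdot> y) = path_prod E b \<cdot> ?w"
      using cs'(2) L' by simp
    also have "app E (path_prod E p') ?r' (eL \<cdot> k) (path_prod E b \<cdot> ?w) = lq \<cdot> ?z"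
      by (rule eL(5)[OF cw])
    also have "pb2 E (eval E (dm E p')) q' \<cdot> (lq \<cdot> ?z) = a \<cdot> (pb2 E (eval E (dm E p)) q \<cdot> ?z)"
      using cmp_reassoc[OF l(6), of ?z] by simp
    also have "\<dots> = a \<cdot> app E p q (?k2 \<cdot> (rb \<cdot> k)) y"
      using R cs by simp
    also have "\<dots> = app E p' q' (e \<cdot> (?k2 \<cdot> (rb \<cdot> k))) (b \<cdot> y)"
      using e(5)[OF co] by simp
    also have "\<dots> = app E p' q' (?k2' \<cdot> (eK \<cdot> (rb \<cdot> k))) (b \<cdot> y)"
      using cmp_reassoc[OF eK(5), of "rb \<cdot> k"] by simp
    finally show "app E p' q' (?k2' \<cdot> (rb' \<cdot> eL) \<cdot> k) (b \<cdot> y) =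
      app E p' q' (?k2' \<cdot> (eK \<cdot> rb) \<cdot> k) (b \<cdot> y)"
      by simp
  qed simp_all
  with 1 show ?thesis
    by - (rule pb_ext[of "eval E (cd E p')" ?\<Pi>'], simp_all)
qed

end

end

section \<open>The lifted functor\<close>

lemma catR_cart_simps:
  "(d0, d2) \<in> ob (catR_cart E) \<longleftrightarrow> d0 \<in> ar E \<and> d2 \<in> ar E \<and> dm E d2 = cd E d0 \<and>
     cd E d2 = dm E d0 \<and> d0 \<cdot>\<^bsub>E\<^esub> d2 = idt E (cd E d0)"
  "(x, y, (k, l)) \<in> ar (catR_cart E) \<Longrightarrow> square E (snd x) (snd y) l k"
  "dm (catR_cart E) (x, y, t) = x" "cd (catR_cart E) (x, y, t) = y"
  by (auto simp: catR_cart_def catR_def diag_cat_simps wide_subcat_simps)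

lemma cat2R_cart_simps:
  "(d0, d2) \<in> ob (cat2R_cart E) \<longleftrightarrow> d0 \<in> ar (cat2 E) \<and> d2 \<in> ar (cat2 E) \<and>
     dm (cat2 E) d2 = cd (cat2 E) d0 \<and> cd (cat2 E) d2 = dm (cat2 E) d0 \<and>
     d0 \<cdot>\<^bsub>cat2 E\<^esub> d2 = idt (cat2 E) (cd (cat2 E) d0)"
  "((d0, d2), (d0', d2'), (k, l)) \<in> ar (cat2R_cart E) \<longleftrightarrow>
     (d0, d2) \<in> ob (cat2R_cart E) \<and> (d0', d2') \<in> ob (cat2R_cart E) \<and>
     square (cat2 E) d0 d0' k l \<and> square (cat2 E) d2 d2' l k \<and>
     k \<in> ar (cat2_cart E) \<and> l \<in> ar (cat2_cart E)"
  "dm (cat2R_cart E) (x, y, t) = x" "cd (cat2R_cart E) (x, y, t) = y"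
  by (auto simp: cat2R_cart_def catR_def diag_cat_simps wide_subcat_simps)

lemma cat4_cart_dm_cd [simp]:
  "dm (cat4_cart E) (x, y, t) = x" "cd (cat4_cart E) (x, y, t) = y"
  by (simp_all add: cat4_cart_def cat4_def diag_cat_simps wide_subcat_simps)

text \<open>Chosen pullbacks give the lifts and the pasting law gives the fillers. Lifts are unique
  only up to isomorphism, whence the use of right fibrations instead of discrete ones.\<close>

lemma (in lcc_category) cod2_right_fibration: "right_fibration (cat2_cart E) E (cod2 E)"
proof (rule right_fibrationI[OF cat2_cart_functors(1)])
  fix p f assume "p \<in> ob (cat2_cart E)" "f \<in> ar E" "cd E f = FO (cod2 E) p"
  then have [simp]: "p \<in> ar E" "f \<in> ar E" and pf: "cd E f = cd E p" by (simp_all add: cod2_def)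
  note [simp] = pf pf[symmetric]
  have "pb_square E (pb1 E f p) p (pb2 E f p) f"
  proof (rule pb_squareI)
    fix x y assume "x \<in> ar E" "y \<in> ar E" "dm E x = dm E y" "cd E x = dm E p"
      "cd E y = cd E (pb1 E f p)" "p \<cdot> x = f \<cdot> y"
    then have c: "cone E f p y x" using pf by (simp add: cone_def del: pf[symmetric])
    show "\<exists>h\<in>ar E. dm E h = dm E x \<and> cd E h = dm E (pb1 E f p) \<and> pb2 E f p \<cdot> h = x \<and> pb1 E f p \<cdot> h = y"
      using pb_pair[OF c] coneD(6)[OF c] by (intro bexI[of _ "pb_pair E f p y x"]) auto
  next
    fix h h' assume "h \<in> ar E" "h' \<in> ar E" "cd E h = dm E (pb1 E f p)" "cd E h' = dm E (pb1 E f p)"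
      "dm E h = dm E h'" "pb2 E f p \<cdot> h = pb2 E f p \<cdot> h'" "pb1 E f p \<cdot> h = pb1 E f p \<cdot> h'"
    then show "h = h'" by - (rule pb_ext[of f p], simp_all add: pf del: pf[symmetric])
  qed (use pb_commutes[of f p] pf in \<open>simp_all del: pf[symmetric]\<close>)
  then show "\<exists>k\<in>ar (cat2_cart E). cd (cat2_cart E) k = p \<and> FA (cod2 E) k = f"
    by (intro bexI[of _ "(pb1 E f p, p, (pb2 E f p, f))"]) (simp_all add: cod2_def)
next
  fix k g w
  assume kg: "k \<in> ar (cat2_cart E)" "g \<in> ar (cat2_cart E)" "cd (cat2_cart E) g = cd (cat2_cart E) k"
    "w \<in> ar E" "dm E w = FO (cod2 E) (dm (cat2_cart E) g)" "cd E w = FO (cod2 E) (dm (cat2_cart E) k)"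
    "FA (cod2 E) k \<cdot> w = FA (cod2 E) g"
  obtain p p' a b where k: "k = (p, p', (a, b))" by (cases k) auto
  obtain p'' a' b' where g: "g = (p'', p', (a', b'))" using kg(3) unfolding k by (cases g) auto
  have s: "pb_square E p p' a b" and s': "pb_square E p'' p' a' (b \<cdot> w)"
    and w: "w \<in> ar E" "dm E w = cd E p''" "cd E w = cd E p"
    using kg unfolding k g by (simp_all add: cod2_def)
  obtain c where "a \<cdot> c = a'" "pb_square E p'' p c w"
    by (rule pb_square_cancel[OF s s' w])
  then show "\<exists>h\<in>ar (cat2_cart E). dm (cat2_cart E) h = dm (cat2_cart E) g \<and>
      cd (cat2_cart E) h = dm (cat2_cart E) k \<and> k \<cdot>\<^bsub>cat2_cart E\<^esub> h = g \<and> FA (cod2 E) h = w"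
    using kg unfolding k g by (intro bexI[of _ "(p'', p, (c, w))"]) (simp_all add: cod2_def)
next
  fix k h h'
  assume kh: "k \<in> ar (cat2_cart E)" "h \<in> ar (cat2_cart E)" "h' \<in> ar (cat2_cart E)"
    "cd (cat2_cart E) h = dm (cat2_cart E) k" "cd (cat2_cart E) h' = dm (cat2_cart E) k"
    "dm (cat2_cart E) h = dm (cat2_cart E) h'" "k \<cdot>\<^bsub>cat2_cart E\<^esub> h = k \<cdot>\<^bsub>cat2_cart E\<^esub> h'"
    "FA (cod2 E) h = FA (cod2 E) h'"
  obtain p p' a b where k: "k = (p, p', (a, b))" by (cases k) auto
  obtain p'' c w where h: "h = (p'', p, (c, w))" using kh(4) unfolding k by (cases h) auto
  obtain c' w' where h': "h' = (p'', p, (c', w'))"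
    using kh(5,6) unfolding k h by (cases h') auto
  have w: "w' = w" and cc: "a \<cdot> c = a \<cdot> c'" and s: "pb_square E p p' a b"
    and t: "pb_square E p'' p c w" "pb_square E p'' p c' w'"
    using kh unfolding k h h' by (simp_all add: cod2_def)
  have "c = c'"
    by (rule pb_square_ext[OF s])
      (use cc pb_squareD[OF t(1)] pb_squareD[OF t(2)] w in simp_all)
  then show "h = h'" using w by (simp add: h h')
qed

lemma times_u_Fib_simps [simp]:
  "FO (times_ftor u_Fib) ((x, q), (y, p)) = (q, p)"
  "FA (times_ftor u_Fib) ((f, (q, q', (a, b))), (g, (p, p', (b', c)))) = ((q, p), (q', p'), (a, b, c))"
  by (simp_all add: times_ftor_def u_Fib_def)

lemma cod3_times_u_Fib: "cod3 E \<circ>\<^sub>F times_ftor u_Fib = cod2 E \<circ>\<^sub>F u_Fib \<circ>\<^sub>F proj2"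
  by (auto simp: ftor_comp_def cod3_def cod2_def times_ftor_def u_Fib_def proj2_def fun_eq_iff
      split: prod.splits)

context lcc_interval_category
begin

section \<open>Structured fibrations, composable pairs, and their pushforward\<close>

context
  fixes F :: "('f, 'g) cat" and u :: "('f, 'g, 'm, 'm arr2) ftor" and Fib Fib2
  assumes disc: "discrete_fibration F (cat2_cart E) u"
  defines "Fib \<equiv> pullback_cat F (cat2_cart E) u (delta_ftor E)"
    and "Fib2 \<equiv> pullback_cat Fib Fib (cod2 E \<circ>\<^sub>F u_Fib) (dom2 E \<circ>\<^sub>F u_Fib)"
begin

lemma Fib_discrete_fibration: "discrete_fibration Fib (cat2_cart E) u_Fib"
  unfolding Fib_def u_Fib_def by (rule discrete_fibration_pullback[OF disc delta_functor])

lemma Fib_right_fibration: "right_fibration Fib E (cod2 E \<circ>\<^sub>F u_Fib)"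
  by (rule right_fibration_comp[OF discrete_imp_right_fibration[OF Fib_discrete_fibration]
        cod2_right_fibration])

text \<open>The projection of a pair to its second member is a pullback of the right fibration
  \<open>cod2 E \<circ>\<^sub>F u_Fib\<close>, and the codomain of a pair is the codomain of that
  member.\<close>

lemma Fib2_right_fibration: "right_fibration Fib2 E (cod3 E \<circ>\<^sub>F times_ftor u_Fib)"
proof -
  have "is_functor Fib E (dom2 E \<circ>\<^sub>F u_Fib)"
    using Fib_discrete_fibration
    by (auto intro: is_functor_comp[OF _ cat2_cart_functors(2)] simp: discrete_fibration_def)
  from right_fibration_pullback[OF Fib_right_fibration this] show ?thesis
    unfolding Fib2_def cod3_times_u_Fib
    by (rule right_fibration_comp[OF _ Fib_right_fibration])
qed

lemma Fib2_ob:
  assumes "z \<in> ob Fib2"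
  obtains x q y p where "z = ((x, q), (y, p))" "x \<in> ob F" "y \<in> ob F" "q \<in> ar E" "p \<in> ar E"
    "cd E q = dm E p" "FO u x = delta_arr E q" "FO u y = delta_arr E p"
  using assms unfolding Fib2_def Fib_def
  by (cases z) (auto simp: u_Fib_def cod2_def dom2_def delta_ftor_def)

lemma Fib2_ar:
  assumes "k \<in> ar Fib2"
  obtains f q q' a b g p p' c where "k = ((f, (q, q', (a, b))), (g, (p, p', (b, c))))"
    "f \<in> ar F" "g \<in> ar F" "pb_square E q q' a b" "pb_square E p p' b c"
    "cd E q = dm E p" "cd E q' = dm E p'"
    "FA u f = FA (delta_ftor E) (q, q', (a, b))" "FA u g = FA (delta_ftor E) (p, p', (b, c))"
    "dm Fib2 k = ((dm F f, q), (dm F g, p))" "cd Fib2 k = ((cd F f, q'), (cd F g, p'))"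
proof -
  obtain f q q' a b g p p' b' c where k: "k = ((f, (q, q', (a, b))), (g, (p, p', (b', c))))"
    by (cases k) (metis prod.collapse)
  have h: "f \<in> ar F" "g \<in> ar F" "pb_square E q q' a b" "pb_square E p p' b c" "b' = b"
    "FA u f = FA (delta_ftor E) (q, q', (a, b))" "FA u g = FA (delta_ftor E) (p, p', (b, c))"
    using assms unfolding k Fib2_def Fib_def by (auto simp: u_Fib_def cod2_def dom2_def)
  have "cd E q = dm E p" "cd E q' = dm E p'"
    using pb_squareD[OF h(3)] pb_squareD[OF h(4)] by simp_all
  with h show thesis by (intro that[of f q q' a b g p p' c]) (simp_all add: k Fib2_def Fib_def)
qed

lemma Pi3_functor: "is_functor Fib2 (cat2_cart E) (Pi3 E \<circ>\<^sub>F times_ftor u_Fib)"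
  unfolding is_functor_def
proof (intro conjI ballI impI)
  show "category Fib2"
    using Fib2_right_fibration by (auto simp: right_fibration_def dest: is_functorD(1))
  show "category (cat2_cart E)" by (rule is_functorD(1)[OF cat2_cart_functors(1)])
next
  fix z assume "z \<in> ob Fib2"
  then obtain x q y p where z: "z = ((x, q), (y, p))" and qp: "p \<in> ar E" "q \<in> ar E" "cd E q = dm E p"
    by (rule Fib2_ob)
  then show "FO (Pi3 E \<circ>\<^sub>F times_ftor u_Fib) z \<in> ob (cat2_cart E)" by (simp add: Pi3_def)
  show "FA (Pi3 E \<circ>\<^sub>F times_ftor u_Fib) (idt Fib2 z) =
      idt (cat2_cart E) (FO (Pi3 E \<circ>\<^sub>F times_ftor u_Fib) z)"
    using push_map_idt[OF qp] qp unfolding z by (simp add: Fib2_def Fib_def Pi3_def)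
next
  fix k assume "k \<in> ar Fib2"
  then obtain f q q' a b g p p' c where k: "k = ((f, (q, q', (a, b))), (g, (p, p', (b, c))))"
    and h: "pb_square E q q' a b" "pb_square E p p' b c" "cd E q = dm E p" "cd E q' = dm E p'"
    and kd: "dm Fib2 k = ((dm F f, q), (dm F g, p))" "cd Fib2 k = ((cd F f, q'), (cd F g, p'))"
    by (rule Fib2_ar)
  have "pb_square E (push E p q) (push E p' q') (push_map E (q, p) (q', p') (a, b, c)) c"
    by (rule beck_chevalley) (use h pb_squareD[OF h(1)] pb_squareD[OF h(2)] in \<open>auto simp: pb_square_def\<close>)
  then show "FA (Pi3 E \<circ>\<^sub>F times_ftor u_Fib) k \<in> hom (cat2_cart E)
      (FO (Pi3 E \<circ>\<^sub>F times_ftor u_Fib) (dm Fib2 k)) (FO (Pi3 E \<circ>\<^sub>F times_ftor u_Fib) (cd Fib2 k))"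
    unfolding kd unfolding k by (simp add: Pi3_def)
next
  fix k l assume kl: "k \<in> ar Fib2" "l \<in> ar Fib2" "cd Fib2 k = dm Fib2 l"
  obtain f q q' a b g p p' c where k: "k = ((f, (q, q', (a, b))), (g, (p, p', (b, c))))"
    and h: "pb_square E q q' a b" "pb_square E p p' b c" "cd E q = dm E p" "cd E q' = dm E p'"
    and kd: "cd Fib2 k = ((cd F f, q'), (cd F g, p'))"
    using kl(1) by (rule Fib2_ar)
  obtain f' q1 q'' a' b' g' p1 p'' c' where l: "l = ((f', (q1, q'', (a', b'))), (g', (p1, p'', (b', c'))))"
    and h': "pb_square E q1 q'' a' b'" "pb_square E p1 p'' b' c'" "cd E q1 = dm E p1" "cd E q'' = dm E p''"
    and ld: "dm Fib2 l = ((dm F f', q1), (dm F g', p1))"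
    using kl(2) by (rule Fib2_ar)
  have [simp]: "q1 = q'" "p1 = p'" using kl(3) unfolding kd ld by simp_all
  have "push_map E (q, p) (q'', p'') (a' \<cdot> a, b' \<cdot> b, c' \<cdot> c) =
    push_map E (q', p') (q'', p'') (a', b', c') \<cdot> push_map E (q, p) (q', p') (a, b, c)"
    by (rule push_map_cmp)
      (use h h' pb_squareD(1,2)[OF h(1)] pb_squareD(1,2)[OF h(2)] pb_squareD(1,2)[OF h'(1)]
        pb_squareD(1,2)[OF h'(2)] in \<open>auto simp: pb_square_def\<close>)
  then show "FA (Pi3 E \<circ>\<^sub>F times_ftor u_Fib) (l \<cdot>\<^bsub>Fib2\<^esub> k) =
     FA (Pi3 E \<circ>\<^sub>F times_ftor u_Fib) l \<cdot>\<^bsub>cat2_cart E\<^esub> FA (Pi3 E \<circ>\<^sub>F times_ftor u_Fib) k"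
    unfolding k l by (simp add: Fib2_def Fib_def Pi3_def)
qed

lemma cod_Pi3:
  "ftor_eq Fib2 (cod2 E \<circ>\<^sub>F (Pi3 E \<circ>\<^sub>F times_ftor u_Fib)) (cod3 E \<circ>\<^sub>F times_ftor u_Fib)"
  unfolding ftor_eq_def
proof (intro conjI ballI)
  fix z assume "z \<in> ob Fib2"
  then show "FO (cod2 E \<circ>\<^sub>F (Pi3 E \<circ>\<^sub>F times_ftor u_Fib)) z = FO (cod3 E \<circ>\<^sub>F times_ftor u_Fib) z"
    by (rule Fib2_ob) (simp add: cod2_def cod3_def Pi3_def)
next
  fix k assume "k \<in> ar Fib2"
  then show "FA (cod2 E \<circ>\<^sub>F (Pi3 E \<circ>\<^sub>F times_ftor u_Fib)) k = FA (cod3 E \<circ>\<^sub>F times_ftor u_Fib) k"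
    by (rule Fib2_ar) (simp add: cod2_def cod3_def Pi3_def)
qed

text \<open>The place where STF1, STF2 and STF3 meet: \<open>S\<close> yields the section,
  \<open>L\<close> structures the center, and \<open>M\<close> passes to the retract. Over each
  arrow only the existence of a structured arrow is claimed; the functor laws follow later from
  discreteness.\<close>

lemma pushforward_fibration_structure:
  assumes S: "is_functor F (catR_cart E) S" "ftor_eq F (d0_ftor \<circ>\<^sub>F S) u"
    and L: "is_functor (pullback_cat F (cat4_cart E) u ev01_4) (pullback_cat F (cat3_cart E) u ev01_3) L"
      "ftor_eq (pullback_cat F (cat4_cart E) u ev01_4) (proj2 \<circ>\<^sub>F L) (Pi4 E \<circ>\<^sub>F proj2)"
    and M: "is_functor (pullback_cat F (cat2R_cart E) u (ev_c E)) F M"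
      "ftor_eq (pullback_cat F (cat2R_cart E) u (ev_c E)) (u \<circ>\<^sub>F M) (ev_r E \<circ>\<^sub>F proj2)"
  obtains T where "\<And>z. z \<in> ob Fib2 \<Longrightarrow>
      T z \<in> ob F \<and> FO u (T z) = delta_arr E (FO (Pi3 E \<circ>\<^sub>F times_ftor u_Fib) z)"
    "\<And>k. k \<in> ar Fib2 \<Longrightarrow> \<exists>t\<in>ar F. dm F t = T (dm Fib2 k) \<and> cd F t = T (cd Fib2 k) \<and>
      FA u t = FA (delta_ftor E) (FA (Pi3 E \<circ>\<^sub>F times_ftor u_Fib) k)"
proof -
  define sn where "sn y = snd (FO S y)" for y
  \<comment> \<open>Arbitrary choices are harmless: the retract equations and the naturality lemmas
    use nothing but the four characterizations.\<close>
  define it where "it q p = (SOME t. section_top q p t)" for q p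
  define ib where "ib q p = (SOME t. section_bot q p t)" for q p
  define rt where "rt q p y = (SOME t. retraction_top q p (sn y) t)" for q p y
  define rb where "rb q p y = (SOME t. retraction_bot q p (sn y) t)" for q p y
  define c4 where "c4 q p = (delta_arr E q, pb1 E (eval E (dm E p)) q, path_prod E p)" for q p
  define R where "R q p y = ((center q p, delta_arr E (push E p q), (rt q p y, rb q p y)),
    (delta_arr E (push E p q), center q p, (it q p, ib q p)))" for q p y
  define T where "T z = (case z of ((x, q), (y, p)) \<Rightarrow> FO M (fst (FO L (x, c4 q p)), R q p y))" for z
  note U = is_functorD[OF disc[unfolded discrete_fibration_def, THEN conjunct1]]
  note S' = is_functorD[OF S(1)] and L' = is_functorD[OF L(1)] and M' = is_functorD[OF M(1)]
  have sn: "FO S y = (delta_arr E p, sn y)" "sectioned E p (sn y)"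
    if "y \<in> ob F" "FO u y = delta_arr E p" "p \<in> ar E" for y p
  proof -
    have "fst (FO S y) = delta_arr E p"
      using S(2) that by (simp add: ftor_eq_def d0_ftor_def)
    then show e: "FO S y = (delta_arr E p, sn y)" by (metis sn_def prod.collapse)
    show "sectioned E p (sn y)"
      using S'(3)[OF that(1)] that(3) unfolding e by (auto simp: catR_cart_simps sectioned_def)
  qed
  have data: "section_top q p (it q p)" "section_bot q p (ib q p)"
    "retraction_top q p (sn y) (rt q p y)" "retraction_bot q p (sn y) (rb q p y)"
    if "p \<in> ar E" "q \<in> ar E" "cd E q = dm E p" "sectioned E p (sn y)" for q p y
    unfolding it_def ib_def rt_def rb_def
    using someI_ex[OF section_top_ex[OF that(1-3)]] someI_ex[OF section_bot_ex[OF that(1-3)]]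
      someI_ex[OF retraction_top_ex[OF that]] someI_ex[OF retraction_bot_ex[OF that]] by blast+
  have Rob: "R q p y \<in> ob (cat2R_cart E)"
    if "p \<in> ar E" "q \<in> ar E" "cd E q = dm E p" "sectioned E p (sn y)" for q p y
  proof -
    note d = data[OF that] and [simp] = that(1-3) center(1-3)[OF that(1-3)]
    have [simp]: "it q p \<in> ar E" "dm E (it q p) = cyl (dm E (push E p q))"
      "cd E (it q p) = dm E (push E (path_prod E p) (path_prod E q))"
      "ib q p \<in> ar E" "dm E (ib q p) = dm E (pb1 E (eval E (cd E p)) (push E p q))"
      "cd E (ib q p) = dm E (push E (path_prod E p) (pb1 E (eval E (dm E p)) q))"
      "rt q p y \<in> ar E" "dm E (rt q p y) = dm E (push E (path_prod E p) (path_prod E q))"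
      "cd E (rt q p y) = cyl (dm E (push E p q))"
      "rb q p y \<in> ar E" "dm E (rb q p y) = dm E (push E (path_prod E p) (pb1 E (eval E (dm E p)) q))"
      "cd E (rb q p y) = dm E (pb1 E (eval E (cd E p)) (push E p q))"
      using d by (auto simp: section_top_def section_bot_def retraction_top_def retraction_bot_def)
    note sq = section_square[OF that d] retraction_square[OF that d]
      retract_top[OF that d] retract_bot[OF that d]
    show ?thesis
      unfolding R_def cat2R_cart_simps by (simp add: square_def sq)
  qed
  have c4ob: "(x, c4 q p) \<in> ob (pullback_cat F (cat4_cart E) u ev01_4)"
    if "x \<in> ob F" "FO u x = delta_arr E q" "p \<in> ar E" "q \<in> ar E" "cd E q = dm E p" for x q p
    using that by (simp add: c4_def ev01_4_def)
  have Lob: "fst (FO L (x, c4 q p)) \<in> ob F" "FO u (fst (FO L (x, c4 q p))) = center q p"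
    if "x \<in> ob F" "FO u x = delta_arr E q" "p \<in> ar E" "q \<in> ar E" "cd E q = dm E p" for x q p
  proof -
    have "snd (FO L (x, c4 q p)) = FO (Pi4 E) (c4 q p)"
      using L(2) c4ob[OF that] by (auto simp: ftor_eq_def simp del: pullback_cat_simps)
    then show "fst (FO L (x, c4 q p)) \<in> ob F" "FO u (fst (FO L (x, c4 q p))) = center q p"
      using L'(3)[OF c4ob[OF that]] by (auto simp: Pi4_def c4_def ev01_3_def center_def)
  qed
  have TRob: "(fst (FO L (x, c4 q p)), R q p y) \<in> ob (pullback_cat F (cat2R_cart E) u (ev_c E))"
    if "x \<in> ob F" "FO u x = delta_arr E q" "p \<in> ar E" "q \<in> ar E" "cd E q = dm E p"
      "sectioned E p (sn y)" for x q p y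
    using Lob[OF that(1-5)] Rob[OF that(3-6)] by (simp add: ev_c_def R_def)
  have T1: "T z \<in> ob F \<and> FO u (T z) = delta_arr E (FO (Pi3 E \<circ>\<^sub>F times_ftor u_Fib) z)"
    if z': "z \<in> ob Fib2" for z
  proof -
    obtain x q y p where z: "z = ((x, q), (y, p))" and h: "x \<in> ob F" "y \<in> ob F" "q \<in> ar E" "p \<in> ar E"
      "cd E q = dm E p" "FO u x = delta_arr E q" "FO u y = delta_arr E p"
      using z' by (rule Fib2_ob)
    note o = TRob[OF h(1,6,4,3,5) sn(2)[OF h(2,7,4)]]
    have "FO u (T z) = FO (ev_r E) (R q p y)"
      using M(2) o by (auto simp: ftor_eq_def z T_def simp del: pullback_cat_simps)
    then show ?thesis using M'(3)[OF o] by (simp add: z T_def ev_r_def R_def Pi3_def)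
  qed
  have T2: "\<exists>t\<in>ar F. dm F t = T (dm Fib2 k) \<and> cd F t = T (cd Fib2 k) \<and>
      FA u t = FA (delta_ftor E) (FA (Pi3 E \<circ>\<^sub>F times_ftor u_Fib) k)" if k': "k \<in> ar Fib2" for k
  proof -
    obtain f q q' a b g p p' c where k: "k = ((f, (q, q', (a, b))), (g, (p, p', (b, c))))"
      and fg: "f \<in> ar F" "g \<in> ar F" and sq: "pb_square E q q' a b" and sp: "pb_square E p p' b c"
      and cq: "cd E q = dm E p" and cq': "cd E q' = dm E p'"
      and uf: "FA u f = FA (delta_ftor E) (q, q', (a, b))"
      and ug: "FA u g = FA (delta_ftor E) (p, p', (b, c))"
      and kd: "dm Fib2 k = ((dm F f, q), (dm F g, p))" "cd Fib2 k = ((cd F f, q'), (cd F g, p'))"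
      using k' by (rule Fib2_ar)
    have p: "p \<in> ar E" "q \<in> ar E" "p' \<in> ar E" "q' \<in> ar E"
      using pb_squareD(1,2)[OF sq] pb_squareD(1,2)[OF sp] by simp_all
    interpret FC: category F by (rule U)
    let ?x = "dm F f" and ?x' = "cd F f" and ?y = "dm F g" and ?y' = "cd F g"
    have ob: "?x \<in> ob F" "?x' \<in> ob F" "?y \<in> ob F" "?y' \<in> ob F" using fg by simp_all
    have ux: "FO u ?x = delta_arr E q" "FO u ?x' = delta_arr E q'"
      "FO u ?y = delta_arr E p" "FO u ?y' = delta_arr E p'"
      using U(5,6)[OF fg(1)] U(5,6)[OF fg(2)] by (simp_all add: uf ug delta_ftor_def)
    note s = sn[OF ob(3) ux(3) p(1)] and s' = sn[OF ob(4) ux(4) p(3)]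
    note d = data[OF p(1,2) cq s(2)] and d' = data[OF p(3,4) cq' s'(2)]
    \<comment> \<open>The morphism \<open>FA S g\<close> is a square on retractions and also on
      sections. Its image under \<open>d0_ftor\<close> is \<open>FA u g\<close>, which identifies
      the components; the square on sections is then the claim.\<close>
    have ss: "sn ?y' \<cdot> pb_pair E (eval E (cd E p')) p' (path_prod E c \<cdot> pb1 E (eval E (cd E p)) p)
            (b \<cdot> pb2 E (eval E (cd E p)) p) = path_prod E b \<cdot> sn ?y"
    proof -
      obtain x1 x2 m n where e: "FA S g = (x1, x2, (m, n))" by (cases "FA S g") auto
      have x1: "x1 = FO S ?y" and x2: "x2 = FO S ?y'"
        using S'(5,6)[OF fg(2)] unfolding e by (simp_all add: catR_cart_simps)
      have "FA d0_ftor (FA S g) = FA u g" using S(2) fg(2) by (simp add: ftor_eq_def)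
      then have "m = path_prod E b" "n = pb_pair E (eval E (cd E p')) p'
          (path_prod E c \<cdot> pb1 E (eval E (cd E p)) p) (b \<cdot> pb2 E (eval E (cd E p)) p)"
        unfolding e x1 x2 ug s(1) s'(1) by (simp_all add: d0_ftor_def delta_ftor_def)
      moreover have "square E (sn ?y) (sn ?y') n m"
        using catR_cart_simps(2)[of x1 x2 m n E] S'(4)[OF fg(2)] e x1 x2 s(1) s'(1) by simp
      ultimately show ?thesis by (simp add: square_def)
    qed
    note hyps = p(1,2) cq s(2) and hyps' = p(3,4) cq' s'(2)
    let ?e = "push_map E (q, p) (q', p') (a, b, c)"
    let ?lq = "pb_pair E (eval E (dm E p')) q' (path_prod E b \<cdot> pb1 E (eval E (dm E p)) q)
            (a \<cdot> pb2 E (eval E (dm E p)) q)"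
    let ?r = "pb1 E (eval E (dm E p)) q" and ?r' = "pb1 E (eval E (dm E p')) q'"
    let ?eN = "push_map E (path_prod E q, path_prod E p) (path_prod E q', path_prod E p')
      (path_prod E a, path_prod E b, path_prod E c)"
    let ?eL = "push_map E (?r, path_prod E p) (?r', path_prod E p') (?lq, path_prod E b, path_prod E c)"
    let ?eK = "pb_pair E (eval E (cd E p')) (push E p' q')
      (path_prod E c \<cdot> pb1 E (eval E (cd E p)) (push E p q)) (?e \<cdot> pb2 E (eval E (cd E p)) (push E p q))"
    \<comment> \<open>The first square of this transformation is \<open>delta_ftor\<close> of the
      square of \<open>q\<close>, so \<open>f\<close> lies over it. The second is the base change of
      that square along evaluation, the third the path cylinder of the square of
      \<open>p\<close>.\<close>
    let ?A4 = "(c4 q p, c4 q' p', (path_prod E a, ?lq, path_prod E b, path_prod E c))"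
    have A4: "(f, ?A4) \<in> ar (pullback_cat F (cat4_cart E) u ev01_4)"
      using fg(1) uf p cq cq' pb_square_delta[OF sq] delta_base_change_at(1)[OF sq cq cq']
        pb_square_path_prod[OF sp]
      by (simp add: c4_def ev01_4_def delta_ftor_def)
    define f2 where "f2 = fst (FA L (f, ?A4))"
    have "snd (FA L (f, ?A4)) = FA (Pi4 E) ?A4"
      using L(2) A4 by (auto simp: ftor_eq_def simp del: pullback_cat_simps)
    moreover have "FA (Pi4 E) ?A4 = ((center q p, push E (path_prod E p) ?r),
        (center q' p', push E (path_prod E p') ?r'), (?eN, ?eL, path_prod E c))"
      using p cq cq' by (simp add: Pi4_def c4_def center_def)
    ultimately have e: "FA L (f, ?A4) = (f2, ((center q p, push E (path_prod E p) ?r),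
        (center q' p', push E (path_prod E p') ?r'), (?eN, ?eL, path_prod E c)))"
      unfolding f2_def by (metis prod.collapse)
    have f2: "f2 \<in> ar F" "FA u f2 = (center q p, center q' p', (?eN, ?eL))"
      "dm F f2 = fst (FO L (?x, c4 q p))" "cd F f2 = fst (FO L (?x', c4 q' p'))"
      using L'(4)[OF A4] arg_cong[OF L'(5)[OF A4], of fst] arg_cong[OF L'(6)[OF A4], of fst]
      unfolding e by (simp_all add: ev01_3_def)
    let ?l = "(delta_arr E (push E p q), delta_arr E (push E p' q'), (path_prod E ?e, ?eK))"
    \<comment> \<open>The square between the centers is a pullback without computation, being the
      image under \<open>u\<close> of the arrow \<open>f2\<close>.\<close>
    have k2: "(center q p, center q' p', (?eN, ?eL)) \<in> ar (cat2_cart E)"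
      using U(4)[OF f2(1)] f2(2) by simp
    have P: "pb_square E (push E p q) (push E p' q') ?e c"
      by (rule beck_chevalley) (use p cq cq' sq sp in \<open>auto simp: pb_square_def\<close>)
    have l: "?l = FA (delta_ftor E) (FA (Pi3 E \<circ>\<^sub>F times_ftor u_Fib) k)"
      using p cq cq' by (simp add: k Pi3_def delta_ftor_def)
    have l2: "?l \<in> ar (cat2_cart E)"
      using pb_square_delta[OF P] p cq cq' by simp
    \<comment> \<open>These four equations are the naturality of the section and of the retraction,
      each on domains and on codomains.\<close>
    note nat = section_top_natural[OF hyps d hyps' d' sq sp ss]
      section_bot_natural[OF hyps d hyps' d' sq sp ss]
      retraction_top_natural[OF hyps d hyps' d' sq sp ss]
      retraction_bot_natural[OF hyps d hyps' d' sq sp ss]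
    let ?AR = "(R q p ?y, R q' p' ?y', ((center q p, center q' p', (?eN, ?eL)), ?l))"
    have "?AR \<in> ar (cat2R_cart E)"
      using Rob[OF hyps] Rob[OF hyps'] k2 l2 nat
      unfolding R_def cat2R_cart_simps
      by (simp add: square_def pb_square_def)
    moreover obtain m where m: "m = ((center q p, center q' p', (?eN, ?eL)), ?l)" by blast
    ultimately have AR: "(f2, (R q p ?y, R q' p' ?y', m)) \<in> ar (pullback_cat F (cat2R_cart E) u (ev_c E))"
      using f2 by (simp add: ev_c_def)
    have "FA u (FA M (f2, (R q p ?y, R q' p' ?y', m))) = snd m"
      using M(2) AR by (auto simp: ftor_eq_def ev_r_def split_def simp del: pullback_cat_simps)
    then have uM: "FA u (FA M (f2, (R q p ?y, R q' p' ?y', m))) =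
        FA (delta_ftor E) (FA (Pi3 E \<circ>\<^sub>F times_ftor u_Fib) k)"
      by (rule trans) (unfold m snd_conv, rule l)
    have dcM: "dm F (FA M (f2, (R q p ?y, R q' p' ?y', m))) = T (dm Fib2 k)"
      "cd F (FA M (f2, (R q p ?y, R q' p' ?y', m))) = T (cd Fib2 k)"
      unfolding M'(5)[OF AR] M'(6)[OF AR]
      by (simp_all add: f2(3,4) kd T_def cat2R_cart_simps(3,4))
    show ?thesis by (rule bexI[OF _ M'(4)[OF AR]]) (intro conjI dcM uM)
  qed
  from T1 T2 show thesis by (rule that)
qed

end

end

theorem propositionC11:
  fixes E :: "('o, 'm) lcc_interval"
    and TFib :: "('f, 'g) cat"
    and u :: "('f, 'g, 'm, 'm arr2) ftor"
  assumes "lcc_interval_category E"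
    and "STF0 E TFib u"
    and "STF1 E TFib u"
    and "STF2 E TFib u"
    and "STF3 E TFib u"
  shows "\<exists>P. is_functor (Fib_Fib_cart E TFib u) (Fib_cart E TFib u) P \<and>
    ftor_eq (Fib_Fib_cart E TFib u) (u_Fib \<circ>\<^sub>F P) (Pi3 E \<circ>\<^sub>F times_ftor u_Fib) \<and>
    cartesian_functor E
      (Fib_Fib_cart E TFib u) (cod3 E \<circ>\<^sub>F times_ftor u_Fib)
      (Fib_cart E TFib u) (cod2 E \<circ>\<^sub>F u_Fib) P"
proof -
  interpret lcc_interval_category E by fact
  let ?F = "cart_part E TFib u" and ?Fib = "Fib_cart E TFib u" and ?Fib2 = "Fib_Fib_cart E TFib u"
  let ?v = "u_Fib :: ('f \<times> 'm, 'g \<times> 'm arr2, 'm, 'm arr2) ftor"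
  let ?G = "Pi3 E \<circ>\<^sub>F times_ftor ?v"
  have disc: "discrete_fibration ?F (cat2_cart E) u"
    using assms(2) by (simp add: STF0_def fibred_structure_def)
  note Fib = Fib_discrete_fibration[OF disc, folded Fib_cart_def]
    Fib_right_fibration[OF disc, folded Fib_cart_def]
  note Fib2 = Fib2_right_fibration[OF disc, folded Fib_cart_def, folded Fib_Fib_cart_def]
  note G = Pi3_functor[OF disc, folded Fib_cart_def, folded Fib_Fib_cart_def]
  obtain S where S: "is_functor ?F (catR_cart E) S" "ftor_eq ?F (d0_ftor \<circ>\<^sub>F S) u"
    using assms(3) by (auto simp: STF1_def)
  obtain L where L: "is_functor (pullback_cat ?F (cat4_cart E) u ev01_4) (pullback_cat ?F (cat3_cart E) u ev01_3) L"
      "ftor_eq (pullback_cat ?F (cat4_cart E) u ev01_4) (proj2 \<circ>\<^sub>F L) (Pi4 E \<circ>\<^sub>F proj2)"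
    using assms(4) by (auto simp: STF2_def Let_def)
  obtain M where M: "is_functor (pullback_cat ?F (cat2R_cart E) u (ev_c E)) ?F M"
      "ftor_eq (pullback_cat ?F (cat2R_cart E) u (ev_c E)) (u \<circ>\<^sub>F M) (ev_r E \<circ>\<^sub>F proj2)"
    using assms(5) by (auto simp: STF3_def Let_def)
  obtain T where T: "\<And>z. z \<in> ob ?Fib2 \<Longrightarrow> T z \<in> ob ?F \<and> FO u (T z) = delta_arr E (FO ?G z)"
    "\<And>k. k \<in> ar ?Fib2 \<Longrightarrow> \<exists>t\<in>ar ?F. dm ?F t = T (dm ?Fib2 k) \<and> cd ?F t = T (cd ?Fib2 k) \<and>
      FA u t = FA (delta_ftor E) (FA ?G k)"
    using pushforward_fibration_structure[OF disc S L M, folded Fib_cart_def, folded Fib_Fib_cart_def]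
    by metis
  note G' = is_functorD[OF G]
  obtain P where P: "is_functor ?Fib2 ?Fib P" "ftor_eq ?Fib2 (u_Fib \<circ>\<^sub>F P) ?G"
  \<comment> \<open>Since \<open>?Fib\<close> is a pullback, a lift of \<open>?G\<close> to it
    consists of \<open>?G\<close> together with a lift to \<open>?F\<close> of \<open>?G\<close>
    followed by \<open>delta_ftor E\<close>; \<open>T\<close> supplies the latter.\<close>
  proof (rule lift_functor_along_discrete_fibration[OF G Fib(1), of "\<lambda>z. (T z, FO ?G z)"])
    fix z assume "z \<in> ob ?Fib2"
    with T(1) G'(3) show "(T z, FO ?G z) \<in> ob ?Fib \<and> FO u_Fib (T z, FO ?G z) = FO ?G z"
      by (simp add: Fib_cart_def u_Fib_def delta_ftor_def)
  next
    fix k assume k: "k \<in> ar ?Fib2"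
    then obtain t where t: "t \<in> ar ?F" "dm ?F t = T (dm ?Fib2 k)" "cd ?F t = T (cd ?Fib2 k)"
      "FA u t = FA (delta_ftor E) (FA ?G k)" using T(2) by blast
    show "\<exists>l\<in>ar ?Fib. dm ?Fib l = (T (dm ?Fib2 k), FO ?G (dm ?Fib2 k)) \<and>
        cd ?Fib l = (T (cd ?Fib2 k), FO ?G (cd ?Fib2 k)) \<and> FA u_Fib l = FA ?G k"
      using t G'(4-6)[OF k]
      by (intro bexI[of _ "(t, FA ?G k)"]) (simp_all add: Fib_cart_def u_Fib_def)
  qed
  have "ftor_eq ?Fib2 ((cod2 E \<circ>\<^sub>F u_Fib) \<circ>\<^sub>F P) (cod3 E \<circ>\<^sub>F times_ftor u_Fib)"
    using P(2) cod_Pi3[OF disc, folded Fib_cart_def, folded Fib_Fib_cart_def]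
    by (simp add: ftor_eq_def)
  \<comment> \<open>Every arrow of the right fibration \<open>?Fib\<close> is cartesian over
    \<open>E\<close>, so preservation of cartesian arrows is immediate.\<close>
  moreover have "cartesian_arrow ?Fib E (cod2 E \<circ>\<^sub>F u_Fib) (FA P k)"
    if "cartesian_arrow ?Fib2 E (cod3 E \<circ>\<^sub>F times_ftor u_Fib) k" for k
    using that Fib(2) is_functorD(4)[OF P(1)]
    by (auto simp: right_fibration_def cartesian_arrow_def[of ?Fib2])
  ultimately show ?thesis
    using P Fib(2) Fib2 by (auto simp: cartesian_functor_def intro: right_fibration_imp_fibration)
qed

end
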